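(* In the weighted Indian buffet model described in the context, let $\beta\in[0,1)$ and $B\in\mathcal{B}$, and let $L_n(B)=\mathrm{card}(B\cap S_n)$. If $\overline{R}_n:=\frac1n\sum_{i=1}^nR_i\to r$ almost surely for some constant $r$, then \[ \frac{L_n(B)}{a_n(\beta)}\longrightarrow m(B)\lambda(\beta)\quad\text{a.s.} \] Moreover, if in addition $\frac{\sum_{j=1}^n j^{\beta-1}E|\overline{R}_j-r|}{\sqrt{a_n(\beta)}}\to0$, then \[ \sqrt{a_n(\beta)}\Bigl\{\frac{L_n(B)}{a_n(\beta)}-m(B)\lambda(\beta)\Bigr\}\longrightarrow\mathcal{N}\bigl(0,m(B)\lambda(\beta)\bigr)\quad\text{stably}. \] Here $a_n(\beta)=\log n$ and $\lambda(\beta)=\alpha c/r$ if $\beta=0$, while $a_n(\beta)=n^\beta$ and $\lambda(\beta)=\frac{\alpha\Gamma(c+1)}{\Gamma(c+\beta)}\frac{1}{\beta r^{1-\beta}}$ if $\beta\in(0,1)$.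
   Context: Let $\mathcal{X}$ be a separable metric space with Borel $\sigma$-field $\mathcal{B}$, and let $\mathcal{M}$ be the set of finite positive measures on $\mathcal{B}$; $\mu\in\mathcal{M}$ is diffuse if $\mu\{x\}=0$ for all $x$. All random quantities live on a probability space $(\Omega,\mathcal{A},P)$. A random measure (r.m.) is a map $M:\Omega\to\mathcal{M}$ such that $\omega\mapsto M(\omega)(B)$ is measurable for each $B\in\mathcal{B}$. A Poisson r.m. with intensity $\nu\in\mathcal{M}$ is an r.m. $M$ with $M(B_1),\dots,M(B_k)$ independent for pairwise disjoint $B_j$ and $M(B)\sim\mathrm{Poi}(\nu(B))$ for all $B$ (with $\mathrm{Poi}(0)=\delta_0$). Each $\nu\in\mathcal{M}$ is uniquely $\nu=\nu_c+\nu_d$, $\nu_c$ diffuse, $\nu_d=\sum_j\gamma_j\delta_{x_j}$. $M\sim\mathrm{BeP}(\nu)$ (Bernoulli r.m. with hazard measure $\nu$) means $M=M_1+M_2$ with $M_1,M_2$ independent, $M_1$ Poisson with intensity $\nu_c$, $M_2=\sum_jV_j\delta_{x_j}$ with independent indicators $V_j$, $P(V_j=1)=\gamma_j$. "$X\mid\mathcal{G}\sim Y\mid\mathcal{G}$" means $P(X\in A\mid\mathcal{G})=P(Y\in A\mid\mathcal{G})$ a.s. for all measurable $A$. Model: fix a diffuse probability measure $m$ on $\mathcal{B}$ and reals $\alpha>0$, $\beta<1$, $c>-\beta$. $(M_n)_{n\ge1}$ are r.m.'s and $(R_n)_{n\ge1}$ real random variables such that for each $n\ge1$, $R_n$ is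 independent of $(M_1,\dots,M_n,R_1,\dots,R_{n-1})$ and $R_n\ge u$ for a constant $u>\max(\beta,0)$; and $M_{n+1}\mid\mathcal{F}_n\sim\mathrm{BeP}(\nu_n)$ for all $n\ge0$, where $\mathcal{F}_0=\{\varnothing,\Omega\}$, $\mathcal{F}_n=\sigma(M_1,\dots,M_n,R_1,\dots,R_n)$, $S_n=\{x: M_i\{x\}=1\text{ for some } i\le n\}$, $\nu_0=\alpha m$ and for $n\ge1$ \[ \nu_n=\sum_{x\in S_n}\frac{\sum_{i=1}^nR_iM_i\{x\}-\beta}{\sum_{i=1}^nR_i+c}\,\delta_x+\Lambda_n\, m,\qquad \Lambda_0=\alpha,\ \ \Lambda_n=\alpha\frac{\Gamma(c+1)\Gamma(c+\beta+\sum_{i=1}^nR_i)}{\Gamma(c+\beta)\Gamma(c+1+\sum_{i=1}^nR_i)}. \] Stable convergence: a kernel is an r.m. $K$ with $K(\omega)(\mathbb{R})=1$ for all $\omega$. Real random variables $X_n$ converge stably to $K$ if $E\{K(f)\mid H\}=\lim_nE\{f(X_n)\mid H\}$ for all $H\in\mathcal{A}$ with $P(H)>0$ and all bounded continuous $f$. $\mathcal{N}(0,a)$ is the Gaussian law with mean $0$ and variance $a\ge0$ ($\mathcal N(0,0)=\delta_0$), viewed as a constant kernel. *)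

theory Defs
  imports "HOL-Probability.Probability"
begin

text \<open>The measurable space of finite (positive) measures on the sigma-field of N, equipped with
  the sigma-field generated by the evaluation maps mu |-> mu(B), B in sets N
  (same construction as the library's subprob_algebra).\<close>
definition finite_measures :: "'a measure \<Rightarrow> 'a measure measure" where
  "finite_measures N =
    (SUP A \<in> sets N. vimage_algebra {\<mu>. finite_measure \<mu> \<and> sets \<mu> = sets N} (\<lambda>\<mu>. emeasure \<mu> A) borel)"

definition random_measure :: "'q measure \<Rightarrow> ('q \<Rightarrow> 'x::topological_space measure) \<Rightarrow> bool" where
  "random_measure Q N \<longleftrightarrow>
     (\<forall>\<omega>\<in>space Q. finite_measure (N \<omega>) \<and> sets (N \<omega>) = sets (borel :: 'x measure)) \<and>
     (\<forall>B\<in>sets (borel :: 'x measure). (\<lambda>\<omega>. measure (N \<omega>) B) \<in> borel_measurable Q)"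

text \<open>Poisson random measure with intensity given by the (finite) set function lam.
  Poi(0) is the Dirac mass at 0 (note 0^0 = 1).\<close>
definition poisson_rm :: "'q measure \<Rightarrow> ('q \<Rightarrow> 'x::topological_space measure) \<Rightarrow> ('x set \<Rightarrow> real) \<Rightarrow> bool" where
  "poisson_rm Q N lam \<longleftrightarrow>
     random_measure Q N \<and>
     (\<forall>(I::nat set) Bs. finite I \<longrightarrow> (\<forall>j\<in>I. Bs j \<in> sets (borel :: 'x measure)) \<longrightarrow>
        disjoint_family_on Bs I \<longrightarrow>
        prob_space.indep_vars Q (\<lambda>_. borel) (\<lambda>j \<omega>. measure (N \<omega>) (Bs j)) I) \<and>
     (\<forall>B\<in>sets (borel :: 'x measure). \<forall>k::nat.
        measure Q {\<omega>\<in>space Q. measure (N \<omega>) B = real k} = lam B ^ k / fact k * exp (- lam B))"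

definition atoms_of :: "'x measure \<Rightarrow> 'x set" where
  "atoms_of \<nu> = {x. measure \<nu> {x} \<noteq> 0}"

definition diffuse_part :: "'x measure \<Rightarrow> 'x set \<Rightarrow> real" where
  "diffuse_part \<nu> B = measure \<nu> B - (\<Sum>\<^sub>\<infinity>x\<in>atoms_of \<nu> \<inter> B. measure \<nu> {x})"

definition BeP_rm :: "'q measure \<Rightarrow> ('q \<Rightarrow> 'x::topological_space measure) \<Rightarrow> 'x measure \<Rightarrow> bool" where
  "BeP_rm Q N \<nu> \<longleftrightarrow>
     random_measure Q N \<and>
     (\<exists>N1 (V :: 'x \<Rightarrow> 'q \<Rightarrow> real).
        poisson_rm Q N1 (diffuse_part \<nu>) \<and>
        (\<forall>x\<in>atoms_of \<nu>. V x \<in> borel_measurable Q \<and> (\<forall>\<omega>\<in>space Q. V x \<omega> \<in> {0, 1}) \<and>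
            measure Q {\<omega>\<in>space Q. V x \<omega> = 1} = measure \<nu> {x}) \<and>
        prob_space.indep_vars Q (\<lambda>_. borel) V (atoms_of \<nu>) \<and>
        prob_space.indep_set Q
           (sets (vimage_algebra (space Q) N1 (finite_measures (borel :: 'x measure))))
           (sets (vimage_algebra (space Q) (\<lambda>\<omega>. restrict (\<lambda>x. V x \<omega>) (atoms_of \<nu>))
                    (PiM (atoms_of \<nu>) (\<lambda>_. borel :: real measure)))) \<and>
        (AE \<omega> in Q. \<forall>B\<in>sets (borel :: 'x measure).
            measure (N \<omega>) B = measure (N1 \<omega>) B + (\<Sum>\<^sub>\<infinity>x\<in>atoms_of \<nu> \<inter> B. V x \<omega>)))"

text \<open>The law BeP(nu) on the space of finite measures: the distribution of any N ~ BeP(nu)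
  (realized on some probability space; the pair type below is rich enough to carry N1 and N2).\<close>
definition BeP_law :: "'x::topological_space measure \<Rightarrow> 'x measure measure" where
  "BeP_law \<nu> = (THE D. \<exists>(Q :: ('x measure \<times> 'x measure) measure) N.
      prob_space Q \<and> BeP_rm Q N \<nu> \<and> D = distr Q (finite_measures (borel :: 'x measure)) N)"

definition gen_sigma :: "'o measure \<Rightarrow> (nat \<Rightarrow> 'o \<Rightarrow> 'x::topological_space measure) \<Rightarrow> (nat \<Rightarrow> 'o \<Rightarrow> real)
     \<Rightarrow> nat \<Rightarrow> nat \<Rightarrow> 'o measure" where
  "gen_sigma P M R n k = sigma (space P)
     ({{\<omega>\<in>space P. measure (M i \<omega>) B \<in> C} | i B C. i \<in> {1..n} \<and> B \<in> sets (borel :: 'x measure) \<and> C \<in> sets (borel :: real measure)} \<union>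
      {{\<omega>\<in>space P. R i \<omega> \<in> C} | i C. i \<in> {1..k} \<and> C \<in> sets (borel :: real measure)})"

definition filt :: "'o measure \<Rightarrow> (nat \<Rightarrow> 'o \<Rightarrow> 'x::topological_space measure) \<Rightarrow> (nat \<Rightarrow> 'o \<Rightarrow> real)
     \<Rightarrow> nat \<Rightarrow> 'o measure" where
  "filt P M R n = gen_sigma P M R n n"

definition feat :: "(nat \<Rightarrow> 'o \<Rightarrow> 'x measure) \<Rightarrow> nat \<Rightarrow> 'o \<Rightarrow> 'x set" where
  "feat M n \<omega> = {x. \<exists>i\<in>{1..n}. measure (M i \<omega>) {x} = 1}"

definition Lambda_n :: "real \<Rightarrow> real \<Rightarrow> real \<Rightarrow> real \<Rightarrow> real" where
  "Lambda_n \<alpha> \<beta> c s = \<alpha> * (Gamma (c + 1) * Gamma (c + \<beta> + s)) / (Gamma (c + \<beta>) * Gamma (c + 1 + s))"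

text \<open>The hazard measure nu_n(omega). For n = 0 it reduces to alpha m (S_0 empty, Lambda_0 = alpha).\<close>
definition ibp_nu :: "'x::topological_space measure \<Rightarrow> real \<Rightarrow> real \<Rightarrow> real \<Rightarrow> (nat \<Rightarrow> 'o \<Rightarrow> 'x measure)
     \<Rightarrow> (nat \<Rightarrow> 'o \<Rightarrow> real) \<Rightarrow> nat \<Rightarrow> 'o \<Rightarrow> 'x measure" where
  "ibp_nu m \<alpha> \<beta> c M R n \<omega> =
     measure_of UNIV (sets (borel :: 'x measure))
       (\<lambda>B. ennreal ((\<Sum>x\<in>feat M n \<omega> \<inter> B.
               ((\<Sum>i=1..n. R i \<omega> * measure (M i \<omega>) {x}) - \<beta>) / ((\<Sum>i=1..n. R i \<omega>) + c))
             + Lambda_n \<alpha> \<beta> c (\<Sum>i=1..n. R i \<omega>) * measure m B))"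

definition kernel :: "('o \<Rightarrow> real measure) \<Rightarrow> bool" where
  "kernel K \<longleftrightarrow> (\<forall>\<omega>. sets (K \<omega>) = sets (borel :: real measure) \<and> emeasure (K \<omega>) UNIV = 1)"

definition stably_to :: "'o measure \<Rightarrow> (nat \<Rightarrow> 'o \<Rightarrow> real) \<Rightarrow> ('o \<Rightarrow> real measure) \<Rightarrow> bool" where
  "stably_to P X K \<longleftrightarrow>
     (\<forall>H\<in>sets P. measure P H > 0 \<longrightarrow>
       (\<forall>f :: real \<Rightarrow> real. continuous_on UNIV f \<longrightarrow> bounded (range f) \<longrightarrow>
          (\<lambda>n. (\<integral>\<omega>. f (X n \<omega>) * indicator H \<omega> \<partial>P) / measure P H)
            \<longlonglongrightarrow> (\<integral>\<omega>. (\<integral>x. f x \<partial>K \<omega>) * indicator H \<omega> \<partial>P) / measure P H))"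

definition gauss0 :: "real \<Rightarrow> real measure" where
  "gauss0 a = (if a = 0 then return borel 0 else density lborel (normal_density 0 (sqrt a)))"

definition a_seq :: "real \<Rightarrow> nat \<Rightarrow> real" where
  "a_seq \<beta> n = (if \<beta> = 0 then ln (real n) else real n powr \<beta>)"

definition lam_const :: "real \<Rightarrow> real \<Rightarrow> real \<Rightarrow> real \<Rightarrow> real" where
  "lam_const \<alpha> \<beta> c r = (if \<beta> = 0 then \<alpha> * c / r
      else \<alpha> * Gamma (c + 1) / Gamma (c + \<beta>) * (1 / (\<beta> * r powr (1 - \<beta>))))"

end

theory Submission
  imports Defs "HOL-Real_Asymp.Real_Asymp"
begin

text \<open>
  Let N be the number of features in B and let C be its compensator, the sum of the increments
  m(B) \<Lambda>_j. Conditionally on the past, the number of new features in B is Poisson with mean m(B) \<Lambda>_n: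
  the atoms of the hazard measure sit on the old features and its diffuse part charges no fixed finite set.
  Hence exp(z N - (exp z - 1) C) has martingale increments for every complex z.

  For real z, the Chernoff bound makes the deviations of N - C of order a_n summable along the times at
  which a_n first reaches an integer, monotonicity of N fills the gaps, and C / a_n converges because
  \<Lambda>_j is asymptotic to a multiple of (r j)^(\<beta> - 1).

  For z = i t / sqrt(a_n), the martingale property gives the limit of E(exp(i t Z_n); H) for the events H
  of the past, where Z_n is the normalised error: the rate condition says that C differs from its
  deterministic limit by o(sqrt(a_n)) in L1. The limit extends to all events because Z_n is adapted, so that H may be
  replaced by its conditional probability, and this is stable convergence by Levy's theorem.
\<close>

section \<open>Finite measures and finite kernels\<close>

lemma space_finite_measures: "space (finite_measures N) = {\<mu>. finite_measure \<mu> \<and> sets \<mu> = sets N}"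
  by (auto simp: finite_measures_def space_Sup_eq_UN)

lemma finite_measuresD:
  assumes "\<mu> \<in> space (finite_measures N)"
  shows "finite_measure \<mu>" "sets \<mu> = sets N" "space \<mu> = space N"
  using assms by (auto simp: space_finite_measures dest: sets_eq_imp_space_eq)

lemma finite_measures_cong: "sets M = sets N \<Longrightarrow> finite_measures M = finite_measures N"
  by (simp add: finite_measures_def)

lemma measurable_emeasure_finite_measures[measurable]:
  "A \<in> sets N \<Longrightarrow> (\<lambda>\<mu>. emeasure \<mu> A) \<in> borel_measurable (finite_measures N)"
  by (auto intro!: measurable_Sup1 measurable_vimage_algebra1 simp: finite_measures_def)

lemma measurable_measure_finite_measures[measurable]:
  "A \<in> sets N \<Longrightarrow> (\<lambda>\<mu>. measure \<mu> A) \<in> borel_measurable (finite_measures N)"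
  unfolding measure_def by measurable

lemma measurable_finite_measures:
  assumes K: "\<And>x. x \<in> space M \<Longrightarrow> K x \<in> space (finite_measures N)"
    and meas: "\<And>A. A \<in> sets N \<Longrightarrow> (\<lambda>x. measure (K x) A) \<in> borel_measurable M"
  shows "K \<in> measurable M (finite_measures N)"
proof -
  have "(\<lambda>x. emeasure (K x) A) \<in> borel_measurable M" if A: "A \<in> sets N" for A
  proof -
    have "(\<lambda>x. ennreal (measure (K x) A)) \<in> borel_measurable M"
      using meas[OF A] by measurable
    then show ?thesis
      by (rule measurable_cong[THEN iffD1, rotated])
         (use finite_measuresD(1)[OF K] in \<open>simp add: finite_measure.emeasure_eq_measure\<close>)
  qed
  moreover have "K \<in> space M \<rightarrow> {\<mu>. finite_measure \<mu> \<and> sets \<mu> = sets N}"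
    using K by (auto simp: space_finite_measures)
  ultimately show ?thesis
    by (auto intro!: measurable_Sup2 measurable_vimage_algebra2 simp: finite_measures_def)
qed

lemma random_measure_iff_measurable:
  "random_measure Q N \<longleftrightarrow> N \<in> measurable Q (finite_measures borel)"
proof
  assume "random_measure Q N"
  then show "N \<in> measurable Q (finite_measures borel)"
    by (intro measurable_finite_measures) (auto simp: random_measure_def space_finite_measures)
next
  assume N[measurable]: "N \<in> measurable Q (finite_measures borel)"
  then show "random_measure Q N"
    using finite_measuresD(1,2)[OF measurable_space[OF N]] by (auto simp: random_measure_def)
qed

text \<open>Normalising the total mass reduces finite kernels to the sub-Markov kernels of the library.\<close>

lemma measurable_scale_finite_kernel:
  assumes K[measurable]: "K \<in> measurable M (finite_measures N)" and ne: "space N \<noteq> {}"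
  shows "(\<lambda>x. scale_measure (ennreal (inverse (1 + measure (K x) (space N)))) (K x)) \<in> measurable M (subprob_algebra N)"
    (is "?L \<in> _")
proof (rule measurable_subprob_algebra)
  fix x assume "x \<in> space M"
  then have K': "K x \<in> space (finite_measures N)"
    by (rule measurable_space[OF K])
  note Kx = finite_measuresD[OF K']
  interpret finite_measure "K x" by (rule Kx)
  have "emeasure (?L x) (space N) = ennreal (measure (K x) (space N) / (1 + measure (K x) (space N)))"
    by (simp add: emeasure_eq_measure ennreal_mult[symmetric] divide_inverse mult.commute)
  also have "\<dots> \<le> 1"
    by (simp add: divide_le_eq_1 add_pos_nonneg)
  finally show "subprob_space (?L x)"
    using ne by (intro subprob_spaceI) (auto simp: space_scale_measure Kx)
  show "sets (?L x) = sets N"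
    by (simp add: Kx)
qed simp

lemma measurable_measure_finite_kernel:
  assumes A: "(SIGMA x:space M. A x) \<in> sets (M \<Otimes>\<^sub>M N)"
    and K[measurable]: "K \<in> measurable M (finite_measures N)"
  shows "(\<lambda>x. measure (K x) (A x)) \<in> borel_measurable M"
proof (cases "space N = {}")
  case True
  then have "measure (K x) (A x) = 0" if "x \<in> space M" for x
    using finite_measuresD(3)[OF measurable_space[OF K that]]
    by (metis measure_empty measure_notin_sets sets.sets_into_space subset_empty)
  then show ?thesis
    by (simp cong: measurable_cong)
next
  case False
  define t where "t x = 1 + measure (K x) (space N)" for x
  have t: "0 < t x" for x
    by (simp add: t_def add_pos_nonneg)
  have "(\<lambda>x. t x * measure (scale_measure (ennreal (inverse (t x))) (K x)) (A x)) \<in> borel_measurable M"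
    unfolding t_def
    by (intro borel_measurable_times measure_measurable_subprob_algebra2[OF A measurable_scale_finite_kernel[OF K False]])
      measurable
  moreover have "t x * measure (scale_measure (ennreal (inverse (t x))) (K x)) (A x) = measure (K x) (A x)" for x
    using t[of x] by (simp add: measure_def enn2real_mult)
  ultimately show ?thesis
    by simp
qed

lemma measurable_point_mass:
  fixes K :: "'a \<Rightarrow> 'x::{metric_space, second_countable_topology} measure"
  assumes K: "K \<in> measurable M (finite_measures borel)"
  shows "(\<lambda>p. measure (K (fst p)) {snd p}) \<in> borel_measurable (M \<Otimes>\<^sub>M borel)"
proof (rule measurable_measure_finite_kernel)
  have "(SIGMA p:space (M \<Otimes>\<^sub>M borel). {snd p}) = {q \<in> space ((M \<Otimes>\<^sub>M borel) \<Otimes>\<^sub>M borel). dist (snd (fst q)) (snd q :: 'x) = 0}"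
    by (auto simp: space_pair_measure)
  also have "\<dots> \<in> sets ((M \<Otimes>\<^sub>M borel) \<Otimes>\<^sub>M borel)"
    by measurable
  finally show "(SIGMA p:space (M \<Otimes>\<^sub>M borel). {snd p :: 'x}) \<in> sets ((M \<Otimes>\<^sub>M borel) \<Otimes>\<^sub>M borel)" .
  show "(\<lambda>p. K (fst p)) \<in> measurable (M \<Otimes>\<^sub>M borel) (finite_measures borel)"
    using measurable_compose[OF measurable_fst K] .
qed

section \<open>Simple point measures\<close>

definition simple_point_measure :: "'x measure \<Rightarrow> bool" where
  "simple_point_measure \<mu> \<longleftrightarrow> (AE x in \<mu>. measure \<mu> {x} = 1)"

definition unit_atoms :: "'x measure \<Rightarrow> 'x set" where
  "unit_atoms \<mu> = {x. measure \<mu> {x} = 1}"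

lemma pred_simple_point_measure[measurable]:
  "Measurable.pred (finite_measures borel) (simple_point_measure :: 'x::{metric_space, second_countable_topology} measure \<Rightarrow> bool)"
proof -
  let ?F = "finite_measures (borel :: 'x measure)"
  have id: "(\<lambda>\<mu>. \<mu>) \<in> measurable ?F ?F"
    by simp
  note [measurable] = measurable_point_mass[OF id]
  have "(SIGMA \<mu>:space ?F. - unit_atoms \<mu>) = {p \<in> space (?F \<Otimes>\<^sub>M borel). measure (fst p) {snd p} \<noteq> 1}"
    by (auto simp: space_pair_measure unit_atoms_def)
  also have "\<dots> \<in> sets (?F \<Otimes>\<^sub>M borel)"
    by measurable
  finally have sect: "(SIGMA \<mu>:space ?F. - unit_atoms \<mu>) \<in> sets (?F \<Otimes>\<^sub>M borel)" .
  have [measurable]: "(\<lambda>\<mu>. measure \<mu> (- unit_atoms \<mu>)) \<in> borel_measurable ?F"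
    by (rule measurable_measure_finite_kernel[OF sect id])
  have "Measurable.pred ?F (\<lambda>\<mu>. measure \<mu> (- unit_atoms \<mu>) = 0)"
    by measurable
  then show ?thesis
  proof (rule measurable_cong[THEN iffD1, rotated])
    fix \<mu> :: "'x measure" assume \<mu>: "\<mu> \<in> space ?F"
    interpret finite_measure \<mu> by (rule finite_measuresD[OF \<mu>])
    have "Pair \<mu> -` (SIGMA \<mu>:space ?F. - unit_atoms \<mu>) \<in> sets borel"
      using sect by (rule sets_Pair1)
    then have "- unit_atoms \<mu> \<in> sets \<mu>"
      using \<mu> by (simp add: finite_measuresD vimage_def Compl_eq)
    then show "measure \<mu> (- unit_atoms \<mu>) = 0 \<longleftrightarrow> simple_point_measure \<mu>"
      using finite_measuresD(3)[OF \<mu>]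
      by (subst simple_point_measure_def, subst AE_iff_measurable[of "- unit_atoms \<mu>"])
         (auto simp: emeasure_eq_measure unit_atoms_def)
  qed
qed

lemma measure_finite_subset_unit_atoms:
  assumes \<mu>: "\<mu> \<in> space (finite_measures (borel :: 'x::t1_space measure))"
    and A: "finite A" "A \<subseteq> unit_atoms \<mu>"
  shows "measure \<mu> A = real (card A)"
proof -
  interpret finite_measure \<mu> by (rule finite_measuresD[OF \<mu>])
  have "measure \<mu> A = (\<Sum>x\<in>A. measure \<mu> {x})"
    using A(1) \<mu> by (intro finite_measure_eq_sum_singleton) (auto simp: finite_measuresD)
  also have "\<dots> = real (card A)"
    using A(2) by (simp add: unit_atoms_def subset_iff)
  finally show ?thesis .
qed

lemma finite_unit_atoms:
  assumes \<mu>: "\<mu> \<in> space (finite_measures (borel :: 'x::t1_space measure))"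
  shows "finite (unit_atoms \<mu>)"
proof (rule ccontr)
  interpret finite_measure \<mu> by (rule finite_measuresD[OF \<mu>])
  assume "infinite (unit_atoms \<mu>)"
  then obtain F where F: "finite F" "card F = Suc (nat \<lceil>measure \<mu> (space \<mu>)\<rceil>)" "F \<subseteq> unit_atoms \<mu>"
    using infinite_arbitrarily_large by blast
  then have "real (Suc (nat \<lceil>measure \<mu> (space \<mu>)\<rceil>)) = measure \<mu> F"
    using measure_finite_subset_unit_atoms[OF \<mu> F(1,3)] by simp
  then show False
    using bounded_measure[of F] by linarith
qed

lemma measure_simple_point_measure:
  assumes \<mu>: "\<mu> \<in> space (finite_measures (borel :: 'x::t1_space measure))" and simple: "simple_point_measure \<mu>"
    and A: "A \<in> sets borel"
  shows "measure \<mu> A = real (card (A \<inter> unit_atoms \<mu>))"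
proof -
  interpret finite_measure \<mu> by (rule finite_measuresD[OF \<mu>])
  have fin: "finite (A \<inter> unit_atoms \<mu>)"
    using finite_unit_atoms[OF \<mu>] by simp
  have "measure \<mu> A = measure \<mu> (A \<inter> unit_atoms \<mu>)"
    using simple A fin \<mu>
    by (intro finite_measure_eq_AE) (auto simp: simple_point_measure_def unit_atoms_def finite_measuresD borel_closed finite_imp_closed)
  also have "\<dots> = real (card (A \<inter> unit_atoms \<mu>))"
    by (intro measure_finite_subset_unit_atoms[OF \<mu> fin]) simp
  finally show ?thesis .
qed

lemma simple_point_measure_singleton:
  assumes "\<mu> \<in> space (finite_measures (borel :: 'x::t1_space measure))" "simple_point_measure \<mu>"
  shows "measure \<mu> {x} \<in> {0, 1}"
proof -
  have "card ({x} \<inter> unit_atoms \<mu>) \<le> 1"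
    using card_mono[of "{x}" "{x} \<inter> unit_atoms \<mu>"] by simp
  then show ?thesis
    using measure_simple_point_measure[OF assms, of "{x}"] by auto
qed

section \<open>The law of a random measure\<close>

definition values_on_sets :: "'a measure \<Rightarrow> 'a measure \<Rightarrow> 'a set \<Rightarrow> real" where
  "values_on_sets N \<mu> = (\<lambda>A\<in>sets N. measure \<mu> A)"

lemma measurable_values_on_sets[measurable]:
  "values_on_sets N \<in> measurable (finite_measures N) (PiM (sets N) (\<lambda>_. borel))"
  unfolding values_on_sets_def by (intro measurable_restrict measurable_measure_finite_measures)

lemma sets_finite_measures_eq_vimage:
  "sets (finite_measures N) = {values_on_sets N -` X \<inter> space (finite_measures N) | X. X \<in> sets (PiM (sets N) (\<lambda>_. borel))}"
    (is "_ = ?R")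
proof
  let ?PN = "PiM (sets N) (\<lambda>_. borel :: real measure)"
  let ?V = "vimage_algebra (space (finite_measures N)) (values_on_sets N) ?PN"
  have V: "sets ?V = ?R"
    by (intro sets_vimage_algebra2 measurable_space[OF measurable_values_on_sets, THEN Pi_I])
  have val: "values_on_sets N \<in> measurable ?V ?PN"
    by (intro measurable_vimage_algebra1 Pi_I measurable_space[OF measurable_values_on_sets])
  have "(\<lambda>\<mu>. \<mu>) \<in> measurable ?V (finite_measures N)"
  proof (rule measurable_finite_measures)
    fix A assume A: "A \<in> sets N"
    have "(\<lambda>\<mu>. values_on_sets N \<mu> A) \<in> borel_measurable ?V"
      using measurable_compose[OF val measurable_component_singleton[OF A]] .
    then show "(\<lambda>\<mu>. measure \<mu> A) \<in> borel_measurable ?V"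
      using A by (simp add: values_on_sets_def)
  qed simp
  then show "sets (finite_measures N) \<subseteq> ?R"
    unfolding V[symmetric] using measurable_sets[of "\<lambda>\<mu>. \<mu>" ?V "finite_measures N"] sets.sets_into_space
    by (fastforce simp: Int_absorb2)
  show "?R \<subseteq> sets (finite_measures N)"
    using measurable_sets[OF measurable_values_on_sets] by blast
qed

definition boolean_atom :: "'a measure \<Rightarrow> 'a set set \<Rightarrow> 'a set set \<Rightarrow> 'a set" where
  "boolean_atom N J T = {x \<in> space N. \<forall>A\<in>J. x \<in> A \<longleftrightarrow> A \<in> T}"

lemma sets_boolean_atom:
  assumes "finite J" "J \<subseteq> sets N"
  shows "boolean_atom N J T \<in> sets N"
  unfolding boolean_atom_def
proof (rule sets.sets_Collect_finite_All)
  fix A assume "A \<in> J"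
  then have [measurable]: "A \<in> sets N"
    using assms by auto
  show "{x \<in> space N. x \<in> A \<longleftrightarrow> A \<in> T} \<in> sets N"
    by measurable
qed (rule assms)

lemma disjoint_boolean_atom: "disjoint_family_on (boolean_atom N J) (Pow J)"
  unfolding disjoint_family_on_def
proof (intro ballI impI)
  fix S T assume "S \<in> Pow J" "T \<in> Pow J" "S \<noteq> T"
  then obtain A where "A \<in> J" "A \<in> S \<longleftrightarrow> A \<notin> T"
    by blast
  then show "boolean_atom N J S \<inter> boolean_atom N J T = {}"
    by (auto simp: boolean_atom_def)
qed

lemma measure_eq_sum_boolean_atom:
  assumes \<mu>: "\<mu> \<in> space (finite_measures N)" and J: "finite J" "J \<subseteq> sets N" and A: "A \<in> J"
  shows "measure \<mu> A = (\<Sum>T | T \<subseteq> J \<and> A \<in> T. measure \<mu> (boolean_atom N J T))"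
proof -
  interpret finite_measure \<mu> by (rule finite_measuresD[OF \<mu>])
  have "A = (\<Union>T\<in>{T. T \<subseteq> J \<and> A \<in> T}. boolean_atom N J T)"
  proof (intro set_eqI iffI)
    fix x assume "x \<in> A"
    moreover have "x \<in> space N"
      using \<open>x \<in> A\<close> A J(2) sets.sets_into_space by blast
    ultimately show "x \<in> (\<Union>T\<in>{T. T \<subseteq> J \<and> A \<in> T}. boolean_atom N J T)"
      using A by (intro UN_I[of "{A'\<in>J. x \<in> A'}"]) (auto simp: boolean_atom_def)
  qed (use A in \<open>auto simp: boolean_atom_def\<close>)
  moreover have "measure \<mu> (\<Union>T\<in>{T. T \<subseteq> J \<and> A \<in> T}. boolean_atom N J T)
      = (\<Sum>T | T \<subseteq> J \<and> A \<in> T. measure \<mu> (boolean_atom N J T))"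
    using J(1) \<mu> sets_boolean_atom[OF J]
    by (intro finite_measure_finite_Union disjoint_family_on_mono[OF _ disjoint_boolean_atom])
       (auto simp: finite_measuresD)
  ultimately show ?thesis
    by simp
qed

text \<open>Every finite family of sets consists of unions of the atoms of the algebra that it
  generates, so the joint laws over disjoint families determine the law of a random measure.\<close>

lemma emeasure_distr_cylinder_eq:
  fixes h :: "nat \<Rightarrow> 'a set set"
  assumes L[measurable]: "L \<in> measurable R (finite_measures N)"
    and J: "finite J" "J \<subseteq> sets N" and C: "\<And>A. A \<in> J \<Longrightarrow> C A \<in> sets borel"
    and h: "bij_betw h {..<n} (Pow J)"
  shows "emeasure R {\<omega>\<in>space R. \<forall>A\<in>J. measure (L \<omega>) A \<in> C A}
    = emeasure (distr R (PiM {..<n} (\<lambda>_. borel)) (\<lambda>\<omega>. \<lambda>j\<in>{..<n}. measure (L \<omega>) (boolean_atom N J (h j))))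
        {v \<in> space (PiM {..<n} (\<lambda>_. borel)). \<forall>A\<in>J. (\<Sum>j | j < n \<and> A \<in> h j. v j) \<in> C A}"
    (is "_ = emeasure (distr R ?PI ?X) ?W")
proof -
  have atom: "boolean_atom N J T \<in> sets N" for T
    using J by (rule sets_boolean_atom)
  have X[measurable]: "?X \<in> measurable R ?PI"
    by (intro measurable_restrict measurable_compose[OF L measurable_measure_finite_measures[OF atom]])
  have W: "?W \<in> sets ?PI"
  proof (rule sets.sets_Collect_finite_All[OF _ J(1)])
    fix A assume "A \<in> J"
    then have [measurable]: "C A \<in> sets borel"
      by (rule C)
    have [measurable]: "(\<lambda>v. \<Sum>j | j < n \<and> A \<in> h j. v j) \<in> borel_measurable ?PI"
      by (intro borel_measurable_sum measurable_component_singleton) auto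
    show "{v \<in> space ?PI. (\<Sum>j | j < n \<and> A \<in> h j. v j) \<in> C A} \<in> sets ?PI"
      by measurable
  qed
  have "(\<Sum>j | j < n \<and> A \<in> h j. ?X \<omega> j) = measure (L \<omega>) A" if "\<omega> \<in> space R" "A \<in> J" for \<omega> A
  proof -
    have "bij_betw h {j. j < n \<and> A \<in> h j} {T. T \<subseteq> J \<and> A \<in> T}"
      using h by (auto simp: bij_betw_def inj_on_def image_iff) blast
    then have "(\<Sum>j | j < n \<and> A \<in> h j. measure (L \<omega>) (boolean_atom N J (h j)))
        = (\<Sum>T | T \<subseteq> J \<and> A \<in> T. measure (L \<omega>) (boolean_atom N J T))"
      by (rule sum.reindex_bij_betw)
    also have "\<dots> = measure (L \<omega>) A"
      using measure_eq_sum_boolean_atom[OF measurable_space[OF L that(1)] J that(2)] by simp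
    finally show ?thesis
      by simp
  qed
  then have "{\<omega>\<in>space R. \<forall>A\<in>J. measure (L \<omega>) A \<in> C A} = ?X -` ?W \<inter> space R"
    using measurable_space[OF X] by auto
  then show ?thesis
    using W by (simp add: emeasure_distr)
qed

lemma emeasure_distr_values_on_sets_prod_emb:
  assumes L[measurable]: "L \<in> measurable R (finite_measures N)"
    and J: "finite J" "J \<subseteq> sets N" and C: "\<And>A. A \<in> J \<Longrightarrow> C A \<in> sets borel"
  shows "emeasure (distr R (PiM (sets N) (\<lambda>_. borel)) (\<lambda>\<omega>. values_on_sets N (L \<omega>)))
      (prod_emb (sets N) (\<lambda>_. borel) J (PiE J C))
    = emeasure R {\<omega>\<in>space R. \<forall>A\<in>J. measure (L \<omega>) A \<in> C A}"
proof -
  have "values_on_sets N \<mu> \<in> prod_emb (sets N) (\<lambda>_. borel) J (PiE J C) \<longleftrightarrow> (\<forall>A\<in>J. measure \<mu> A \<in> C A)" for \<mu>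
  proof -
    have "restrict (values_on_sets N \<mu>) J = restrict (measure \<mu>) J"
      using J(2) by (auto simp: values_on_sets_def restrict_def fun_eq_iff)
    then show ?thesis
      unfolding prod_emb_iff by (simp only: restrict_PiE_iff) (simp add: values_on_sets_def)
  qed
  then have "(\<lambda>\<omega>. values_on_sets N (L \<omega>)) -` prod_emb (sets N) (\<lambda>_. borel) J (PiE J C) \<inter> space R
      = {\<omega>\<in>space R. \<forall>A\<in>J. measure (L \<omega>) A \<in> C A}"
    by auto
  moreover have "prod_emb (sets N) (\<lambda>_. borel) J (PiE J C) \<in> sets (PiM (sets N) (\<lambda>_. borel))"
    using J C by (intro sets_PiM_I) auto
  moreover have "(\<lambda>\<omega>. values_on_sets N (L \<omega>)) \<in> measurable R (PiM (sets N) (\<lambda>_. borel))"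
    by measurable
  ultimately show ?thesis
    by (simp only: emeasure_distr)
qed

lemma distr_finite_measures_eq_of_values:
  assumes L[measurable]: "L \<in> measurable Q (finite_measures N)"
    and L'[measurable]: "L' \<in> measurable Q' (finite_measures N)"
    and eq: "distr Q (PiM (sets N) (\<lambda>_. borel)) (\<lambda>\<omega>. values_on_sets N (L \<omega>))
      = distr Q' (PiM (sets N) (\<lambda>_. borel)) (\<lambda>\<omega>. values_on_sets N (L' \<omega>))"
  shows "distr Q (finite_measures N) L = distr Q' (finite_measures N) L'"
proof (rule measure_eqI)
  fix Y assume "Y \<in> sets (distr Q (finite_measures N) L)"
  then have Y: "Y \<in> sets (finite_measures N)"
    by simp
  then obtain X where X: "X \<in> sets (PiM (sets N) (\<lambda>_. borel))"
    and Y_eq: "Y = values_on_sets N -` X \<inter> space (finite_measures N)"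
    unfolding sets_finite_measures_eq_vimage by blast
  have "emeasure (distr R (finite_measures N) K) Y
      = emeasure (distr R (PiM (sets N) (\<lambda>_. borel)) (\<lambda>\<omega>. values_on_sets N (K \<omega>))) X"
    if K[measurable]: "K \<in> measurable R (finite_measures N)" for R :: "'s measure" and K
  proof -
    have "K -` Y \<inter> space R = (\<lambda>\<omega>. values_on_sets N (K \<omega>)) -` X \<inter> space R"
      using measurable_space[OF K] by (auto simp: Y_eq)
    moreover have "(\<lambda>\<omega>. values_on_sets N (K \<omega>)) \<in> measurable R (PiM (sets N) (\<lambda>_. borel))"
      by measurable
    ultimately show ?thesis
      by (simp only: emeasure_distr[OF K Y] emeasure_distr[OF _ X])
  qed
  from this[OF L] this[OF L'] show "emeasure (distr Q (finite_measures N) L) Y = emeasure (distr Q' (finite_measures N) L') Y"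
    by (simp only: eq)
qed simp

lemma distr_finite_measures_eqI:
  fixes N :: "'x measure"
  assumes "finite_measure Q"
    and L[measurable]: "L \<in> measurable Q (finite_measures N)"
    and L'[measurable]: "L' \<in> measurable Q' (finite_measures N)"
    and eq: "\<And>(n::nat) A. (\<And>j. j < n \<Longrightarrow> A j \<in> sets N) \<Longrightarrow> disjoint_family_on A {..<n} \<Longrightarrow>
      distr Q (PiM {..<n} (\<lambda>_. borel)) (\<lambda>\<omega>. \<lambda>j\<in>{..<n}. measure (L \<omega>) (A j))
      = distr Q' (PiM {..<n} (\<lambda>_. borel)) (\<lambda>\<omega>. \<lambda>j\<in>{..<n}. measure (L' \<omega>) (A j))"
  shows "distr Q (finite_measures N) L = distr Q' (finite_measures N) L'"
proof (intro distr_finite_measures_eq_of_values L L' measure_eqI_PiM_infinite)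
  interpret Q: finite_measure Q by fact
  show "finite_measure (distr Q (PiM (sets N) (\<lambda>_. borel)) (\<lambda>\<omega>. values_on_sets N (L \<omega>)))"
    by (intro Q.finite_measure_distr) measurable
  fix C :: "'x set \<Rightarrow> real set" and J
  assume J: "finite J" "J \<subseteq> sets N" and C: "\<And>A. A \<in> J \<Longrightarrow> C A \<in> sets borel"
  obtain h where h: "bij_betw h {..<card (Pow J)} (Pow J)"
    using ex_bij_betw_nat_finite[of "Pow J"] J(1) by (auto simp: atLeast0LessThan)
  have "disjoint_family_on (\<lambda>j. boolean_atom N J (h j)) {..<card (Pow J)}"
    unfolding disjoint_family_on_def
  proof (intro ballI impI)
    fix i j assume "i \<in> {..<card (Pow J)}" "j \<in> {..<card (Pow J)}" "i \<noteq> j"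
    then have "h i \<in> Pow J" "h j \<in> Pow J" "h i \<noteq> h j"
      using bij_betwE[OF h] bij_betw_imp_inj_on[OF h] by (auto dest: inj_onD)
    then show "boolean_atom N J (h i) \<inter> boolean_atom N J (h j) = {}"
      by (rule disjoint_family_onD[OF disjoint_boolean_atom])
  qed
  note eq_atoms = eq[OF sets_boolean_atom[OF J] this]
  show "emeasure (distr Q (PiM (sets N) (\<lambda>_. borel)) (\<lambda>\<omega>. values_on_sets N (L \<omega>))) (prod_emb (sets N) (\<lambda>_. borel) J (PiE J C))
      = emeasure (distr Q' (PiM (sets N) (\<lambda>_. borel)) (\<lambda>\<omega>. values_on_sets N (L' \<omega>))) (prod_emb (sets N) (\<lambda>_. borel) J (PiE J C))"
    by (simp only: emeasure_distr_values_on_sets_prod_emb[OF L J C] emeasure_distr_values_on_sets_prod_emb[OF L' J C]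
        emeasure_distr_cylinder_eq[OF L J C h] emeasure_distr_cylinder_eq[OF L' J C h] eq_atoms)
qed simp_all

section \<open>Random variables with values in the natural numbers\<close>

lemma (in prob_space) prob_sums_nat_valued:
  assumes X[measurable]: "X \<in> borel_measurable M" and nat: "AE \<omega> in M. X \<omega> \<in> \<nat>" and E: "E \<in> events"
  shows "(\<lambda>q. prob {\<omega>\<in>E. X \<omega> = real q}) sums prob E"
proof -
  have meas: "{\<omega>\<in>E. X \<omega> = real q} \<in> events" for q
  proof -
    have "{\<omega>\<in>E. X \<omega> = real q} = E \<inter> {\<omega>\<in>space M. X \<omega> = real q}"
      using sets.sets_into_space[OF E] by auto
    also have "\<dots> \<in> events"
      using E by measurable
    finally show ?thesis .
  qed
  then have "(\<lambda>q. prob {\<omega>\<in>E. X \<omega> = real q}) sums prob (\<Union>q. {\<omega>\<in>E. X \<omega> = real q})"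
    by (intro finite_measure_UNION) (auto simp: disjoint_family_on_def)
  also have "prob (\<Union>q. {\<omega>\<in>E. X \<omega> = real q}) = prob E"
  proof (rule finite_measure_eq_AE)
    show "AE \<omega> in M. \<omega> \<in> (\<Union>q. {\<omega>\<in>E. X \<omega> = real q}) \<longleftrightarrow> \<omega> \<in> E"
      using nat by eventually_elim (auto elim: Nats_cases)
  qed (use meas E in auto)
  finally show ?thesis .
qed

lemma (in prob_space) AE_nat_valued:
  assumes [measurable]: "X \<in> borel_measurable M"
    and p: "\<And>k. prob {\<omega>\<in>space M. X \<omega> = real k} = p k" "p sums 1"
  shows "AE \<omega> in M. X \<omega> \<in> \<nat>"
proof -
  have "(\<lambda>k. prob {\<omega>\<in>space M. X \<omega> = real k}) sums prob (\<Union>k. {\<omega>\<in>space M. X \<omega> = real k})"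
    by (intro finite_measure_UNION) (auto simp: disjoint_family_on_def)
  with p have "prob (\<Union>k. {\<omega>\<in>space M. X \<omega> = real k}) = 1"
    by (simp add: sums_unique2)
  then have "AE \<omega> in M. \<omega> \<in> (\<Union>k. {\<omega>\<in>space M. X \<omega> = real k})"
    by (subst (asm) prob_eq_1) auto
  then show ?thesis
    by eventually_elim auto
qed

definition nat_law :: "(nat \<Rightarrow> real) \<Rightarrow> real measure" where
  "nat_law p = distr (density (count_space UNIV) (\<lambda>k. ennreal (p k))) borel real"

lemma (in prob_space) distr_eq_nat_law:
  assumes X[measurable]: "X \<in> borel_measurable M"
    and p: "\<And>k. prob {\<omega>\<in>space M. X \<omega> = real k} = p k" "p sums 1"
  shows "distr M borel X = nat_law p"
proof -
  note nat = AE_nat_valued[OF assms]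
  let ?K = "\<lambda>\<omega>. nat \<lfloor>X \<omega>\<rfloor>"
  have "distr M (count_space UNIV) ?K = density (count_space UNIV) (\<lambda>k. ennreal (p k))"
  proof (rule measure_eqI_countable[where A=UNIV])
    fix k :: nat
    have "prob (?K -` {k} \<inter> space M) = prob {\<omega>\<in>space M. X \<omega> = real k}"
      using nat by (intro finite_measure_eq_AE) (auto elim!: eventually_mono Nats_cases)
    then show "emeasure (distr M (count_space UNIV) ?K) {k} = emeasure (density (count_space UNIV) (\<lambda>k. ennreal (p k))) {k}"
      by (simp add: emeasure_distr emeasure_eq_measure p emeasure_density nn_integral_indicator_singleton)
  qed simp_all
  moreover have "distr M borel X = distr M borel (\<lambda>\<omega>. real (?K \<omega>))"
    using nat by (intro distr_cong_AE) (auto elim!: eventually_mono Nats_cases)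
  ultimately show ?thesis
    unfolding nat_law_def by (simp add: distr_distr comp_def flip: \<open>distr M (count_space UNIV) ?K = _\<close>)
qed

definition poisson_prob :: "real \<Rightarrow> nat \<Rightarrow> real" where
  "poisson_prob x k = x ^ k / fact k * exp (- x)"

definition bernoulli_prob :: "real \<Rightarrow> nat \<Rightarrow> real" where
  "bernoulli_prob p k = (if k = 0 then 1 - p else if k = 1 then p else 0)"

lemma poisson_prob_nonneg: "0 \<le> x \<Longrightarrow> 0 \<le> poisson_prob x k"
  by (simp add: poisson_prob_def)

lemma sums_poisson_prob_power:
  fixes z :: complex
  shows "(\<lambda>k. of_real (poisson_prob x k) * z ^ k) sums exp (of_real x * (z - 1))"
proof -
  have "(\<lambda>k. (of_real x * z) ^ k /\<^sub>R fact k * exp (- of_real x)) sums (exp (of_real x * z) * exp (- of_real x))"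
    by (intro sums_mult2 exp_converges)
  moreover have "exp (of_real x * z) * exp (- of_real x) = exp (of_real x * (z - 1))"
    by (simp add: exp_add[symmetric] algebra_simps)
  moreover have "(of_real x * z) ^ k /\<^sub>R fact k * exp (- of_real x) = of_real (poisson_prob x k) * z ^ k" for k
    by (simp add: poisson_prob_def power_mult_distrib scaleR_conv_of_real divide_inverse exp_of_real[symmetric] mult_ac)
  ultimately show ?thesis
    by simp
qed

lemma sums_poisson_prob_exp: "(\<lambda>k. poisson_prob x k * exp (\<theta> * real k)) sums exp (x * (exp \<theta> - 1))"
proof -
  have "(\<lambda>k. complex_of_real (poisson_prob x k * exp \<theta> ^ k)) sums complex_of_real (exp (x * (exp \<theta> - 1)))"
    using sums_poisson_prob_power[of x "of_real (exp \<theta>)"]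
    by (simp only: of_real_mult of_real_power of_real_diff of_real_1 exp_of_real[symmetric])
  then show ?thesis
    by (simp only: sums_of_real_iff exp_of_nat2_mult)
qed

lemma poisson_prob_sums: "poisson_prob x sums 1"
  using sums_poisson_prob_exp[of x 0] by simp

lemma bernoulli_prob_nonneg: "0 \<le> p \<Longrightarrow> p \<le> 1 \<Longrightarrow> 0 \<le> bernoulli_prob p k"
  by (simp add: bernoulli_prob_def)

lemma bernoulli_prob_sums: "bernoulli_prob p sums 1"
  using sums_finite[of "{0, 1}" "bernoulli_prob p"] by (simp add: bernoulli_prob_def)

text \<open>The point constraints are replaced by set constraints one coordinate at a time.\<close>

definition (in prob_space) hybrid_box :: "'i set \<Rightarrow> ('i \<Rightarrow> 'a \<Rightarrow> real) \<Rightarrow> ('i \<Rightarrow> real set) \<Rightarrow> 'i set \<Rightarrow> ('i \<Rightarrow> nat) \<Rightarrow> 'a set" where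
  "hybrid_box I X A J k = {\<omega>\<in>space M. \<forall>i\<in>I. if i \<in> J then X i \<omega> \<in> A i else X i \<omega> = real (k i)}"

lemma (in prob_space) sets_hybrid_box:
  assumes I: "finite I" and X[measurable]: "\<And>i. i \<in> I \<Longrightarrow> X i \<in> borel_measurable M"
    and A[measurable]: "\<And>i. i \<in> I \<Longrightarrow> A i \<in> sets borel"
  shows "hybrid_box I X A J k \<in> events"
  unfolding hybrid_box_def
proof (rule sets.sets_Collect_finite_All[OF _ I])
  fix i assume [simp]: "i \<in> I"
  have "{\<omega>\<in>space M. X i \<omega> \<in> A i} \<in> events" "{\<omega>\<in>space M. X i \<omega> = real (k i)} \<in> events"
    by measurable
  then show "{\<omega>\<in>space M. if i \<in> J then X i \<omega> \<in> A i else X i \<omega> = real (k i)} \<in> events"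
    by simp
qed

lemma (in prob_space) prob_hybrid_box_insert:
  fixes X :: "'i \<Rightarrow> 'a \<Rightarrow> real" and p :: "'i \<Rightarrow> nat \<Rightarrow> real"
  assumes I: "finite I" and X: "\<And>i. i \<in> I \<Longrightarrow> X i \<in> borel_measurable M" and A: "\<And>i. i \<in> I \<Longrightarrow> A i \<in> sets borel"
    and j: "j \<in> I" "j \<notin> J" and nat: "AE \<omega> in M. X j \<omega> \<in> \<nat>"
    and W: "(\<lambda>q. indicator (A j) (real q) * p j q) sums W j"
    and hybrid: "\<And>k. prob (hybrid_box I X A J k) = (\<Prod>i\<in>I. if i \<in> J then W i else p i (k i))"
  shows "prob (hybrid_box I X A (insert j J) k) = (\<Prod>i\<in>I. if i \<in> insert j J then W i else p i (k i))"
proof -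
  let ?rest = "\<Prod>i\<in>I - {j}. if i \<in> J then W i else p i (k i)"
  have split: "(\<Prod>i\<in>I. if i \<in> J' then W i else p i (k' i)) = (if j \<in> J' then W j else p j (k' j)) * ?rest"
    if "J' - {j} = J" "\<And>i. i \<noteq> j \<Longrightarrow> k' i = k i" for J' k'
    unfolding prod.remove[OF I j(1)] using that
    by (intro arg_cong2[where f=times] prod.cong refl) auto
  have "prob {\<omega>\<in>hybrid_box I X A (insert j J) k. X j \<omega> = real q} = indicator (A j) (real q) * p j q * ?rest" for q
  proof -
    have "{\<omega>\<in>hybrid_box I X A (insert j J) k. X j \<omega> = real q}
        = (if real q \<in> A j then hybrid_box I X A J (k(j := q)) else {})"
      using j by (auto simp: hybrid_box_def split: if_splits)
    then show ?thesis
      using split[of J "k(j := q)"] j by (simp add: hybrid)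
  qed
  moreover have "hybrid_box I X A (insert j J) k \<in> events"
    by (intro sets_hybrid_box I X A)
  ultimately have "(\<lambda>q. indicator (A j) (real q) * p j q * ?rest) sums prob (hybrid_box I X A (insert j J) k)"
    using prob_sums_nat_valued[OF X[OF j(1)] nat, of "hybrid_box I X A (insert j J) k"] by simp
  moreover have "(\<lambda>q. indicator (A j) (real q) * p j q * ?rest) sums (W j * ?rest)"
    by (intro sums_mult2 W)
  ultimately have "prob (hybrid_box I X A (insert j J) k) = W j * ?rest"
    by (rule sums_unique2)
  then show ?thesis
    using split[of "insert j J" k] j by simp
qed

lemma (in prob_space) prob_nat_valued_boxes:
  fixes X :: "'i \<Rightarrow> 'a \<Rightarrow> real" and p :: "'i \<Rightarrow> nat \<Rightarrow> real"
  assumes I: "finite I" and X: "\<And>i. i \<in> I \<Longrightarrow> X i \<in> borel_measurable M"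
    and nat: "\<And>i. i \<in> I \<Longrightarrow> AE \<omega> in M. X i \<omega> \<in> \<nat>"
    and p: "\<And>i k. i \<in> I \<Longrightarrow> 0 \<le> p i k" "\<And>i. i \<in> I \<Longrightarrow> p i sums 1"
    and joint: "\<And>k. prob {\<omega>\<in>space M. \<forall>i\<in>I. X i \<omega> = real (k i)} = (\<Prod>i\<in>I. p i (k i))"
    and A: "\<And>i. i \<in> I \<Longrightarrow> A i \<in> sets borel"
  shows "prob {\<omega>\<in>space M. \<forall>i\<in>I. X i \<omega> \<in> A i} = (\<Prod>i\<in>I. \<Sum>q. indicator (A i) (real q) * p i q)"
proof -
  define W where "W i = (\<Sum>q. indicator (A i) (real q) * p i q)" for i
  have W: "(\<lambda>q. indicator (A i) (real q) * p i q) sums W i" if "i \<in> I" for i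
    unfolding W_def
  proof (rule summable_sums)
    show "summable (\<lambda>q. indicator (A i) (real q) * p i q)"
      using p(1)[OF that]
      by (intro summable_comparison_test'[OF sums_summable[OF p(2)[OF that]], of 0]) (auto simp: indicator_def)
  qed
  have "prob (hybrid_box I X A J k) = (\<Prod>i\<in>I. if i \<in> J then W i else p i (k i))" if "finite J" "J \<subseteq> I" for J k
    using that
  proof (induction J arbitrary: k rule: finite_induct)
    case empty
    then show ?case
      by (simp add: hybrid_box_def joint)
  next
    case (insert j J)
    then show ?case
      by (intro prob_hybrid_box_insert I X A nat W) auto
  qed
  from this[OF I subset_refl] show ?thesis
    by (simp add: hybrid_box_def W_def)
qed

lemma (in prob_space)
  fixes X :: "'i \<Rightarrow> 'a \<Rightarrow> real" and p :: "'i \<Rightarrow> nat \<Rightarrow> real"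
  assumes I: "finite I" and X: "\<And>i. i \<in> I \<Longrightarrow> X i \<in> borel_measurable M"
    and nat: "\<And>i. i \<in> I \<Longrightarrow> AE \<omega> in M. X i \<omega> \<in> \<nat>"
    and p: "\<And>i k. i \<in> I \<Longrightarrow> 0 \<le> p i k" "\<And>i. i \<in> I \<Longrightarrow> p i sums 1"
    and joint: "\<And>k. prob {\<omega>\<in>space M. \<forall>i\<in>I. X i \<omega> = real (k i)} = (\<Prod>i\<in>I. p i (k i))"
  shows indep_vars_nat_valuedI: "indep_vars (\<lambda>_. borel) X I"
    and prob_nat_valued_marginal: "i \<in> I \<Longrightarrow> prob {\<omega>\<in>space M. X i \<omega> = real k} = p i k"
proof -
  define W where "W i A = (\<Sum>q. indicator A (real q) * p i q)" for i and A :: "real set"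
  have boxes: "prob {\<omega>\<in>space M. \<forall>i\<in>J. X i \<omega> \<in> A i} = (\<Prod>i\<in>J. W i (A i))"
    if J: "J \<subseteq> I" and A: "\<And>i. i \<in> J \<Longrightarrow> A i \<in> sets borel" for J A
  proof -
    let ?A = "\<lambda>i. if i \<in> J then A i else UNIV"
    have "W i UNIV = 1" if "i \<in> I" for i
      using sums_unique[OF p(2)[OF that]] by (simp add: W_def)
    then have "(\<Prod>i\<in>I. W i (?A i)) = (\<Prod>i\<in>J. W i (A i))"
      using I J by (intro prod.mono_neutral_cong_right) auto
    moreover have "{\<omega>\<in>space M. \<forall>i\<in>J. X i \<omega> \<in> A i} = {\<omega>\<in>space M. \<forall>i\<in>I. X i \<omega> \<in> ?A i}"
      using J by auto
    ultimately show ?thesis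
      using prob_nat_valued_boxes[OF I X nat p joint, of ?A] A by (simp add: W_def)
  qed
  show "prob {\<omega>\<in>space M. X i \<omega> = real k} = p i k" if "i \<in> I"
  proof -
    have "(\<lambda>q. indicator {real k} (real q) * p i q) = (\<lambda>q. if q = k then p i q else 0)"
      by auto
    then have "W i {real k} = p i k"
      unfolding W_def using sums_unique[OF sums_single[of k "p i"]] by simp
    then show ?thesis
      using boxes[of "{i}" "\<lambda>_. {real k}"] that by simp
  qed
  show "indep_vars (\<lambda>_. borel) X I"
    unfolding indep_vars_def2
  proof (intro conjI ballI X indep_setsI)
    fix B J assume J: "J \<noteq> {}" "J \<subseteq> I" "finite J" and "\<forall>j\<in>J. B j \<in> {X j -` A \<inter> space M |A. A \<in> sets borel}"
    then have "\<forall>j\<in>J. \<exists>A. A \<in> sets borel \<and> B j = X j -` A \<inter> space M"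
      by auto
    from bchoice[OF this] obtain A where A: "\<And>j. j \<in> J \<Longrightarrow> A j \<in> sets borel" and B: "\<And>j. j \<in> J \<Longrightarrow> B j = X j -` A j \<inter> space M"
      by blast
    have "(\<Inter>j\<in>J. B j) = {\<omega>\<in>space M. \<forall>j\<in>J. X j \<omega> \<in> A j}"
      using J(1) by (auto simp: B)
    moreover have "prob (B j) = W j (A j)" if "j \<in> J" for j
      using boxes[of "{j}" A] J(2) A that by (auto simp: B vimage_def Int_def conj_commute)
    ultimately show "prob (\<Inter>j\<in>J. B j) = (\<Prod>j\<in>J. prob (B j))"
      using boxes[OF J(2) A] by simp
  qed (use X in \<open>auto simp: measurable_sets\<close>)
qed

section \<open>Sums of measures and counting measures\<close>

lemma finite_measures_eqI:
  assumes \<mu>: "\<mu> \<in> space (finite_measures N)" and \<nu>: "\<nu> \<in> space (finite_measures N)"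
    and eq: "\<And>A. A \<in> sets N \<Longrightarrow> measure \<mu> A = measure \<nu> A"
  shows "\<mu> = \<nu>"
  using finite_measuresD[OF \<mu>] finite_measuresD[OF \<nu>] eq
  by (intro measure_eqI) (auto simp: finite_measure.emeasure_eq_measure)

definition add_measure :: "'a measure \<Rightarrow> 'a measure \<Rightarrow> 'a measure" where
  "add_measure \<mu> \<nu> = measure_of (space \<mu>) (sets \<mu>) (\<lambda>A. emeasure \<mu> A + emeasure \<nu> A)"

lemma sets_add_measure[simp]: "sets (add_measure \<mu> \<nu>) = sets \<mu>"
  by (simp add: add_measure_def)

lemma space_add_measure[simp]: "space (add_measure \<mu> \<nu>) = space \<mu>"
  by (simp add: add_measure_def)

lemma emeasure_add_measure:
  assumes \<nu>: "sets \<nu> = sets \<mu>" and A: "A \<in> sets \<mu>"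
  shows "emeasure (add_measure \<mu> \<nu>) A = emeasure \<mu> A + emeasure \<nu> A"
proof (rule emeasure_measure_of[OF add_measure_def])
  show "countably_additive (sets (add_measure \<mu> \<nu>)) (\<lambda>A. emeasure \<mu> A + emeasure \<nu> A)"
  proof (rule countably_additiveI)
    fix F :: "nat \<Rightarrow> 'a set" assume "range F \<subseteq> sets (add_measure \<mu> \<nu>)" "disjoint_family F"
    then have "(\<Sum>i. emeasure \<mu> (F i)) + (\<Sum>i. emeasure \<nu> (F i)) = emeasure \<mu> (\<Union>i. F i) + emeasure \<nu> (\<Union>i. F i)"
      using \<nu> by (intro arg_cong2[where f="(+)"] suminf_emeasure) auto
    then show "(\<Sum>i. emeasure \<mu> (F i) + emeasure \<nu> (F i)) = emeasure \<mu> (\<Union>i. F i) + emeasure \<nu> (\<Union>i. F i)"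
      by (simp add: suminf_add summableI)
  qed
qed (use A sets.space_closed[of \<mu>] in \<open>auto simp: positive_def\<close>)

lemma
  assumes \<mu>: "\<mu> \<in> space (finite_measures N)" and \<nu>: "\<nu> \<in> space (finite_measures N)"
  shows add_measure_in_finite_measures: "add_measure \<mu> \<nu> \<in> space (finite_measures N)"
    and measure_add_measure: "A \<in> sets N \<Longrightarrow> measure (add_measure \<mu> \<nu>) A = measure \<mu> A + measure \<nu> A"
proof -
  interpret \<mu>: finite_measure \<mu> by (rule finite_measuresD[OF \<mu>])
  interpret \<nu>: finite_measure \<nu> by (rule finite_measuresD[OF \<nu>])
  have emeasure_add: "emeasure (add_measure \<mu> \<nu>) A = emeasure \<mu> A + emeasure \<nu> A" if "A \<in> sets N" for A
    using that finite_measuresD[OF \<mu>] finite_measuresD[OF \<nu>] by (intro emeasure_add_measure) auto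
  show "add_measure \<mu> \<nu> \<in> space (finite_measures N)"
    using emeasure_add[of "space N"] finite_measuresD[OF \<mu>] by (auto simp: space_finite_measures intro!: finite_measureI)
  show "measure (add_measure \<mu> \<nu>) A = measure \<mu> A + measure \<nu> A" if "A \<in> sets N"
    unfolding measure_def emeasure_add[OF that] by (intro enn2real_plus) (simp_all add: less_top[symmetric])
qed

lemma measurable_add_measure:
  assumes f[measurable]: "f \<in> measurable M (finite_measures N)" and g[measurable]: "g \<in> measurable M (finite_measures N)"
  shows "(\<lambda>x. add_measure (f x) (g x)) \<in> measurable M (finite_measures N)"
proof (rule measurable_finite_measures)
  fix A assume A[measurable]: "A \<in> sets N"
  have "(\<lambda>x. measure (f x) A + measure (g x) A) \<in> borel_measurable M"
    by measurable
  then show "(\<lambda>x. measure (add_measure (f x) (g x)) A) \<in> borel_measurable M"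
    by (rule measurable_cong[THEN iffD1, rotated])
       (simp add: measure_add_measure[OF measurable_space[OF f] measurable_space[OF g] A])
qed (intro add_measure_in_finite_measures measurable_space[OF f] measurable_space[OF g])

lemma AE_add_measure:
  assumes "sets \<nu> = sets \<mu>" and "AE x in \<mu>. P x" "AE x in \<nu>. P x"
  shows "AE x in add_measure \<mu> \<nu>. P x"
proof -
  have sp: "space \<nu> = space \<mu>"
    using assms(1) by (rule sets_eq_imp_space_eq)
  from assms(2) obtain A where A: "{x\<in>space \<mu>. \<not> P x} \<subseteq> A" "emeasure \<mu> A = 0" "A \<in> sets \<mu>"
    by (rule AE_E)
  from assms(3) obtain B where B: "{x\<in>space \<nu>. \<not> P x} \<subseteq> B" "emeasure \<nu> B = 0" "B \<in> sets \<nu>"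
    by (rule AE_E)
  have "emeasure \<mu> (A \<inter> B) = 0" "emeasure \<nu> (A \<inter> B) = 0"
    using A B assms(1) emeasure_mono[of "A \<inter> B" A \<mu>] emeasure_mono[of "A \<inter> B" B \<nu>] by auto
  then have "emeasure (add_measure \<mu> \<nu>) (A \<inter> B) = 0"
    using A B assms(1) by (subst emeasure_add_measure) auto
  then show ?thesis
    using A B assms(1) sp by (intro AE_I[of _ _ "A \<inter> B"]) auto
qed

lemma simple_point_measure_add_measure:
  assumes \<mu>: "\<mu> \<in> space (finite_measures (borel :: 'x::t1_space measure))" "simple_point_measure \<mu>"
    and \<nu>: "\<nu> \<in> space (finite_measures borel)" "simple_point_measure \<nu>"
    and disj: "unit_atoms \<mu> \<inter> unit_atoms \<nu> = {}"
  shows "simple_point_measure (add_measure \<mu> \<nu>)"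
  unfolding simple_point_measure_def
proof (rule AE_add_measure)
  have one: "measure (add_measure \<mu> \<nu>) {x} = 1" if "x \<in> unit_atoms \<mu> \<union> unit_atoms \<nu>" for x
    using that disj simple_point_measure_singleton[OF \<mu>, of x] simple_point_measure_singleton[OF \<nu>, of x]
    by (auto simp: unit_atoms_def measure_add_measure[OF \<mu>(1) \<nu>(1)])
  show "AE x in \<mu>. measure (add_measure \<mu> \<nu>) {x} = 1" "AE x in \<nu>. measure (add_measure \<mu> \<nu>) {x} = 1"
    using \<mu>(2) \<nu>(2) by (auto simp: simple_point_measure_def unit_atoms_def elim!: eventually_mono intro!: one)
qed (simp add: finite_measuresD[OF \<mu>(1)] finite_measuresD[OF \<nu>(1)])

definition counting_on :: "'x::topological_space set \<Rightarrow> 'x measure" where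
  "counting_on T = distr (count_space T) borel (\<lambda>x. x)"

lemma sets_counting_on[simp]: "sets (counting_on T) = sets borel"
  by (simp add: counting_on_def)

lemma emeasure_counting_on:
  assumes "finite T" "A \<in> sets borel"
  shows "emeasure (counting_on T) A = ennreal (real (card (T \<inter> A)))"
  unfolding counting_on_def using assms
  by (subst emeasure_distr) (auto simp: measurable_count_space_eq1 Int_commute ennreal_of_nat_eq_real_of_nat)

lemma measure_counting_on:
  assumes "finite T" "A \<in> sets borel"
  shows "measure (counting_on T) A = real (card (T \<inter> A))"
  unfolding measure_def emeasure_counting_on[OF assms] by simp

lemma counting_on_in_finite_measures: "finite T \<Longrightarrow> counting_on T \<in> space (finite_measures borel)"
  using sets_eq_imp_space_eq[OF sets_counting_on, of T]
  by (simp add: space_finite_measures emeasure_counting_on finite_measureI)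

lemma unit_atoms_counting_on: "finite T \<Longrightarrow> unit_atoms (counting_on T) = (T :: 'x::t1_space set)"
  by (auto simp: unit_atoms_def measure_counting_on Int_insert_right split: if_splits)

lemma simple_point_measure_counting_on:
  assumes T: "finite (T :: 'x::t1_space set)"
  shows "simple_point_measure (counting_on T)"
proof -
  have N: "- T \<in> sets borel"
    using T by (intro borel_comp borel_closed finite_imp_closed)
  then have "emeasure (counting_on T) (- T) = 0"
    by (simp add: emeasure_counting_on[OF T N])
  then show ?thesis
    unfolding simple_point_measure_def using N unit_atoms_counting_on[OF T]
    by (intro AE_I[of _ _ "- T"]) (auto simp: unit_atoms_def)
qed

lemma measurable_counting_on_subset:
  assumes S: "finite S" and P: "\<And>x. x \<in> S \<Longrightarrow> Measurable.pred M (\<lambda>\<omega>. P \<omega> x)"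
  shows "(\<lambda>\<omega>. counting_on {x\<in>S. P \<omega> x}) \<in> measurable M (finite_measures borel)"
proof (rule measurable_finite_measures)
  fix A :: "'a set" assume A: "A \<in> sets borel"
  have "(\<lambda>\<omega>. \<Sum>x\<in>S \<inter> A. if P \<omega> x then 1 else 0 :: real) \<in> borel_measurable M"
    using P by (intro borel_measurable_sum measurable_If measurable_const) (auto simp: pred_def)
  moreover have "measure (counting_on {x\<in>S. P \<omega> x}) A = (\<Sum>x\<in>S \<inter> A. if P \<omega> x then 1 else 0)" for \<omega>
  proof -
    have "{x\<in>S. P \<omega> x} \<inter> A = {x\<in>S \<inter> A. P \<omega> x}"
      by auto
    then show ?thesis
      using S A by (simp add: measure_counting_on sum.inter_filter[symmetric])
  qed
  ultimately show "(\<lambda>\<omega>. measure (counting_on {x\<in>S. P \<omega> x}) A) \<in> borel_measurable M"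
    by simp
qed (simp add: counting_on_in_finite_measures S)

section \<open>Uniqueness of the law of a Bernoulli random measure\<close>

lemma (in prob_space) indep_vars_imp_distr_eq_PiM:
  assumes "indep_vars M' X I"
  shows "distr M (PiM I M') (\<lambda>\<omega>. \<lambda>i\<in>I. X i \<omega>) = PiM I (\<lambda>i. distr M (M' i) (X i))"
proof (cases "I = {}")
  case True
  have rv: "random_variable (PiM {} M') (\<lambda>\<omega>. \<lambda>i\<in>{}. X i \<omega>)"
    by (rule measurable_restrict) auto
  show ?thesis
    unfolding True
  proof (rule measure_eqI)
    fix A assume "A \<in> sets (distr M (PiM {} M') (\<lambda>\<omega>. \<lambda>i\<in>{}. X i \<omega>))"
    then have "A = {} \<or> A = {\<lambda>_. undefined}"
      by (auto simp: PiM_empty)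
    then show "emeasure (distr M (PiM {} M') (\<lambda>\<omega>. \<lambda>i\<in>{}. X i \<omega>)) A
        = emeasure (PiM {} (\<lambda>i. distr M (M' i) (X i))) A"
      using rv by (auto simp: PiM_empty emeasure_distr restrict_def emeasure_space_1)
  qed (simp add: PiM_empty)
next
  case False
  then show ?thesis
    using assms indep_vars_iff_distr_eq_PiM'[OF False, where M'=M' and X=X] by (auto simp: indep_vars_def)
qed

lemma (in prob_space) indep_set_vimage_imp_distr_pair:
  assumes X[measurable]: "X \<in> measurable M S" and Y[measurable]: "Y \<in> measurable M T"
    and indep: "indep_set (sets (vimage_algebra (space M) X S)) (sets (vimage_algebra (space M) Y T))"
  shows "distr M (S \<Otimes>\<^sub>M T) (\<lambda>\<omega>. (X \<omega>, Y \<omega>)) = distr M S X \<Otimes>\<^sub>M distr M T Y"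
proof (rule pair_measure_eqI[symmetric])
  interpret X: prob_space "distr M S X" by (rule prob_space_distr) fact
  interpret Y: prob_space "distr M T Y" by (rule prob_space_distr) fact
  show "sigma_finite_measure (distr M S X)" "sigma_finite_measure (distr M T Y)"
    by unfold_locales
  fix A B assume "A \<in> sets (distr M S X)" "B \<in> sets (distr M T Y)"
  then have [measurable]: "A \<in> sets S" "B \<in> sets T"
    by simp_all
  have "X -` A \<inter> space M \<in> sets (vimage_algebra (space M) X S)" "Y -` B \<inter> space M \<in> sets (vimage_algebra (space M) Y T)"
    by (auto intro: in_vimage_algebra)
  then have "prob ((X -` A \<inter> space M) \<inter> (Y -` B \<inter> space M)) = prob (X -` A \<inter> space M) * prob (Y -` B \<inter> space M)"
    using indep by (auto simp: indep_sets2_eq)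
  moreover have "(\<lambda>\<omega>. (X \<omega>, Y \<omega>)) -` (A \<times> B) \<inter> space M = (X -` A \<inter> space M) \<inter> (Y -` B \<inter> space M)"
    by auto
  ultimately show "emeasure (distr M S X) A * emeasure (distr M T Y) B
      = emeasure (distr M (S \<Otimes>\<^sub>M T) (\<lambda>\<omega>. (X \<omega>, Y \<omega>))) (A \<times> B)"
    by (simp add: emeasure_distr emeasure_eq_measure ennreal_mult)
qed simp

lemma (in prob_space) distr_poisson_rm_counts:
  assumes rm: "poisson_rm M N lam" and J: "finite (J :: nat set)"
    and A: "\<And>j. j \<in> J \<Longrightarrow> A j \<in> sets borel" "disjoint_family_on A J"
  shows "distr M (PiM J (\<lambda>_. borel)) (\<lambda>\<omega>. \<lambda>j\<in>J. measure (N \<omega>) (A j)) = PiM J (\<lambda>j. nat_law (poisson_prob (lam (A j))))"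
proof -
  have indep: "indep_vars (\<lambda>_. borel) (\<lambda>j \<omega>. measure (N \<omega>) (A j)) J"
    using rm J A by (simp add: poisson_rm_def)
  have "distr M borel (\<lambda>\<omega>. measure (N \<omega>) (A j)) = nat_law (poisson_prob (lam (A j)))" if "j \<in> J" for j
    using rm A(1)[OF that] indep that
    by (intro distr_eq_nat_law poisson_prob_sums) (auto simp: poisson_rm_def poisson_prob_def indep_vars_def)
  then show ?thesis
    using indep_vars_imp_distr_eq_PiM[OF indep] by (simp cong: PiM_cong)
qed

lemma poisson_rm_unique:
  fixes N :: "'q \<Rightarrow> 'x::topological_space measure" and N' :: "'r \<Rightarrow> 'x measure"
  assumes Q: "prob_space Q" "poisson_rm Q N lam" and Q': "prob_space Q'" "poisson_rm Q' N' lam"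
  shows "distr Q (finite_measures borel) N = distr Q' (finite_measures borel) N'"
proof (rule distr_finite_measures_eqI[OF prob_space.finite_measure[OF Q(1)]])
  show "N \<in> measurable Q (finite_measures borel)" "N' \<in> measurable Q' (finite_measures borel)"
    using Q Q' by (auto simp: poisson_rm_def random_measure_iff_measurable)
  fix n :: nat and A :: "nat \<Rightarrow> 'x set"
  assume A: "\<And>j. j < n \<Longrightarrow> A j \<in> sets borel" "disjoint_family_on A {..<n}"
  show "distr Q (PiM {..<n} (\<lambda>_. borel)) (\<lambda>\<omega>. \<lambda>j\<in>{..<n}. measure (N \<omega>) (A j))
      = distr Q' (PiM {..<n} (\<lambda>_. borel)) (\<lambda>\<omega>. \<lambda>j\<in>{..<n}. measure (N' \<omega>) (A j))"
    using A(1)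
    by (intro trans[OF prob_space.distr_poisson_rm_counts[OF Q _ _ A(2)] sym[OF prob_space.distr_poisson_rm_counts[OF Q' _ _ A(2)]]])
       auto
qed

lemma (in prob_space) distr_eq_nat_law_bernoulli:
  assumes V[measurable]: "V \<in> borel_measurable M" and V01: "\<And>\<omega>. \<omega> \<in> space M \<Longrightarrow> V \<omega> \<in> {0, 1}"
  shows "distr M borel V = nat_law (bernoulli_prob (prob {\<omega>\<in>space M. V \<omega> = 1}))"
proof (rule distr_eq_nat_law[OF V _ bernoulli_prob_sums])
  fix k
  have "{\<omega>\<in>space M. V \<omega> = 0} = space M - {\<omega>\<in>space M. V \<omega> = 1}"
    using V01 by auto
  then have "prob {\<omega>\<in>space M. V \<omega> = 0} = 1 - prob {\<omega>\<in>space M. V \<omega> = 1}"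
    by (simp add: prob_compl)
  moreover have "prob {\<omega>\<in>space M. V \<omega> = real k} = 0" if "k \<noteq> 0" "k \<noteq> 1"
  proof -
    have "{\<omega>\<in>space M. V \<omega> = real k} = {}"
      using V01 that by fastforce
    then show ?thesis
      by (simp only: measure_empty)
  qed
  ultimately show "prob {\<omega>\<in>space M. V \<omega> = real k} = bernoulli_prob (prob {\<omega>\<in>space M. V \<omega> = 1}) k"
    by (cases "k = 0 \<or> k = 1") (auto simp: bernoulli_prob_def)
qed

definition add_unit_masses :: "'x::topological_space set \<Rightarrow> 'x measure \<times> ('x \<Rightarrow> real) \<Rightarrow> 'x measure" where
  "add_unit_masses S p = add_measure (fst p) (counting_on {x\<in>S. snd p x = 1})"

lemma
  assumes \<mu>: "\<mu> \<in> space (finite_measures borel)" and S: "finite S"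
  shows add_unit_masses_in_finite_measures: "add_unit_masses S (\<mu>, v) \<in> space (finite_measures borel)"
    and measure_add_unit_masses: "(\<And>x. x \<in> S \<Longrightarrow> v x \<in> {0, 1}) \<Longrightarrow> B \<in> sets borel \<Longrightarrow>
      measure (add_unit_masses S (\<mu>, v)) B = measure \<mu> B + (\<Sum>\<^sub>\<infinity>x\<in>S \<inter> B. v x)"
proof -
  have count: "counting_on {x\<in>S. v x = 1} \<in> space (finite_measures borel)"
    using S by (simp add: counting_on_in_finite_measures)
  show "add_unit_masses S (\<mu>, v) \<in> space (finite_measures borel)"
    unfolding add_unit_masses_def using \<mu> count by (simp add: add_measure_in_finite_measures)
  assume v01: "\<And>x. x \<in> S \<Longrightarrow> v x \<in> {0, 1}" and B: "B \<in> sets borel"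
  have "(\<Sum>\<^sub>\<infinity>x\<in>S \<inter> B. v x) = (\<Sum>x\<in>S \<inter> B. if v x = 1 then 1 else 0)"
    using S by (subst infsum_finite) (auto intro!: sum.cong dest!: v01)
  also have "\<dots> = real (card ({x\<in>S. v x = 1} \<inter> B))"
    using S by (simp add: sum.inter_filter[symmetric] Int_def conj_ac)
  finally show "measure (add_unit_masses S (\<mu>, v)) B = measure \<mu> B + (\<Sum>\<^sub>\<infinity>x\<in>S \<inter> B. v x)"
    using S B by (simp add: add_unit_masses_def measure_add_measure[OF \<mu> count] measure_counting_on)
qed

lemma measurable_add_unit_masses:
  fixes S :: "'x::topological_space set"
  assumes S: "finite S"
  shows "add_unit_masses S \<in> measurable (finite_measures borel \<Otimes>\<^sub>M PiM S (\<lambda>_. borel)) (finite_measures borel)"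
    (is "_ \<in> measurable ?M _")
  unfolding add_unit_masses_def
proof (intro measurable_add_measure measurable_fst measurable_counting_on_subset S)
  fix x assume "x \<in> S"
  then have [measurable]: "(\<lambda>p. snd p x) \<in> borel_measurable ?M"
    by (intro measurable_compose[OF measurable_snd measurable_component_singleton])
  show "Measurable.pred ?M (\<lambda>p. snd p x = 1)"
    by measurable
qed

lemma eq_add_unit_massesI:
  fixes \<mu> :: "'x::topological_space measure"
  assumes \<mu>: "\<mu> \<in> space (finite_measures borel)" and \<mu>\<^sub>1: "\<mu>\<^sub>1 \<in> space (finite_measures borel)"
    and S: "finite S" and v: "\<And>x. x \<in> S \<Longrightarrow> v x \<in> {0, 1}"
    and eq: "\<And>B. B \<in> sets borel \<Longrightarrow> measure \<mu> B = measure \<mu>\<^sub>1 B + (\<Sum>\<^sub>\<infinity>x\<in>S \<inter> B. v x)"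
  shows "\<mu> = add_unit_masses S (\<mu>\<^sub>1, v)"
  using eq measure_add_unit_masses[OF \<mu>\<^sub>1 S v]
  by (intro finite_measures_eqI[OF \<mu>] add_unit_masses_in_finite_measures \<mu>\<^sub>1 S) simp

lemma (in prob_space) distr_BeP_rm:
  fixes \<nu> :: "'x::topological_space measure"
  assumes bep: "BeP_rm M N \<nu>" and S: "finite (atoms_of \<nu>)"
  obtains N1 where "poisson_rm M N1 (diffuse_part \<nu>)"
    and "distr M (finite_measures borel) N
      = distr (distr M (finite_measures borel) N1 \<Otimes>\<^sub>M PiM (atoms_of \<nu>) (\<lambda>x. nat_law (bernoulli_prob (measure \<nu> {x}))))
          (finite_measures borel) (add_unit_masses (atoms_of \<nu>))"
proof -
  let ?S = "atoms_of \<nu>" and ?F = "finite_measures (borel :: 'x measure)"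
  let ?PS = "PiM ?S (\<lambda>_. borel :: real measure)"
  from bep obtain N1 and V :: "'x \<Rightarrow> 'a \<Rightarrow> real" where
      N: "random_measure M N" and poisson: "poisson_rm M N1 (diffuse_part \<nu>)"
    and V: "\<And>x. x \<in> ?S \<Longrightarrow> V x \<in> borel_measurable M" "\<And>x \<omega>. x \<in> ?S \<Longrightarrow> \<omega> \<in> space M \<Longrightarrow> V x \<omega> \<in> {0, 1}"
      "\<And>x. x \<in> ?S \<Longrightarrow> prob {\<omega>\<in>space M. V x \<omega> = 1} = measure \<nu> {x}"
    and V_indep: "indep_vars (\<lambda>_. borel) V ?S"
    and N1_V: "indep_set (sets (vimage_algebra (space M) N1 ?F))
        (sets (vimage_algebra (space M) (\<lambda>\<omega>. \<lambda>x\<in>?S. V x \<omega>) ?PS))"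
    and N_eq: "AE \<omega> in M. \<forall>B\<in>sets borel. measure (N \<omega>) B = measure (N1 \<omega>) B + (\<Sum>\<^sub>\<infinity>x\<in>?S \<inter> B. V x \<omega>)"
    unfolding BeP_rm_def by blast
  let ?V = "\<lambda>\<omega>. \<lambda>x\<in>?S. V x \<omega>"
  note total[measurable] = measurable_add_unit_masses[OF S]
  have N1[measurable]: "N1 \<in> measurable M ?F" and N'[measurable]: "N \<in> measurable M ?F"
    using poisson N by (auto simp: poisson_rm_def random_measure_iff_measurable)
  have V_meas[measurable]: "?V \<in> measurable M ?PS"
    using V by (intro measurable_restrict) auto
  have "AE \<omega> in M. N \<omega> = add_unit_masses ?S (N1 \<omega>, ?V \<omega>)"
    using N_eq AE_space
  proof eventually_elim
    case (elim \<omega>)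
    show ?case
    proof (rule eq_add_unit_massesI[OF measurable_space[OF N' elim(2)] measurable_space[OF N1 elim(2)] S])
      fix B :: "'x set" assume "B \<in> sets borel"
      moreover have "(\<Sum>\<^sub>\<infinity>x\<in>?S \<inter> B. ?V \<omega> x) = (\<Sum>\<^sub>\<infinity>x\<in>?S \<inter> B. V x \<omega>)"
        by (intro infsum_cong) simp
      ultimately show "measure (N \<omega>) B = measure (N1 \<omega>) B + (\<Sum>\<^sub>\<infinity>x\<in>?S \<inter> B. ?V \<omega> x)"
        using elim(1) by simp
    qed (use V(2) elim(2) in auto)
  qed
  then have "distr M ?F N = distr M ?F (\<lambda>\<omega>. add_unit_masses ?S (N1 \<omega>, ?V \<omega>))"
    by (intro distr_cong_AE) measurable
  also have "\<dots> = distr (distr M ?F N1 \<Otimes>\<^sub>M distr M ?PS ?V) ?F (add_unit_masses ?S)"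
    by (subst indep_set_vimage_imp_distr_pair[OF N1 V_meas N1_V, symmetric], subst distr_distr) (auto simp: comp_def)
  also have "distr M ?PS ?V = PiM ?S (\<lambda>x. nat_law (bernoulli_prob (measure \<nu> {x})))"
    using indep_vars_imp_distr_eq_PiM[OF V_indep] distr_eq_nat_law_bernoulli[OF V(1,2)] V(3) by (simp cong: PiM_cong)
  finally show thesis
    using that[OF poisson] by simp
qed

lemma BeP_rm_unique:
  fixes \<nu> :: "'x::topological_space measure"
  assumes Q: "prob_space Q" "BeP_rm Q N \<nu>" and Q': "prob_space Q'" "BeP_rm Q' N' \<nu>"
    and S: "finite (atoms_of \<nu>)"
  shows "distr Q (finite_measures borel) N = distr Q' (finite_measures borel) N'"
proof -
  obtain N1 where N1: "poisson_rm Q N1 (diffuse_part \<nu>)"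
    "distr Q (finite_measures borel) N
      = distr (distr Q (finite_measures borel) N1 \<Otimes>\<^sub>M PiM (atoms_of \<nu>) (\<lambda>x. nat_law (bernoulli_prob (measure \<nu> {x}))))
          (finite_measures borel) (add_unit_masses (atoms_of \<nu>))"
    by (rule prob_space.distr_BeP_rm[OF Q S])
  obtain N1' where N1': "poisson_rm Q' N1' (diffuse_part \<nu>)"
    "distr Q' (finite_measures borel) N'
      = distr (distr Q' (finite_measures borel) N1' \<Otimes>\<^sub>M PiM (atoms_of \<nu>) (\<lambda>x. nat_law (bernoulli_prob (measure \<nu> {x}))))
          (finite_measures borel) (add_unit_masses (atoms_of \<nu>))"
    by (rule prob_space.distr_BeP_rm[OF Q' S])
  show ?thesis
    unfolding N1(2) N1'(2) poisson_rm_unique[OF Q(1) N1(1) Q'(1) N1'(1)] ..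
qed

section \<open>Existence of the law of a Bernoulli random measure\<close>

definition count_event :: "'a measure \<Rightarrow> 'i set \<Rightarrow> ('i \<Rightarrow> 'a set) \<Rightarrow> ('i \<Rightarrow> nat) \<Rightarrow> 'a measure set" where
  "count_event N J A k = {\<mu> \<in> space (finite_measures N). \<forall>j\<in>J. measure \<mu> (A j) = real (k j)}"

lemma sets_count_event:
  assumes "finite J" and [measurable]: "\<And>j. j \<in> J \<Longrightarrow> A j \<in> sets N"
  shows "count_event N J A k \<in> sets (finite_measures N)"
  unfolding count_event_def using assms(1) by measurable

primrec iid_points_law :: "'a measure \<Rightarrow> nat \<Rightarrow> 'a measure measure" where
  "iid_points_law m 0 = return (finite_measures m) (null_measure m)"
| "iid_points_law m (Suc n) = distr (iid_points_law m n \<Otimes>\<^sub>M m) (finite_measures m) (\<lambda>p. add_measure (fst p) (return m (snd p)))"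

lemma sets_iid_points_law[simp, measurable_cong]: "sets (iid_points_law m n) = sets (finite_measures m)"
  by (cases n) auto

lemma space_iid_points_law[simp]: "space (iid_points_law m n) = space (finite_measures m)"
  by (rule sets_eq_imp_space_eq) simp

lemma null_measure_in_finite_measures: "null_measure m \<in> space (finite_measures m)"
  by (auto simp: space_finite_measures intro: finite_measureI)

lemma return_in_finite_measures: "y \<in> space m \<Longrightarrow> return m y \<in> space (finite_measures m)"
  by (simp add: space_finite_measures prob_space_return prob_space.finite_measure)

lemma measurable_add_point[measurable]:
  "(\<lambda>p. add_measure (fst p) (return m (snd p))) \<in> measurable (iid_points_law m n \<Otimes>\<^sub>M m) (finite_measures m)"
proof -
  have "return m \<in> measurable m (finite_measures m)"
    by (intro measurable_finite_measures return_in_finite_measures) (simp_all add: measure_return)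
  from measurable_compose[OF measurable_snd this] show ?thesis
    by (intro measurable_add_measure) measurable
qed

definition multinomial_prob :: "'i set \<Rightarrow> ('i \<Rightarrow> real) \<Rightarrow> ('i \<Rightarrow> nat) \<Rightarrow> real" where
  "multinomial_prob J p k = fact (sum k J) / (\<Prod>j\<in>J. fact (k j)) * (\<Prod>j\<in>J. p j ^ k j)"

lemma multinomial_prob_decrement:
  assumes J: "finite J" and i: "i \<in> J" "0 < k i"
  shows "real (sum k J) * (multinomial_prob J p (k(i := k i - 1)) * p i) = real (k i) * multinomial_prob J p k"
proof -
  obtain q where q: "k i = Suc q"
    using i(2) by (cases "k i") auto
  let ?k = "k(i := k i - 1)" and ?J = "J - {i}"
  have sums: "sum ?k J = q + sum k ?J" "sum k J = Suc (q + sum k ?J)"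
    and prods: "(\<Prod>j\<in>J. fact (?k j) :: real) = fact q * (\<Prod>j\<in>?J. fact (k j))"
      "(\<Prod>j\<in>J. fact (k j) :: real) = fact (Suc q) * (\<Prod>j\<in>?J. fact (k j))"
      "(\<Prod>j\<in>J. p j ^ ?k j) = p i ^ q * (\<Prod>j\<in>?J. p j ^ k j)"
      "(\<Prod>j\<in>J. p j ^ k j) = p i ^ Suc q * (\<Prod>j\<in>?J. p j ^ k j)"
    by (simp_all only: sum.remove[OF J i(1)] prod.remove[OF J i(1)] q fun_upd_same diff_Suc_1 power_Suc add_Suc)
       (simp_all add: q cong: sum.cong_simp prod.cong_simp)
  have "(\<Prod>j\<in>?J. fact (k j) :: real) \<noteq> 0"
    using J by simp
  then show ?thesis
    unfolding multinomial_prob_def sums prods unfolding q fact_Suc by (simp add: field_simps del: of_nat_Suc)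
qed

context prob_space
begin

lemma prob_space_iid_points_law: "prob_space (iid_points_law M n)"
proof (induction n)
  case 0
  then show ?case
    by (simp add: prob_space_return null_measure_in_finite_measures)
next
  case (Suc n)
  interpret D: prob_space "iid_points_law M n" by fact
  interpret DM: pair_prob_space "iid_points_law M n" M ..
  show ?case
    by (simp add: DM.P.prob_space_distr)
qed

lemma add_point_in_count_event_iff:
  assumes \<mu>: "\<mu> \<in> space (finite_measures M)" and A: "\<And>j. j \<in> J \<Longrightarrow> A j \<in> events" "disjoint_family_on A J"
    and i: "i \<in> J" "y \<in> A i"
  shows "add_measure \<mu> (return M y) \<in> count_event M J A k \<longleftrightarrow> 0 < k i \<and> \<mu> \<in> count_event M J A (k(i := k i - 1))"
proof -
  have y: "y \<in> space M"
    using sets.sets_into_space[OF A(1)[OF i(1)]] i(2) by auto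
  note add = measure_add_measure[OF \<mu> return_in_finite_measures[OF y]] add_measure_in_finite_measures[OF \<mu> return_in_finite_measures[OF y]]
  have "measure (add_measure \<mu> (return M y)) (A j) = measure \<mu> (A j) + (if j = i then 1 else 0)" if j: "j \<in> J" for j
  proof -
    have "y \<in> A j \<longleftrightarrow> j = i"
      using disjoint_family_onD[OF A(2) j i(1)] i(2) by auto
    then show ?thesis
      using A(1)[OF j] by (simp add: add measure_return indicator_def)
  qed
  moreover have "x + 1 = real q \<longleftrightarrow> 0 < q \<and> x = real (q - 1)" if "0 \<le> x" for x :: real and q
    using that by (cases q) auto
  ultimately show ?thesis
    using i(1) \<mu> add(2) by (auto simp: count_event_def)
qed

lemma add_point_vimage_count_event:
  assumes A: "\<And>j. j \<in> J \<Longrightarrow> A j \<in> events" "disjoint_family_on A J" and cover: "(\<Union>j\<in>J. A j) = space M"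
  shows "(\<lambda>p. add_measure (fst p) (return M (snd p))) -` count_event M J A k \<inter> (space (finite_measures M) \<times> space M)
    = (\<Union>i\<in>{i\<in>J. 0 < k i}. count_event M J A (k(i := k i - 1)) \<times> A i)"
    (is "?L = (\<Union>i\<in>?I. ?E i \<times> A i)")
proof (intro set_eqI)
  fix p :: "'a measure \<times> 'a"
  show "p \<in> ?L \<longleftrightarrow> p \<in> (\<Union>i\<in>?I. ?E i \<times> A i)"
  proof (cases "fst p \<in> space (finite_measures M) \<and> snd p \<in> space M")
    case True
    then obtain i where i: "i \<in> J" "snd p \<in> A i"
      using cover by blast
    have "p \<in> (\<Union>i\<in>?I. ?E i \<times> A i) \<longleftrightarrow> 0 < k i \<and> fst p \<in> ?E i"
    proof
      assume "p \<in> (\<Union>i\<in>?I. ?E i \<times> A i)"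
      then obtain j where j: "j \<in> ?I" "p \<in> ?E j \<times> A j"
        by (rule UN_E)
      then have "j = i"
        using disjoint_family_onD[OF A(2) _ i(1), of j] i(2) by (auto simp: mem_Times_iff)
      with j show "0 < k i \<and> fst p \<in> ?E i"
        by (simp add: mem_Times_iff)
    qed (use i in \<open>auto simp: mem_Times_iff intro!: UN_I[of i]\<close>)
    then show ?thesis
      using True by (simp only: Int_iff vimage_eq mem_Times_iff simp_thms add_point_in_count_event_iff[OF _ A i])
  next
    case False
    then have "p \<notin> ?E i \<times> A i" if "i \<in> J" for i
      using cover that by (auto simp: count_event_def)
    then show ?thesis
      using False by (auto simp: mem_Times_iff)
  qed
qed

lemma measure_iid_points_law_Suc_count_event:
  assumes J: "finite J" and A: "\<And>j. j \<in> J \<Longrightarrow> A j \<in> events" "disjoint_family_on A J"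
    and cover: "(\<Union>j\<in>J. A j) = space M"
  shows "measure (iid_points_law M (Suc n)) (count_event M J A k)
    = (\<Sum>i | i \<in> J \<and> 0 < k i. measure (iid_points_law M n) (count_event M J A (k(i := k i - 1))) * prob (A i))"
proof -
  let ?D = "iid_points_law M n"
  interpret D: prob_space ?D by (rule prob_space_iid_points_law)
  interpret DM: pair_prob_space ?D M ..
  let ?E = "\<lambda>i. count_event M J A (k(i := k i - 1))" and ?I = "{i\<in>J. 0 < k i}"
  have E: "?E i \<times> A i \<in> sets (?D \<Otimes>\<^sub>M M)" if "i \<in> J" for i
    using sets_count_event[OF J A(1)] A(1)[OF that] by (intro pair_measureI) auto
  have "measure (iid_points_law M (Suc n)) (count_event M J A k) = DM.P.prob (\<Union>i\<in>?I. ?E i \<times> A i)"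
    using sets_count_event[OF J A(1)] add_point_vimage_count_event[OF A cover, of k]
    by (simp add: measure_distr space_pair_measure)
  also have "\<dots> = (\<Sum>i\<in>?I. DM.P.prob (?E i \<times> A i))"
    using J E A(2) by (intro DM.P.finite_measure_finite_Union) (auto simp: disjoint_family_on_def)
  also have "\<dots> = (\<Sum>i\<in>?I. D.prob (?E i) * prob (A i))"
    using sets_count_event[OF J A(1)] A(1)
    by (intro sum.cong refl) (simp add: measure_def emeasure_pair_measure_Times enn2real_mult)
  finally show ?thesis
    by simp
qed

lemma measure_iid_points_law_count_event:
  assumes J: "finite J" and A: "\<And>j. j \<in> J \<Longrightarrow> A j \<in> events" "disjoint_family_on A J"
    and cover: "(\<Union>j\<in>J. A j) = space M"
  shows "measure (iid_points_law M n) (count_event M J A k)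
    = (if sum k J = n then multinomial_prob J (\<lambda>j. prob (A j)) k else 0)"
proof (induction n arbitrary: k)
  case 0
  have "measure (iid_points_law M 0) (count_event M J A k) = indicator (count_event M J A k) (null_measure M)"
    using sets_count_event[OF J A(1)] by (simp add: measure_return)
  also have "\<dots> = (if sum k J = 0 then 1 else 0)"
    using J null_measure_in_finite_measures by (auto simp: count_event_def indicator_def)
  finally show ?case
    using J by (auto simp: multinomial_prob_def)
next
  case (Suc n)
  let ?w = "multinomial_prob J (\<lambda>j. prob (A j))" and ?I = "{i\<in>J. 0 < k i}"
  have dec: "sum (k(i := k i - 1)) J = sum k J - 1" if "i \<in> ?I" for i
    using that J by (simp add: sum.remove[OF J, of i] cong: sum.cong_simp)
  have rec: "measure (iid_points_law M (Suc n)) (count_event M J A k)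
      = (\<Sum>i\<in>?I. measure (iid_points_law M n) (count_event M J A (k(i := k i - 1))) * prob (A i))"
    by (rule measure_iid_points_law_Suc_count_event[OF J A cover])
  have "measure (iid_points_law M (Suc n)) (count_event M J A k)
      = (\<Sum>i\<in>?I. if sum k J = Suc n then ?w (k(i := k i - 1)) * prob (A i) else 0)"
    unfolding rec Suc.IH
  proof (rule sum.cong[OF refl])
    fix i assume i: "i \<in> ?I"
    then have "0 < sum k J"
      using J by (auto simp: sum.remove[of J i])
    with dec[OF i] show "(if sum (k(i := k i - 1)) J = n then ?w (k(i := k i - 1)) else 0) * prob (A i)
        = (if sum k J = Suc n then ?w (k(i := k i - 1)) * prob (A i) else 0)"
      by auto
  qed
  also have "\<dots> = (if sum k J = Suc n then ?w k else 0)"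
  proof (cases "sum k J = Suc n")
    case True
    have "real (Suc n) * (\<Sum>i\<in>?I. ?w (k(i := k i - 1)) * prob (A i)) = (\<Sum>i\<in>?I. real (k i) * ?w k)"
      unfolding sum_distrib_left using multinomial_prob_decrement[OF J, of _ k "\<lambda>j. prob (A j)"]
      by (intro sum.cong) (auto simp: True)
    also have "\<dots> = (\<Sum>i\<in>J. real (k i) * ?w k)"
      using J by (intro sum.mono_neutral_left) auto
    also have "\<dots> = real (Suc n) * ?w k"
      by (simp add: sum_distrib_right[symmetric] of_nat_sum[symmetric] True del: of_nat_sum)
    finally show ?thesis
      using True by simp
  qed simp
  finally show ?case .
qed

end

lemma AE_notin_finite_of_diffuse:
  fixes m :: "'x::t1_space measure"
  assumes "finite_measure m" and sets: "sets m = sets borel" and diffuse: "\<And>x. measure m {x} = 0" and S: "finite S"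
  shows "AE x in m. x \<notin> S"
proof (intro AE_not_in null_setsI)
  interpret finite_measure m by fact
  have "measure m S = (\<Sum>x\<in>S. measure m {x})"
    using S sets by (intro finite_measure_eq_sum_singleton) auto
  then show "emeasure m S = 0"
    by (simp add: emeasure_eq_measure diffuse)
  show "S \<in> sets m"
    using S sets by (simp add: borel_closed finite_imp_closed)
qed

lemma
  assumes m: "sets m = sets (borel :: 'x::t1_space measure)"
  shows unit_atoms_return: "unit_atoms (return m y) = {y}"
    and simple_point_measure_return: "simple_point_measure (return m y)"
proof -
  have space_m: "space m = UNIV"
    using sets_eq_imp_space_eq[OF m] by simp
  have ret: "measure (return m y) {x} = indicator {x} y" for x
    using m by (simp add: measure_return)
  then show "unit_atoms (return m y) = {y}"
    by (auto simp: unit_atoms_def indicator_def)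
  show "simple_point_measure (return m y)"
    unfolding simple_point_measure_def using m by (subst AE_return) (auto simp: ret space_m)
qed

lemma AE_iid_points_law_simple:
  fixes m :: "'x::{metric_space, second_countable_topology} measure"
  assumes m: "prob_space m" "sets m = sets borel" and diffuse: "\<And>x. measure m {x} = 0"
  shows "AE \<mu> in iid_points_law m n. simple_point_measure \<mu>"
proof -
  interpret m: prob_space m by fact
  note borel = finite_measures_cong[OF m(2)]
  have simple[measurable]: "Measurable.pred (finite_measures m) (simple_point_measure :: 'x measure \<Rightarrow> bool)"
    using pred_simple_point_measure by (simp add: borel)
  show ?thesis
  proof (induction n)
    case 0
    have "simple_point_measure (null_measure m)"
      by (auto simp: simple_point_measure_def intro: AE_I[where N="space m"])
    then show ?case
      unfolding iid_points_law.simps AE_return[OF null_measure_in_finite_measures simple] .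
  next
    case (Suc n)
    let ?D = "iid_points_law m n"
    interpret D: prob_space ?D by (rule m.prob_space_iid_points_law)
    interpret Dm: pair_prob_space ?D m ..
    have "AE p in ?D \<Otimes>\<^sub>M m. simple_point_measure (add_measure (fst p) (return m (snd p)))"
    proof (rule Dm.AE_pair_measure)
      show "{p \<in> space (?D \<Otimes>\<^sub>M m). simple_point_measure (add_measure (fst p) (return m (snd p)))} \<in> sets (?D \<Otimes>\<^sub>M m)"
        using measurable_compose[OF measurable_add_point simple] by (simp add: pred_def)
      show "AE \<mu> in ?D. AE y in m. simple_point_measure (add_measure (fst (\<mu>, y)) (return m (snd (\<mu>, y))))"
        using Suc AE_space
      proof eventually_elim
        case (elim \<mu>)
        then have \<mu>: "\<mu> \<in> space (finite_measures borel)"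
          by (simp add: borel)
        show ?case
          using AE_notin_finite_of_diffuse[OF m.finite_measure_axioms m(2) diffuse finite_unit_atoms[OF \<mu>]] AE_space
        proof eventually_elim
          case (elim y)
          then show ?case
            using \<mu> \<open>simple_point_measure \<mu>\<close> return_in_finite_measures[of y m]
            by (simp add: simple_point_measure_add_measure simple_point_measure_return[OF m(2)] unit_atoms_return[OF m(2)] borel)
        qed
      qed
    qed
    then show ?case
      unfolding iid_points_law.simps using simple by (subst AE_distr_iff) (auto simp: pred_def)
  qed
qed

definition poisson_law :: "'a measure \<Rightarrow> real \<Rightarrow> 'a measure measure" where
  "poisson_law m \<theta> = measure_pmf (poisson_pmf \<theta>) \<bind> iid_points_law m"

lemma sets_poisson_law[simp, measurable_cong]: "sets (poisson_law m \<theta>) = sets (finite_measures m)"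
  unfolding poisson_law_def by (rule sets_bind) auto

lemma space_poisson_law[simp]: "space (poisson_law m \<theta>) = space (finite_measures m)"
  by (rule sets_eq_imp_space_eq) simp

context prob_space
begin

lemma measurable_iid_points_law:
  "iid_points_law M \<in> measurable (measure_pmf p) (subprob_algebra (finite_measures M))"
  using prob_space_iid_points_law prob_space_imp_subprob_space by (auto simp: space_subprob_algebra)

lemma prob_space_poisson_law: "prob_space (poisson_law M \<theta>)"
  unfolding poisson_law_def
  by (rule measure_pmf.prob_space_bind[OF _ measurable_iid_points_law]) (simp add: prob_space_iid_points_law)

lemma measure_poisson_law_count_event:
  assumes \<theta>: "0 < \<theta>" and J: "finite J" and A: "\<And>j. j \<in> J \<Longrightarrow> A j \<in> events" "disjoint_family_on A J"
    and cover: "(\<Union>j\<in>J. A j) = space M"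
  shows "measure (poisson_law M \<theta>) (count_event M J A k) = (\<Prod>j\<in>J. poisson_prob (\<theta> * prob (A j)) (k j))"
proof -
  let ?n = "sum k J" and ?w = "multinomial_prob J (\<lambda>j. prob (A j)) k"
  have w: "0 \<le> ?w"
    unfolding multinomial_prob_def by (intro mult_nonneg_nonneg divide_nonneg_nonneg prod_nonneg) auto
  interpret P: prob_space "poisson_law M \<theta>" by (rule prob_space_poisson_law)
  have "emeasure (iid_points_law M n) (count_event M J A k) = ennreal ?w * indicator {?n} n" for n
  proof -
    interpret D: prob_space "iid_points_law M n" by (rule prob_space_iid_points_law)
    have "D.prob (count_event M J A k) = (if sum k J = n then ?w else 0)"
      by (rule measure_iid_points_law_count_event[OF J A cover])
    then show ?thesis
      by (simp add: D.emeasure_eq_measure)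
  qed
  then have "emeasure (poisson_law M \<theta>) (count_event M J A k) = (\<integral>\<^sup>+n. ennreal ?w * indicator {?n} n \<partial>measure_pmf (poisson_pmf \<theta>))"
    unfolding poisson_law_def
    by (subst emeasure_bind[OF _ measurable_iid_points_law sets_count_event[OF J A(1)]]) simp_all
  also have "\<dots> = ennreal (?w * pmf (poisson_pmf \<theta>) ?n)"
    using w by (subst nn_integral_cmult_indicator) (auto simp: emeasure_pmf_single ennreal_mult)
  finally have "measure (poisson_law M \<theta>) (count_event M J A k) = ?w * pmf (poisson_pmf \<theta>) ?n"
    using mult_nonneg_nonneg[OF w pmf_nonneg[of "poisson_pmf \<theta>" ?n]] by (simp only: P.emeasure_eq_measure ennreal_inj measure_nonneg)
  also have "\<dots> = (\<Prod>j\<in>J. prob (A j) ^ k j) / (\<Prod>j\<in>J. fact (k j)) * \<theta> ^ ?n * exp (- \<theta>)"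
    using \<theta> by (simp add: multinomial_prob_def)
  also have "\<theta> ^ ?n = (\<Prod>j\<in>J. \<theta> ^ k j)"
    by (rule power_sum)
  also have "exp (- \<theta>) = (\<Prod>j\<in>J. exp (- (\<theta> * prob (A j))))"
  proof -
    have "(\<Sum>j\<in>J. prob (A j)) = 1"
      using J A cover prob_space by (subst finite_measure_finite_Union[symmetric]) auto
    then show ?thesis
      using J by (simp add: exp_sum[symmetric] sum_negf sum_distrib_left[symmetric])
  qed
  finally show ?thesis
    by (simp add: poisson_prob_def prod.distrib prod_dividef power_mult_distrib)
qed

lemma poisson_rmI:
  assumes N[measurable]: "N \<in> measurable M (finite_measures borel)"
    and nat: "\<And>A. A \<in> sets borel \<Longrightarrow> AE \<omega> in M. measure (N \<omega>) A \<in> \<nat>"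
    and lam: "\<And>A. A \<in> sets borel \<Longrightarrow> 0 \<le> lam A"
    and joint: "\<And>(J :: nat set) A k. finite J \<Longrightarrow> (\<And>j. j \<in> J \<Longrightarrow> A j \<in> sets borel) \<Longrightarrow> disjoint_family_on A J \<Longrightarrow>
      (\<Union>j\<in>J. A j) = UNIV \<Longrightarrow> prob {\<omega>\<in>space M. \<forall>j\<in>J. measure (N \<omega>) (A j) = real (k j)} = (\<Prod>j\<in>J. poisson_prob (lam (A j)) (k j))"
  shows "poisson_rm M N lam"
proof -
  have counts: "indep_vars (\<lambda>_. borel) (\<lambda>j \<omega>. measure (N \<omega>) (A j)) J \<and>
      (\<forall>j\<in>J. \<forall>k. prob {\<omega>\<in>space M. measure (N \<omega>) (A j) = real k} = poisson_prob (lam (A j)) k)"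
    if J: "finite J" and A: "\<And>j. j \<in> J \<Longrightarrow> A j \<in> sets borel" "disjoint_family_on A J" for J :: "nat set" and A
  proof -
    obtain z where z: "z \<notin> J"
      using ex_new_if_finite[OF infinite_UNIV_nat J] by blast
    define A' where "A' = A(z := - (\<Union>j\<in>J. A j))"
    have A'J: "A' j = A j" if "j \<in> J" for j
      using that z by (auto simp: A'_def)
    have A': "A' j \<in> sets borel" if "j \<in> insert z J" for j
    proof (cases "j = z")
      case True
      have "- (\<Union>j\<in>J. A j) \<in> sets borel"
        using A(1) J by (intro borel_comp sets.finite_UN)
      then show ?thesis
        by (simp only: A'_def True fun_upd_same)
    qed (use that A(1) in \<open>simp add: A'_def\<close>)
    have disj: "disjoint_family_on A' (insert z J)"
      using A(2) z by (auto simp: disjoint_family_on_def A'_def)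
    have cover: "(\<Union>j\<in>insert z J. A' j) = UNIV"
      using z by (auto simp: A'_def)
    have hyps: "finite (insert z J)" "\<And>j. j \<in> insert z J \<Longrightarrow> (\<lambda>\<omega>. measure (N \<omega>) (A' j)) \<in> borel_measurable M"
      "\<And>j. j \<in> insert z J \<Longrightarrow> AE \<omega> in M. measure (N \<omega>) (A' j) \<in> \<nat>"
      "\<And>j k. j \<in> insert z J \<Longrightarrow> 0 \<le> poisson_prob (lam (A' j)) k" "\<And>j. j \<in> insert z J \<Longrightarrow> poisson_prob (lam (A' j)) sums 1"
      "\<And>k. prob {\<omega>\<in>space M. \<forall>j\<in>insert z J. measure (N \<omega>) (A' j) = real (k j)} = (\<Prod>j\<in>insert z J. poisson_prob (lam (A' j)) (k j))"
      using J A' nat lam joint[OF _ A' disj cover]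
      by (auto intro: poisson_prob_nonneg poisson_prob_sums measurable_compose[OF N measurable_measure_finite_measures])
    have "indep_vars (\<lambda>_. borel) (\<lambda>j \<omega>. measure (N \<omega>) (A' j)) J"
      using hyps by (intro indep_vars_subset[OF indep_vars_nat_valuedI subset_insertI])
    moreover have "prob {\<omega>\<in>space M. measure (N \<omega>) (A' j) = real k} = poisson_prob (lam (A' j)) k" if "j \<in> J" for j k
      using that by (intro prob_nat_valued_marginal[OF hyps]) auto
    ultimately show ?thesis
      by (simp add: A'J cong: indep_vars_cong)
  qed
  have "prob {\<omega>\<in>space M. measure (N \<omega>) A = real k} = poisson_prob (lam A) k" if "A \<in> sets borel" for A k
    using counts[of "{0}" "\<lambda>_. A"] that by (simp add: disjoint_family_on_def)
  then show ?thesis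
    using N counts by (simp add: poisson_rm_def random_measure_iff_measurable poisson_prob_def)
qed

end

lemma measure_pair_fst:
  assumes "prob_space N" and P: "{x\<in>space M. P x} \<in> sets M"
  shows "measure (M \<Otimes>\<^sub>M N) {\<omega>\<in>space (M \<Otimes>\<^sub>M N). P (fst \<omega>)} = measure M {x\<in>space M. P x}"
proof -
  interpret N: prob_space N by fact
  have "{\<omega>\<in>space (M \<Otimes>\<^sub>M N). P (fst \<omega>)} = {x\<in>space M. P x} \<times> space N"
    by (auto simp: space_pair_measure)
  then show ?thesis
    using P by (simp add: measure_def N.emeasure_pair_measure_Times N.emeasure_space_1)
qed

lemma measure_pair_snd:
  assumes "prob_space M" "sigma_finite_measure N" and P: "{x\<in>space N. P x} \<in> sets N"
  shows "measure (M \<Otimes>\<^sub>M N) {\<omega>\<in>space (M \<Otimes>\<^sub>M N). P (snd \<omega>)} = measure N {x\<in>space N. P x}"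
proof -
  have "{\<omega>\<in>space (M \<Otimes>\<^sub>M N). P (snd \<omega>)} = space M \<times> {x\<in>space N. P x}"
    by (auto simp: space_pair_measure)
  then show ?thesis
    using P assms by (simp add: measure_def sigma_finite_measure.emeasure_pair_measure_Times prob_space.emeasure_space_1)
qed

lemma (in pair_prob_space) indep_set_vimage_fst_snd:
  assumes f: "f \<in> measurable M1 S" and g: "g \<in> measurable M2 T"
  shows "P.indep_set
      (sets (vimage_algebra (space (M1 \<Otimes>\<^sub>M M2)) (\<lambda>\<omega>. f (fst \<omega>)) S))
      (sets (vimage_algebra (space (M1 \<Otimes>\<^sub>M M2)) (\<lambda>\<omega>. g (snd \<omega>)) T))"
proof -
  have fg: "(\<lambda>\<omega>. f (fst \<omega>)) \<in> measurable (M1 \<Otimes>\<^sub>M M2) S" "(\<lambda>\<omega>. g (snd \<omega>)) \<in> measurable (M1 \<Otimes>\<^sub>M M2) T"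
    using f g by measurable
  have preimage: "(\<lambda>\<omega>. f (fst \<omega>)) -` A \<inter> space (M1 \<Otimes>\<^sub>M M2) = (f -` A \<inter> space M1) \<times> space M2"
    "(\<lambda>\<omega>. g (snd \<omega>)) -` B \<inter> space (M1 \<Otimes>\<^sub>M M2) = space M1 \<times> (g -` B \<inter> space M2)" for A B
    by (auto simp: space_pair_measure)
  have "P.prob ((f -` A \<inter> space M1) \<times> space M2 \<inter> space M1 \<times> (g -` B \<inter> space M2))
      = P.prob ((f -` A \<inter> space M1) \<times> space M2) * P.prob (space M1 \<times> (g -` B \<inter> space M2))"
    if "A \<in> sets S" "B \<in> sets T" for A B
    using measurable_sets[OF f that(1)] measurable_sets[OF g that(2)]
    by (simp add: Times_Int_Times measure_def M2.emeasure_pair_measure_Times enn2real_mult M1.emeasure_space_1 M2.emeasure_space_1)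
  moreover have "(\<lambda>\<omega>. f (fst \<omega>)) \<in> space (M1 \<Otimes>\<^sub>M M2) \<rightarrow> space S" "(\<lambda>\<omega>. g (snd \<omega>)) \<in> space (M1 \<Otimes>\<^sub>M M2) \<rightarrow> space T"
    using measurable_space[OF fg(1)] measurable_space[OF fg(2)] by blast+
  ultimately show ?thesis
    using measurable_sets[OF fg(1)] measurable_sets[OF fg(2)]
    by (auto simp: P.indep_sets2_eq sets_vimage_algebra2 preimage)
qed

lemma
  fixes m :: "'x::{metric_space, second_countable_topology} measure"
  assumes m: "prob_space m" "sets m = sets borel" and diffuse: "\<And>x. measure m {x} = 0" and \<theta>: "0 < \<theta>"
    and D: "prob_space D"
  shows poisson_rm_fst_poisson_law: "poisson_rm (poisson_law m \<theta> \<Otimes>\<^sub>M D) fst (\<lambda>A. \<theta> * measure m A)"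
    and AE_simple_fst_poisson_law: "AE \<omega> in poisson_law m \<theta> \<Otimes>\<^sub>M D. simple_point_measure (fst \<omega>)"
proof -
  interpret m: prob_space m by (rule m)
  interpret L: prob_space "poisson_law m \<theta>" by (rule m.prob_space_poisson_law)
  interpret D: prob_space D by (rule D)
  interpret LD: pair_prob_space "poisson_law m \<theta>" D ..
  note borel = finite_measures_cong[OF m(2)]
  have simple[measurable]: "Measurable.pred (finite_measures m) (simple_point_measure :: 'x measure \<Rightarrow> bool)"
    using pred_simple_point_measure by (simp add: borel)
  have "AE \<mu> in poisson_law m \<theta>. simple_point_measure \<mu>"
    unfolding poisson_law_def using AE_iid_points_law_simple[OF m diffuse]
    by (subst AE_bind[OF m.measurable_iid_points_law]) auto
  moreover have "Measurable.pred (poisson_law m \<theta> \<Otimes>\<^sub>M D) (\<lambda>\<omega>. simple_point_measure (fst \<omega>))"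
    by measurable
  ultimately show AE_simple: "AE \<omega> in poisson_law m \<theta> \<Otimes>\<^sub>M D. simple_point_measure (fst \<omega>)"
    by (intro LD.AE_pair_measure) (auto simp: pred_def elim: eventually_mono)
  show "poisson_rm (poisson_law m \<theta> \<Otimes>\<^sub>M D) fst (\<lambda>A. \<theta> * measure m A)"
  proof (rule LD.P.poisson_rmI)
    show "fst \<in> measurable (poisson_law m \<theta> \<Otimes>\<^sub>M D) (finite_measures borel)"
      using measurable_fst[of "poisson_law m \<theta>" D] by (simp add: borel cong: measurable_cong_sets)
    show "AE \<omega> in poisson_law m \<theta> \<Otimes>\<^sub>M D. measure (fst \<omega>) A \<in> \<nat>" if "A \<in> sets borel" for A
      using AE_simple AE_space
    proof eventually_elim
      case (elim \<omega>)
      then have "fst \<omega> \<in> space (finite_measures borel)"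
        by (auto simp: space_pair_measure borel)
      then show ?case
        using measure_simple_point_measure[OF _ elim(1) that] by simp
    qed
    fix J :: "nat set" and A :: "nat \<Rightarrow> 'x set" and k
    assume J: "finite J" and A: "\<And>j. j \<in> J \<Longrightarrow> A j \<in> sets borel" "disjoint_family_on A J" and cover: "(\<Union>j\<in>J. A j) = UNIV"
    have Am: "\<And>j. j \<in> J \<Longrightarrow> A j \<in> sets m" "(\<Union>j\<in>J. A j) = space m"
      using A(1) cover m(2) sets_eq_imp_space_eq[OF m(2)] by auto
    have "LD.P.prob {\<omega>\<in>space (poisson_law m \<theta> \<Otimes>\<^sub>M D). \<forall>j\<in>J. measure (fst \<omega>) (A j) = real (k j)}
        = L.prob (count_event m J A k)"
      using sets_count_event[OF J Am(1)] by (subst measure_pair_fst[OF D]) (auto simp: count_event_def)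
    then show "LD.P.prob {\<omega>\<in>space (poisson_law m \<theta> \<Otimes>\<^sub>M D). \<forall>j\<in>J. measure (fst \<omega>) (A j) = real (k j)}
        = (\<Prod>j\<in>J. poisson_prob (\<theta> * measure m (A j)) (k j))"
      using m.measure_poisson_law_count_event[OF \<theta> J Am(1) A(2) Am(2)] by simp
  qed (use \<theta> in simp)
qed

definition bernoulli_points_law :: "'x::topological_space set \<Rightarrow> ('x \<Rightarrow> real) \<Rightarrow> 'x measure measure" where
  "bernoulli_points_law S p = distr (measure_pmf (Pi_pmf S False (\<lambda>x. bernoulli_pmf (p x)))) (finite_measures borel)
     (\<lambda>v. counting_on {x\<in>S. v x})"

lemma sets_bernoulli_points_law[simp, measurable_cong]: "sets (bernoulli_points_law S p) = sets (finite_measures borel)"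
  by (simp add: bernoulli_points_law_def)

lemma space_bernoulli_points_law[simp]: "space (bernoulli_points_law S p) = space (finite_measures borel)"
  by (simp add: bernoulli_points_law_def)

lemma measurable_counting_on_pmf:
  "finite S \<Longrightarrow> (\<lambda>v. counting_on {x\<in>S. v x}) \<in> measurable (measure_pmf p) (finite_measures borel)"
  by (simp add: counting_on_in_finite_measures)

lemma prob_space_bernoulli_points_law: "finite S \<Longrightarrow> prob_space (bernoulli_points_law S p)"
  unfolding bernoulli_points_law_def by (intro measure_pmf.prob_space_distr measurable_counting_on_pmf)

lemma measurable_indicator_unit_atoms[measurable]:
  "(\<lambda>\<mu>. indicator (unit_atoms \<mu>) x :: real) \<in> borel_measurable (finite_measures (borel :: 'x::t1_space measure))"
proof -
  have "(\<lambda>\<mu>. if measure \<mu> {x} = 1 then 1 else 0 :: real) \<in> borel_measurable (finite_measures borel)"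
    by measurable
  then show ?thesis
    by (simp add: indicator_def unit_atoms_def cong: if_cong)
qed

lemma measure_bernoulli_pmf_of_bool:
  assumes "0 \<le> p" "p \<le> 1"
  shows "measure_pmf.prob (bernoulli_pmf p) {b. of_bool b = real k} = bernoulli_prob p k"
proof -
  consider (zero) "k = 0" | (one) "k = 1" | (large) "k \<ge> 2"
    by linarith
  then show ?thesis
  proof cases
    case zero
    then have "{b. of_bool b = real k} = {False}"
      by auto
    then show ?thesis
      using assms zero by (simp add: measure_pmf_single bernoulli_prob_def)
  next
    case one
    then have "{b. of_bool b = real k} = {True}"
      by auto
    then show ?thesis
      using assms one by (simp add: measure_pmf_single bernoulli_prob_def)
  next
    case large
    then have "{b. of_bool b = real k} = {}"
      by (auto simp: of_bool_def)
    then show ?thesis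
      using large by (simp add: bernoulli_prob_def del: Collect_empty_eq)
  qed
qed

lemma measure_bernoulli_points_law:
  fixes S :: "'x::t1_space set"
  assumes S: "finite S" and p: "\<And>x. 0 \<le> p x" "\<And>x. p x \<le> 1"
  shows "measure (bernoulli_points_law S p) {\<mu>\<in>space (finite_measures borel). \<forall>x\<in>S. indicator (unit_atoms \<mu>) x = real (k x)}
    = (\<Prod>x\<in>S. bernoulli_prob (p x) (k x))"
proof -
  let ?E = "{\<mu>\<in>space (finite_measures borel). \<forall>x\<in>S. indicator (unit_atoms \<mu>) x = real (k x)}"
  have "?E \<in> sets (finite_measures borel)"
    using S by measurable
  moreover have "(\<lambda>v. counting_on {x\<in>S. v x}) -` ?E = (\<Pi> x\<in>S. {b. of_bool b = real (k x)})"
    using S by (auto simp: counting_on_in_finite_measures unit_atoms_counting_on indicator_def of_bool_def)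
  ultimately show ?thesis
    unfolding bernoulli_points_law_def using measurable_counting_on_pmf[OF S]
    by (simp add: measure_distr measure_Pi_pmf_Pi[OF S] measure_bernoulli_pmf_of_bool p)
qed

locale hazard_measure = m: prob_space m
  for m :: "'x::{metric_space, second_countable_topology} measure" +
  fixes \<theta> :: real and \<nu> :: "'x measure"
  assumes sets_m: "sets m = sets borel" and diffuse: "\<And>x. measure m {x} = 0" and \<theta>: "0 < \<theta>"
    and finite_atoms: "finite (atoms_of \<nu>)" and atom_le_1: "\<And>x. measure \<nu> {x} \<le> 1"
    and diffuse_part_eq: "\<And>A. A \<in> sets borel \<Longrightarrow> diffuse_part \<nu> A = \<theta> * measure m A"
begin

definition BeP_space :: "('x measure \<times> 'x measure) measure" where
  "BeP_space = poisson_law m \<theta> \<Otimes>\<^sub>M bernoulli_points_law (atoms_of \<nu>) (\<lambda>x. measure \<nu> {x})"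

definition BeP_realization :: "'x measure \<times> 'x measure \<Rightarrow> 'x measure" where
  "BeP_realization \<omega> = add_unit_masses (atoms_of \<nu>) (fst \<omega>, indicator (unit_atoms (snd \<omega>)))"

sublocale BP: pair_prob_space "poisson_law m \<theta>" "bernoulli_points_law (atoms_of \<nu>) (\<lambda>x. measure \<nu> {x})"
  using m.prob_space_poisson_law prob_space_bernoulli_points_law[OF finite_atoms]
  by (simp add: pair_prob_space_def pair_sigma_finite_def prob_space_imp_sigma_finite)

lemma prob_space_BeP_space: "prob_space BeP_space"
  unfolding BeP_space_def by (rule BP.P.prob_space_axioms)

lemma space_BeP_space: "space BeP_space = space (finite_measures borel) \<times> space (finite_measures borel)"
  by (simp add: BeP_space_def space_pair_measure finite_measures_cong[OF sets_m])

lemma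
  shows measurable_fst_BeP_space: "fst \<in> measurable BeP_space (finite_measures borel)"
    and measurable_snd_BeP_space: "snd \<in> measurable BeP_space (finite_measures borel)"
  unfolding BeP_space_def
  using measurable_fst[of "poisson_law m \<theta>"] measurable_snd[of _ "bernoulli_points_law (atoms_of \<nu>) (\<lambda>x. measure \<nu> {x})"]
  by (simp_all add: finite_measures_cong[OF sets_m] cong: measurable_cong_sets)

lemma poisson_rm_fst_BeP_space: "poisson_rm BeP_space fst (diffuse_part \<nu>)"
  and AE_simple_fst_BeP_space: "AE \<omega> in BeP_space. simple_point_measure (fst \<omega>)"
proof -
  note law = m.prob_space_axioms sets_m diffuse \<theta> BP.M2.prob_space_axioms
  show "AE \<omega> in BeP_space. simple_point_measure (fst \<omega>)"
    unfolding BeP_space_def by (rule AE_simple_fst_poisson_law[OF law])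
  show "poisson_rm BeP_space fst (diffuse_part \<nu>)"
    using poisson_rm_fst_poisson_law[OF law, folded BeP_space_def] by (simp add: poisson_rm_def diffuse_part_eq)
qed

lemma prob_indicator_unit_atoms_snd:
  "measure BeP_space {\<omega>\<in>space BeP_space. \<forall>x\<in>atoms_of \<nu>. indicator (unit_atoms (snd \<omega>)) x = real (k x)}
    = (\<Prod>x\<in>atoms_of \<nu>. bernoulli_prob (measure \<nu> {x}) (k x))"
proof -
  have "{\<mu>\<in>space (finite_measures borel). \<forall>x\<in>atoms_of \<nu>. indicator (unit_atoms \<mu>) x = real (k x)} \<in> sets (finite_measures borel)"
    using finite_atoms by measurable
  then show ?thesis
    unfolding BeP_space_def
    by (subst measure_pair_snd) (simp_all add: BP.M1.prob_space_axioms BP.M2.sigma_finite_measure_axioms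
        measure_bernoulli_points_law finite_atoms atom_le_1)
qed

lemma BeP_rm_BeP_realization: "BeP_rm BeP_space BeP_realization \<nu>"
  unfolding BeP_rm_def random_measure_iff_measurable
proof (intro conjI exI[of _ fst] exI[of _ "\<lambda>x \<omega>. indicator (unit_atoms (snd \<omega>)) x"] ballI)
  let ?V = "\<lambda>x \<omega>. indicator (unit_atoms (snd \<omega>)) x :: real"
  interpret Q: prob_space BeP_space by (rule prob_space_BeP_space)
  note [measurable] = measurable_fst_BeP_space measurable_snd_BeP_space
  have V: "?V x \<in> borel_measurable BeP_space" for x
    by measurable
  have "(\<lambda>\<omega>. (fst \<omega>, \<lambda>x\<in>atoms_of \<nu>. ?V x \<omega>)) \<in> measurable BeP_space (finite_measures borel \<Otimes>\<^sub>M PiM (atoms_of \<nu>) (\<lambda>_. borel))"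
    using V by measurable
  from measurable_compose[OF this measurable_add_unit_masses[OF finite_atoms]]
  show "BeP_realization \<in> measurable BeP_space (finite_measures borel)"
    by (simp add: BeP_realization_def[abs_def] add_unit_masses_def cong: conj_cong)
  show "poisson_rm BeP_space fst (diffuse_part \<nu>)"
    by (rule poisson_rm_fst_BeP_space)
  show "?V x \<in> borel_measurable BeP_space" for x
    by (rule V)
  show "?V x \<omega> \<in> {0, 1}" for x \<omega>
    by (simp add: indicator_def)
  have V_nat: "?V x \<omega> \<in> \<nat>" for x \<omega>
    by (simp add: indicator_def)
  show "Q.indep_vars (\<lambda>_. borel) ?V (atoms_of \<nu>)"
    by (intro Q.indep_vars_nat_valuedI[where p="\<lambda>x. bernoulli_prob (measure \<nu> {x})"] finite_atoms V V_nat AE_I2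
        bernoulli_prob_nonneg bernoulli_prob_sums prob_indicator_unit_atoms_snd atom_le_1 measure_nonneg)
  show "Q.prob {\<omega>\<in>space BeP_space. ?V x \<omega> = 1} = measure \<nu> {x}" if "x \<in> atoms_of \<nu>" for x
    using Q.prob_nat_valued_marginal[OF finite_atoms V AE_I2[OF V_nat] bernoulli_prob_nonneg bernoulli_prob_sums
        prob_indicator_unit_atoms_snd that, of 1]
    by (simp add: atom_le_1 bernoulli_prob_def)
  have "(\<lambda>\<mu>. \<lambda>x\<in>atoms_of \<nu>. indicator (unit_atoms \<mu>) x :: real)
      \<in> measurable (bernoulli_points_law (atoms_of \<nu>) (\<lambda>x. measure \<nu> {x})) (PiM (atoms_of \<nu>) (\<lambda>_. borel))"
    by measurable
  from BP.indep_set_vimage_fst_snd[OF _ this, of "\<lambda>\<mu>. \<mu>" "finite_measures borel"]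
  show "Q.indep_set (sets (vimage_algebra (space BeP_space) fst (finite_measures borel)))
      (sets (vimage_algebra (space BeP_space) (\<lambda>\<omega>. \<lambda>x\<in>atoms_of \<nu>. ?V x \<omega>) (PiM (atoms_of \<nu>) (\<lambda>_. borel))))"
    by (simp add: BeP_space_def finite_measures_cong[OF sets_m] cong: measurable_cong_sets)
  show "AE \<omega> in BeP_space. \<forall>B\<in>sets borel. measure (BeP_realization \<omega>) B
      = measure (fst \<omega>) B + (\<Sum>\<^sub>\<infinity>x\<in>atoms_of \<nu> \<inter> B. ?V x \<omega>)"
    unfolding BeP_realization_def
    by (intro AE_I2 ballI measure_add_unit_masses) (auto simp: space_BeP_space finite_atoms indicator_def)
qed

lemma AE_simple_BeP_realization: "AE \<omega> in BeP_space. simple_point_measure (BeP_realization \<omega>)"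
proof -
  interpret Q: prob_space BeP_space by (rule prob_space_BeP_space)
  have fst[measurable]: "fst \<in> measurable BeP_space (finite_measures borel)"
    by (rule measurable_fst_BeP_space)
  have "AE \<omega> in BeP_space. measure (fst \<omega>) {x} = 0" for x
  proof -
    have "Q.prob {\<omega>\<in>space BeP_space. measure (fst \<omega>) {x} = 0} = 1"
      using poisson_rm_fst_BeP_space by (auto simp: poisson_rm_def diffuse_part_eq diffuse dest!: bspec[of _ _ "{x}"] spec[of _ 0])
    then show ?thesis
      by (rule Q.AE_prob_1[THEN AE_mp]) simp
  qed
  then have "AE \<omega> in BeP_space. \<forall>x\<in>atoms_of \<nu>. measure (fst \<omega>) {x} = 0"
    by (intro AE_finite_allI finite_atoms)
  then show ?thesis
    using AE_simple_fst_BeP_space AE_space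
  proof eventually_elim
    case (elim \<omega>)
    let ?T = "{x\<in>atoms_of \<nu>. indicator (unit_atoms (snd \<omega>)) x = (1 :: real)}"
    have "finite ?T"
      using finite_atoms by simp
    moreover have "unit_atoms (fst \<omega>) \<inter> ?T = {}"
      using elim(1) by (auto simp: unit_atoms_def)
    moreover have "fst \<omega> \<in> space (finite_measures borel)"
      using elim(3) by (auto simp: space_BeP_space)
    ultimately show ?case
      unfolding BeP_realization_def add_unit_masses_def fst_conv snd_conv
      by (intro simple_point_measure_add_measure elim(2))
         (simp_all only: counting_on_in_finite_measures simple_point_measure_counting_on unit_atoms_counting_on)
  qed
qed

lemma BeP_law_eq_distr: "BeP_law \<nu> = distr BeP_space (finite_measures borel) BeP_realization"
  unfolding BeP_law_def
proof (rule the_equality)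
  show "\<exists>(Q :: ('x measure \<times> 'x measure) measure) N. prob_space Q \<and> BeP_rm Q N \<nu>
      \<and> distr BeP_space (finite_measures borel) BeP_realization = distr Q (finite_measures borel) N"
    using prob_space_BeP_space BeP_rm_BeP_realization by blast
  fix D assume "\<exists>(Q :: ('x measure \<times> 'x measure) measure) N. prob_space Q \<and> BeP_rm Q N \<nu> \<and> D = distr Q (finite_measures borel) N"
  then show "D = distr BeP_space (finite_measures borel) BeP_realization"
    using BeP_rm_unique[OF _ _ prob_space_BeP_space BeP_rm_BeP_realization finite_atoms] by blast
qed

lemma measurable_BeP_realization: "BeP_realization \<in> measurable BeP_space (finite_measures borel)"
  using BeP_rm_BeP_realization by (simp add: BeP_rm_def random_measure_iff_measurable)

lemma prob_space_BeP_law: "prob_space (BeP_law \<nu>)"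
  unfolding BeP_law_eq_distr
  by (intro prob_space.prob_space_distr prob_space_BeP_space measurable_BeP_realization)

lemma sets_BeP_law: "sets (BeP_law \<nu>) = sets (finite_measures borel)"
  by (simp add: BeP_law_eq_distr)

lemma AE_simple_BeP_law: "AE \<mu> in BeP_law \<nu>. simple_point_measure \<mu>"
  unfolding BeP_law_eq_distr using pred_simple_point_measure
  by (subst AE_distr_iff[OF measurable_BeP_realization]) (simp_all add: AE_simple_BeP_realization pred_def)

lemma measure_BeP_law_off_atoms:
  assumes A[measurable]: "A \<in> sets borel" and disj: "A \<inter> atoms_of \<nu> = {}"
  shows "measure (BeP_law \<nu>) {\<mu>\<in>space (finite_measures borel). measure \<mu> A = real k} = poisson_prob (\<theta> * measure m A) k"
proof -
  note [measurable] = measurable_BeP_realization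
  have "measure (BeP_realization \<omega>) A = measure (fst \<omega>) A" if "\<omega> \<in> space BeP_space" for \<omega>
  proof -
    have "atoms_of \<nu> \<inter> A = {}"
      using disj by auto
    then show ?thesis
      unfolding BeP_realization_def using that finite_atoms A
      by (subst measure_add_unit_masses) (auto simp: space_BeP_space indicator_def)
  qed
  then have "BeP_realization -` {\<mu>\<in>space (finite_measures borel). measure \<mu> A = real k} \<inter> space BeP_space
      = {\<omega>\<in>space BeP_space. measure (fst \<omega>) A = real k}"
    using measurable_space[OF measurable_BeP_realization] by auto
  moreover have "measure BeP_space {\<omega>\<in>space BeP_space. measure (fst \<omega>) A = real k} = poisson_prob (\<theta> * measure m A) k"
    using poisson_rm_fst_BeP_space A by (simp add: poisson_rm_def poisson_prob_def diffuse_part_eq)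
  ultimately show ?thesis
    unfolding BeP_law_eq_distr by (subst measure_distr) measurable
qed

end

section \<open>Conditional laws\<close>

lemma (in sigma_finite_subalgebra) nn_cond_exp_suminf:
  assumes f[measurable]: "\<And>i. f i \<in> borel_measurable M"
  shows "AE x in M. nn_cond_exp M F (\<lambda>x. \<Sum>i. f i x) x = (\<Sum>i. nn_cond_exp M F (f i) x)"
proof -
  have cond[measurable]: "nn_cond_exp M F (f i) \<in> borel_measurable M" for i
    by (rule measurable_from_subalg[OF subalg]) simp
  have "AE x in M. (\<Sum>i. nn_cond_exp M F (f i) x) = nn_cond_exp M F (\<lambda>x. \<Sum>i. f i x) x"
  proof (rule nn_cond_exp_charact)
    fix A assume A: "A \<in> sets F"
    then have [measurable]: "A \<in> sets M"
      using subalg by (auto simp: subalgebra_def)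
    have "(\<integral>\<^sup>+x\<in>A. (\<Sum>i. f i x) \<partial>M) = (\<Sum>i. \<integral>\<^sup>+x. indicator A x * f i x \<partial>M)"
      by (simp add: nn_integral_suminf[symmetric] mult.commute)
    also have "\<dots> = (\<Sum>i. \<integral>\<^sup>+x. indicator A x * nn_cond_exp M F (f i) x \<partial>M)"
      using A by (intro arg_cong[where f=suminf] ext nn_cond_exp_intg[symmetric]) simp_all
    also have "\<dots> = (\<integral>\<^sup>+x\<in>A. (\<Sum>i. nn_cond_exp M F (f i) x) \<partial>M)"
      by (simp add: nn_integral_suminf[symmetric] mult.commute)
    finally show "(\<integral>\<^sup>+x\<in>A. (\<Sum>i. f i x) \<partial>M) = (\<integral>\<^sup>+x\<in>A. (\<Sum>i. nn_cond_exp M F (f i) x) \<partial>M)" .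
  qed simp_all
  then show ?thesis
    by (auto elim: eventually_mono)
qed

lemma (in finite_measure_subalgebra) nn_cond_exp_indicator_eq_real_cond_exp:
  assumes E[measurable]: "E \<in> sets M"
  shows "AE x in M. nn_cond_exp M F (indicator E) x = ennreal (real_cond_exp M F (indicator E) x)"
proof -
  have "AE x in M. nn_cond_exp M F (indicator E) x \<le> nn_cond_exp M F (\<lambda>_. 1) x"
    by (intro nn_cond_exp_mono) (auto simp: indicator_def)
  moreover have "AE x in M. 1 = nn_cond_exp M F (\<lambda>_. 1) x" "AE x in M. 0 = nn_cond_exp M F (\<lambda>_. 0) x"
    by (intro nn_cond_exp_F_meas; simp)+
  ultimately show ?thesis
  proof eventually_elim
    case (elim x)
    then have "nn_cond_exp M F (indicator E) x \<noteq> top"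
      by (metis ennreal_one_neq_top neq_top_trans)
    moreover have "(\<lambda>x. ennreal (- indicator E x)) = (\<lambda>_. 0)"
      by (auto simp: fun_eq_iff ennreal_neg)
    ultimately show ?case
      using elim(3) by (simp add: real_cond_exp_def ennreal_indicator less_top)
  qed
qed

lemma (in finite_measure_subalgebra) nn_cond_exp_indicator_compl:
  assumes [measurable]: "E \<in> sets M"
  shows "AE x in M. nn_cond_exp M F (indicator E) x + nn_cond_exp M F (indicator (space M - E)) x = 1"
proof -
  have "AE x in M. nn_cond_exp M F (indicator E) x + nn_cond_exp M F (indicator (space M - E)) x
      = nn_cond_exp M F (\<lambda>x. indicator E x + indicator (space M - E) x) x"
    by (intro nn_cond_exp_sum) auto
  moreover have "AE x in M. nn_cond_exp M F (\<lambda>x. indicator E x + indicator (space M - E) x) x = nn_cond_exp M F (\<lambda>_. 1) x"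
    by (intro nn_cond_exp_cong AE_I2) (auto split: split_indicator)
  moreover have "AE x in M. 1 = nn_cond_exp M F (\<lambda>_. 1) x"
    by (rule nn_cond_exp_F_meas) simp
  ultimately show ?thesis
    by eventually_elim simp
qed

lemma (in finite_measure_subalgebra) nn_cond_exp_indicator_UN:
  assumes [measurable]: "\<And>i. E i \<in> sets M" and disj: "disjoint_family E"
  shows "AE x in M. nn_cond_exp M F (indicator (\<Union>i. E i)) x = (\<Sum>i. nn_cond_exp M F (indicator (E i)) x)"
proof -
  have "indicator (\<Union>i. E i) = (\<lambda>x. \<Sum>i. indicator (E i) x :: ennreal)"
    by (simp add: suminf_indicator[OF disj])
  then show ?thesis
    using nn_cond_exp_suminf[of "\<lambda>i. indicator (E i)"] by simp
qed

text \<open>The kernel need not be measurable: its sections agree almost surely with measurable functions.\<close>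

locale conditional_law = prob_space M for M :: "'a measure" +
  fixes F :: "'a measure" and G :: "'b measure" and Y :: "'a \<Rightarrow> 'b" and \<kappa> :: "'a \<Rightarrow> 'b measure"
  assumes subalgebra_F: "subalgebra M F" and Y_measurable[measurable]: "Y \<in> measurable M G"
    and AE_prob_space_\<kappa>: "AE \<omega> in M. prob_space (\<kappa> \<omega>) \<and> sets (\<kappa> \<omega>) = sets G"
    and nn_cond_exp_Y: "\<And>A. A \<in> sets G \<Longrightarrow>
      AE \<omega> in M. nn_cond_exp M F (indicator {\<omega>\<in>space M. Y \<omega> \<in> A}) \<omega> = emeasure (\<kappa> \<omega>) A"
begin

sublocale finite_measure_subalgebra M F
  by unfold_locales (rule subalgebra_F)

lemma space_F: "space F = space M"
  using subalgebra_F by (simp add: subalgebra_def)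

definition graph_event :: "('a \<times> 'b) set \<Rightarrow> 'a set" where
  "graph_event W = {\<omega>\<in>space M. (\<omega>, Y \<omega>) \<in> W}"

definition section_law :: "('a \<times> 'b) set \<Rightarrow> bool" where
  "section_law W \<longleftrightarrow> (AE \<omega> in M. nn_cond_exp M F (indicator (graph_event W)) \<omega> = emeasure (\<kappa> \<omega>) (Pair \<omega> -` W))"

lemma sets_graph_event:
  assumes "W \<in> sets (F \<Otimes>\<^sub>M G)"
  shows "graph_event W \<in> events"
proof -
  have "(\<lambda>\<omega>. (\<omega>, Y \<omega>)) \<in> measurable M (F \<Otimes>\<^sub>M G)"
    by (intro measurable_Pair measurable_from_subalg[OF subalgebra_F] measurable_ident_sets Y_measurable refl)
  from measurable_sets[OF this assms] show ?thesis
    by (simp add: graph_event_def vimage_def Int_def conj_commute)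
qed

lemma section_law_Times:
  assumes A: "A \<in> sets F" and B: "B \<in> sets G"
  shows "section_law (A \<times> B)"
proof -
  let ?YB = "{\<omega>\<in>space M. Y \<omega> \<in> B}"
  have "?YB \<in> events"
    using B by measurable
  moreover have "indicator (graph_event (A \<times> B)) = (\<lambda>\<omega>. indicator A \<omega> * indicator ?YB \<omega> :: ennreal)"
    using sets.sets_into_space[OF A] by (auto simp: graph_event_def space_F split: split_indicator)
  ultimately have "AE \<omega> in M. indicator A \<omega> * nn_cond_exp M F (indicator ?YB) \<omega>
      = nn_cond_exp M F (indicator (graph_event (A \<times> B))) \<omega>"
    using A by (simp add: nn_cond_exp_prod)
  then show ?thesis
    unfolding section_law_def using nn_cond_exp_Y[OF B]
  proof eventually_elim
    case (elim \<omega>)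
    then show ?case
      by (cases "\<omega> \<in> A") simp_all
  qed
qed

lemma section_law_empty: "section_law {}"
  using section_law_Times[of "{}" "{}"] by simp

lemma section_law_Diff:
  assumes W: "W \<in> sets (F \<Otimes>\<^sub>M G)" and law: "section_law W"
  shows "section_law (space F \<times> space G - W)"
proof -
  let ?W' = "space F \<times> space G - W"
  have graph_compl: "graph_event ?W' = space M - graph_event W"
    using measurable_space[OF Y_measurable] by (auto simp: graph_event_def space_F)
  show ?thesis
    unfolding section_law_def graph_compl
    using nn_cond_exp_indicator_compl[OF sets_graph_event[OF W]] AE_prob_space_\<kappa> law[unfolded section_law_def] AE_space
  proof eventually_elim
    case (elim \<omega>)
    then interpret K: prob_space "\<kappa> \<omega>"
      by simp
    have "space (\<kappa> \<omega>) = space G"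
      using elim(2) by (auto dest: sets_eq_imp_space_eq)
    then have "Pair \<omega> -` ?W' = space (\<kappa> \<omega>) - Pair \<omega> -` W"
      using elim(4) by (auto simp: space_F)
    moreover have "Pair \<omega> -` W \<in> K.events"
      using sets_Pair1[OF W, of \<omega>] elim(2) by simp
    ultimately have "emeasure (\<kappa> \<omega>) (Pair \<omega> -` ?W') = 1 - emeasure (\<kappa> \<omega>) (Pair \<omega> -` W)"
      by (simp add: emeasure_compl K.emeasure_space_1)
    then show ?case
      using elim(1,3) K.emeasure_finite by (metis ennreal_add_diff_cancel_left infinity_ennreal_def)
  qed
qed

lemma section_law_UN:
  assumes W: "\<And>i::nat. W i \<in> sets (F \<Otimes>\<^sub>M G)" and disj: "disjoint_family W" and law: "\<And>i. section_law (W i)"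
  shows "section_law (\<Union>i. W i)"
proof -
  have graph_UN: "graph_event (\<Union>i. W i) = (\<Union>i. graph_event (W i))"
    by (auto simp: graph_event_def)
  have "disjoint_family (\<lambda>i. graph_event (W i))"
    using disj by (auto simp: disjoint_family_on_def graph_event_def)
  then have "AE \<omega> in M. nn_cond_exp M F (indicator (graph_event (\<Union>i. W i))) \<omega>
      = (\<Sum>i. nn_cond_exp M F (indicator (graph_event (W i))) \<omega>)"
    unfolding graph_UN by (intro nn_cond_exp_indicator_UN sets_graph_event W)
  moreover have "AE \<omega> in M. \<forall>i. nn_cond_exp M F (indicator (graph_event (W i))) \<omega> = emeasure (\<kappa> \<omega>) (Pair \<omega> -` W i)"
    using law by (simp add: AE_all_countable section_law_def)
  ultimately show ?thesis
    unfolding section_law_def using AE_prob_space_\<kappa>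
  proof eventually_elim
    case (elim \<omega>)
    have "range (\<lambda>i. Pair \<omega> -` W i) \<subseteq> sets (\<kappa> \<omega>)" "disjoint_family (\<lambda>i. Pair \<omega> -` W i)"
      using sets_Pair1[OF W, of \<omega>] elim(3) disj by (auto simp: disjoint_family_on_def)
    then have "(\<Sum>i. emeasure (\<kappa> \<omega>) (Pair \<omega> -` W i)) = emeasure (\<kappa> \<omega>) (\<Union>i. Pair \<omega> -` W i)"
      by (rule suminf_emeasure)
    then show ?case
      using elim(1,2) by (simp add: vimage_UN)
  qed
qed

theorem nn_cond_exp_section:
  assumes "W \<in> sets (F \<Otimes>\<^sub>M G)"
  shows "AE \<omega> in M. nn_cond_exp M F (indicator {\<omega>\<in>space M. (\<omega>, Y \<omega>) \<in> W}) \<omega> = emeasure (\<kappa> \<omega>) (Pair \<omega> -` W)"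
proof -
  have "section_law W"
    using assms unfolding sets_pair_measure
  proof (induction rule: sigma_sets_induct_disjoint[OF Int_stable_pair_measure_generator pair_measure_closed,
        consumes 1, case_names rectangle empty compl union])
    case (rectangle W)
    then show ?case
      by (auto intro: section_law_Times)
  next
    case empty
    show ?case
      by (rule section_law_empty)
  next
    case (compl W)
    then show ?case
      by (intro section_law_Diff) (simp_all add: sets_pair_measure)
  next
    case (union W)
    then show ?case
      by (intro section_law_UN) (auto simp: sets_pair_measure)
  qed
  then show ?thesis
    by (simp only: section_law_def graph_event_def)
qed

end

lemma (in prob_space) nn_integral_pair_nat:
  fixes Y :: "'a \<Rightarrow> nat" and p :: "nat \<Rightarrow> 'a \<Rightarrow> ennreal"
  assumes sub: "subalgebra M F" and Y[measurable]: "Y \<in> measurable M (count_space UNIV)"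
    and p: "\<And>k. p k \<in> borel_measurable F"
    and cond: "\<And>k. AE \<omega> in M. nn_cond_exp M F (indicator {\<omega>\<in>space M. Y \<omega> = k}) \<omega> = p k \<omega>"
    and G: "\<And>k. G k \<in> borel_measurable F"
  shows "(\<integral>\<^sup>+\<omega>. G (Y \<omega>) \<omega> \<partial>M) = (\<integral>\<^sup>+\<omega>. (\<Sum>k. p k \<omega> * G k \<omega>) \<partial>M)"
proof -
  interpret finite_measure_subalgebra M F
    by unfold_locales (rule sub)
  note [measurable] = measurable_from_subalg[OF sub p] measurable_from_subalg[OF sub G]
  let ?I = "\<lambda>k. indicator {\<omega>\<in>space M. Y \<omega> = k} :: 'a \<Rightarrow> ennreal"
  have "(\<integral>\<^sup>+\<omega>. G (Y \<omega>) \<omega> \<partial>M) = (\<integral>\<^sup>+\<omega>. (\<Sum>k. G k \<omega> * ?I k \<omega>) \<partial>M)"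
  proof (rule nn_integral_cong)
    fix \<omega> assume "\<omega> \<in> space M"
    then have "(\<lambda>k. G k \<omega> * ?I k \<omega>) = (\<lambda>k. if k = Y \<omega> then G k \<omega> else 0)"
      by (auto simp: indicator_def)
    then show "G (Y \<omega>) \<omega> = (\<Sum>k. G k \<omega> * ?I k \<omega>)"
      using sums_unique[OF sums_single[of "Y \<omega>" "\<lambda>k. G k \<omega>"]] by simp
  qed
  also have "\<dots> = (\<Sum>k. \<integral>\<^sup>+\<omega>. G k \<omega> * ?I k \<omega> \<partial>M)"
    by (rule nn_integral_suminf) measurable
  also have "\<dots> = (\<Sum>k. \<integral>\<^sup>+\<omega>. p k \<omega> * G k \<omega> \<partial>M)"
  proof (intro arg_cong[where f=suminf] ext)
    fix k
    have "(\<integral>\<^sup>+\<omega>. G k \<omega> * ?I k \<omega> \<partial>M) = (\<integral>\<^sup>+\<omega>. G k \<omega> * nn_cond_exp M F (?I k) \<omega> \<partial>M)"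
      by (intro nn_cond_exp_intg[symmetric] G borel_measurable_indicator) measurable
    also have "\<dots> = (\<integral>\<^sup>+\<omega>. p k \<omega> * G k \<omega> \<partial>M)"
      using cond[of k] by (intro nn_integral_cong_AE) (auto elim!: eventually_mono simp: mult.commute)
    finally show "(\<integral>\<^sup>+\<omega>. G k \<omega> * ?I k \<omega> \<partial>M) = (\<integral>\<^sup>+\<omega>. p k \<omega> * G k \<omega> \<partial>M)" .
  qed
  also have "\<dots> = (\<integral>\<^sup>+\<omega>. (\<Sum>k. p k \<omega> * G k \<omega>) \<partial>M)"
    by (rule nn_integral_suminf[symmetric]) measurable
  finally show ?thesis .
qed

lemma measurable_pair_nat:
  fixes G :: "nat \<Rightarrow> 'a \<Rightarrow> 'b::topological_space"
  assumes "\<And>k. G k \<in> borel_measurable M"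
  shows "(\<lambda>q. G (snd q) (fst q)) \<in> borel_measurable (M \<Otimes>\<^sub>M count_space UNIV)"
  using assms by (intro measurable_compose_countable'[where f="\<lambda>k q. G k (fst q)" and g=snd and I=UNIV]) auto

lemma (in prob_space) distr_pair_nat_eq_density:
  fixes Y :: "'a \<Rightarrow> nat" and p :: "nat \<Rightarrow> 'a \<Rightarrow> ennreal"
  assumes sub: "subalgebra M F" and Y: "Y \<in> measurable M (count_space UNIV)"
    and p: "\<And>k. p k \<in> borel_measurable F"
    and cond: "\<And>k. AE \<omega> in M. nn_cond_exp M F (indicator {\<omega>\<in>space M. Y \<omega> = k}) \<omega> = p k \<omega>"
  shows "distr M (restr_to_subalg M F \<Otimes>\<^sub>M count_space UNIV) (\<lambda>\<omega>. (\<omega>, Y \<omega>))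
    = density (restr_to_subalg M F \<Otimes>\<^sub>M count_space UNIV) (\<lambda>q. p (snd q) (fst q))"
    (is "distr M ?RC ?pair = density _ ?p")
proof (rule measure_eqI)
  let ?R = "restr_to_subalg M F" and ?C = "count_space UNIV :: nat measure"
  interpret C: sigma_finite_measure ?C
    by (rule sigma_finite_measure_count_space)
  have meas_R: "measurable ?R N = measurable F N" for N :: "'c measure"
    by (intro measurable_cong_sets sets_restr_to_subalg[OF sub] refl)
  have pair: "?pair \<in> measurable M ?RC"
    by (intro measurable_Pair measurable_from_subalg[OF sub] measurable_ident_sets sets_restr_to_subalg[OF sub, symmetric] Y)
  have p_RC: "?p \<in> borel_measurable ?RC"
    using p by (intro measurable_pair_nat) (simp add: meas_R)
  fix X assume "X \<in> sets (distr M ?RC ?pair)"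
  then have X: "X \<in> sets ?RC"
    by simp
  then have sect: "(\<lambda>\<omega>. indicator X (\<omega>, k) :: ennreal) \<in> borel_measurable F" for k
    unfolding meas_R[symmetric] by measurable
  have "emeasure (distr M ?RC ?pair) X = (\<integral>\<^sup>+\<omega>. indicator X (\<omega>, Y \<omega>) \<partial>M)"
    using X pair by (simp add: nn_integral_indicator[symmetric] nn_integral_distr del: nn_integral_indicator)
  also have "\<dots> = (\<integral>\<^sup>+\<omega>. (\<Sum>k. p k \<omega> * indicator X (\<omega>, k)) \<partial>M)"
    by (rule nn_integral_pair_nat[OF sub Y p cond sect])
  also have "\<dots> = (\<integral>\<^sup>+\<omega>. (\<Sum>k. p k \<omega> * indicator X (\<omega>, k)) \<partial>?R)"
    using p sect by (intro nn_integral_subalgebra2[OF sub, symmetric]) measurable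
  also have "\<dots> = (\<integral>\<^sup>+q. ?p q * indicator X q \<partial>?RC)"
    using p_RC X by (subst C.nn_integral_fst[symmetric]) (simp_all add: nn_integral_count_space_nat)
  also have "\<dots> = emeasure (density ?RC ?p) X"
    using p_RC X by (simp add: emeasure_density)
  finally show "emeasure (distr M ?RC ?pair) X = emeasure (density ?RC ?p) X" .
qed simp

lemma integral_count_space_nat_scaleR:
  fixes p :: "nat \<Rightarrow> real" and g :: "nat \<Rightarrow> 'b::{banach, second_countable_topology}"
  assumes p: "\<And>k. 0 \<le> p k" "summable p" and g: "\<And>k. norm (g k) \<le> K"
  shows "(\<integral>k. p k *\<^sub>R g k \<partial>count_space UNIV) = (\<Sum>k. p k *\<^sub>R g k)"
proof -
  have "summable (\<lambda>k. p k * K)"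
    using p(2) by (rule summable_mult2)
  then have "summable (\<lambda>k. norm (p k *\<^sub>R g k))"
    by (rule summable_comparison_test'[where N=0]) (simp add: p(1) g mult_left_mono)
  then show ?thesis
    by (intro integral_count_space_nat) (simp add: integrable_count_space_nat_iff)
qed

lemma (in prob_space) integral_pair_nat:
  fixes Y :: "'a \<Rightarrow> nat" and p :: "nat \<Rightarrow> 'a \<Rightarrow> real" and G :: "nat \<Rightarrow> 'a \<Rightarrow> 'b::{banach, second_countable_topology}"
  assumes sub: "subalgebra M F" and Y: "Y \<in> measurable M (count_space UNIV)"
    and p: "\<And>k. p k \<in> borel_measurable F" "\<And>k \<omega>. \<omega> \<in> space M \<Longrightarrow> 0 \<le> p k \<omega>" "\<And>\<omega>. \<omega> \<in> space M \<Longrightarrow> summable (\<lambda>k. p k \<omega>)"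
    and cond: "\<And>k. AE \<omega> in M. nn_cond_exp M F (indicator {\<omega>\<in>space M. Y \<omega> = k}) \<omega> = ennreal (p k \<omega>)"
    and G: "\<And>k. G k \<in> borel_measurable F" "\<And>k \<omega>. \<omega> \<in> space M \<Longrightarrow> norm (G k \<omega>) \<le> K"
  shows "(\<integral>\<omega>. G (Y \<omega>) \<omega> \<partial>M) = (\<integral>\<omega>. (\<Sum>k. p k \<omega> *\<^sub>R G k \<omega>) \<partial>M)"
proof -
  let ?R = "restr_to_subalg M F" and ?C = "count_space UNIV :: nat measure"
  let ?RC = "?R \<Otimes>\<^sub>M ?C" and ?pair = "\<lambda>\<omega>. (\<omega>, Y \<omega>)"
  let ?p = "\<lambda>q. p (snd q) (fst q)" and ?G = "\<lambda>q. G (snd q) (fst q)"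
  interpret R: prob_space ?R
    by (rule prob_space_restr_to_subalg[OF sub prob_space_axioms])
  interpret RC: pair_sigma_finite ?R ?C
    by (simp add: pair_sigma_finite_def R.sigma_finite_measure_axioms sigma_finite_measure_count_space)
  have meas_R: "measurable ?R N = measurable F N" for N :: "'c measure"
    by (intro measurable_cong_sets sets_restr_to_subalg[OF sub] refl)
  have pair: "?pair \<in> measurable M ?RC"
    by (intro measurable_Pair measurable_from_subalg[OF sub] measurable_ident_sets sets_restr_to_subalg[OF sub, symmetric] Y)
  have p_RC[measurable]: "?p \<in> borel_measurable ?RC" and G_RC[measurable]: "?G \<in> borel_measurable ?RC"
    using p(1) G(1) by (auto intro!: measurable_pair_nat simp: meas_R)
  have p_nonneg: "AE q in ?RC. 0 \<le> ?p q"
    using p(2) by (intro AE_I2) (auto simp: space_pair_measure space_restr_to_subalg)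
  have law: "distr M ?RC ?pair = density ?RC (\<lambda>q. ennreal (?p q))"
    using p(1) by (intro distr_pair_nat_eq_density[OF sub Y _ cond]) simp
  have "integrable M (\<lambda>\<omega>. ?G (?pair \<omega>))"
    using G(2) by (intro integrable_const_bound[of _ K] AE_I2 measurable_compose[OF pair G_RC]) auto
  then have "integrable (distr M ?RC ?pair) ?G"
    by (simp add: integrable_distr_eq[OF pair G_RC])
  then have int: "integrable ?RC (\<lambda>q. ?p q *\<^sub>R ?G q)"
    unfolding law using p_nonneg by (subst (asm) integrable_density) auto
  have "(\<integral>\<omega>. G (Y \<omega>) \<omega> \<partial>M) = (\<integral>q. ?G q \<partial>distr M ?RC ?pair)"
    using integral_distr[OF pair G_RC] by simp
  also have "\<dots> = (\<integral>q. ?p q *\<^sub>R ?G q \<partial>?RC)"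
    unfolding law using p_nonneg by (intro integral_density) auto
  also have "\<dots> = (\<integral>\<omega>. (\<integral>k. p k \<omega> *\<^sub>R G k \<omega> \<partial>?C) \<partial>?R)"
    using RC.integral_fst'[OF int] by simp
  also have "\<dots> = (\<integral>\<omega>. (\<integral>k. p k \<omega> *\<^sub>R G k \<omega> \<partial>?C) \<partial>M)"
    using RC.M2.borel_measurable_lebesgue_integral[of "\<lambda>\<omega> k. p k \<omega> *\<^sub>R G k \<omega>" ?R]
    by (intro integral_subalgebra2[OF sub]) (simp add: meas_R split_beta')
  also have "\<dots> = (\<integral>\<omega>. (\<Sum>k. p k \<omega> *\<^sub>R G k \<omega>) \<partial>M)"
    by (intro Bochner_Integration.integral_cong refl integral_count_space_nat_scaleR[where K=K] p(2,3) G(2))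
  finally show ?thesis .
qed

section \<open>Sequences with bounded increments\<close>

locale slow_sequence =
  fixes a :: "nat \<Rightarrow> real"
  assumes a_0: "a 0 = 0" and mono_a: "mono a" and a_Suc_le: "\<And>n. a (Suc n) \<le> a n + 1"
    and a_at_top: "filterlim a at_top sequentially"
begin

lemma a_nonneg: "0 \<le> a n"
  using monoD[OF mono_a, of 0 n] a_0 by simp

lemma eventually_a_ge_1: "eventually (\<lambda>n. 1 \<le> a n) sequentially"
  using a_at_top by (simp add: filterlim_at_top)

lemma sqrt_a_at_top: "filterlim (\<lambda>n. sqrt (a n)) at_top sequentially"
  by (rule filterlim_compose[OF sqrt_at_top a_at_top])

lemma tendsto_const_div_a: "(\<lambda>n. C / a n) \<longlonglongrightarrow> 0"
  by (intro tendsto_divide_0[OF tendsto_const] filterlim_at_top_imp_at_infinity a_at_top)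

lemma tendsto_const_div_sqrt_a: "(\<lambda>n. C / sqrt (a n)) \<longlonglongrightarrow> 0"
  by (intro tendsto_divide_0[OF tendsto_const] filterlim_at_top_imp_at_infinity sqrt_a_at_top)

definition hitting_time :: "nat \<Rightarrow> nat" where
  "hitting_time k = (LEAST n. real k \<le> a n)"

lemma
  shows hitting_time_ge: "real k \<le> a (hitting_time k)"
    and hitting_time_le: "a (hitting_time k) \<le> real k + 1"
proof -
  obtain N where "real k \<le> a N"
    using a_at_top by (auto simp: filterlim_at_top eventually_sequentially)
  then show ge: "real k \<le> a (hitting_time k)"
    unfolding hitting_time_def by (rule LeastI)
  show "a (hitting_time k) \<le> real k + 1"
  proof (cases "hitting_time k")
    case 0
    then show ?thesis by (simp add: a_0)
  next
    case (Suc q)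
    then have "\<not> real k \<le> a q"
      using not_less_Least[of q "\<lambda>n. real k \<le> a n"] by (simp add: hitting_time_def)
    then show ?thesis
      using a_Suc_le[of q] Suc by simp
  qed
qed

lemma hitting_time_leI: "real k \<le> a n \<Longrightarrow> hitting_time k \<le> n"
  unfolding hitting_time_def by (rule Least_le)

lemma le_hitting_timeI:
  assumes "a n < real k"
  shows "n \<le> hitting_time k"
proof (rule ccontr)
  assume "\<not> n \<le> hitting_time k"
  then have "a (hitting_time k) \<le> a n"
    by (intro monoD[OF mono_a]) simp
  then show False
    using hitting_time_ge[of k] assms by simp
qed

lemma hitting_time_at_top: "filterlim hitting_time at_top sequentially"
  unfolding filterlim_at_top
proof
  fix N
  have "eventually (\<lambda>k. a N < real k) sequentially"
    using filterlim_real_sequentially by (simp add: filterlim_at_top_dense)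
  then show "eventually (\<lambda>k. N \<le> hitting_time k) sequentially"
    by (rule eventually_mono) (rule le_hitting_timeI)
qed

lemma LIMSEQ_div_hitting_index:
  fixes L :: "nat \<Rightarrow> real"
  assumes lim: "(\<lambda>k. L (hitting_time k) / a (hitting_time k)) \<longlonglongrightarrow> l"
  shows "(\<lambda>k. L (hitting_time k) / (real k + c)) \<longlonglongrightarrow> l"
proof -
  let ?t = hitting_time
  have "(\<lambda>k. a (?t k) / (real k + c)) \<longlonglongrightarrow> 1"
  proof (rule tendsto_sandwich)
    show "(\<lambda>k. real k / (real k + c)) \<longlonglongrightarrow> 1" "(\<lambda>k. (real k + 1) / (real k + c)) \<longlonglongrightarrow> 1"
      by real_asymp+
    have pos: "eventually (\<lambda>k. 0 < real k + c) sequentially"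
      by real_asymp
    show "eventually (\<lambda>k. real k / (real k + c) \<le> a (?t k) / (real k + c)) sequentially"
      "eventually (\<lambda>k. a (?t k) / (real k + c) \<le> (real k + 1) / (real k + c)) sequentially"
      using pos by (auto elim!: eventually_mono intro: divide_right_mono hitting_time_ge hitting_time_le)
  qed
  with lim have "(\<lambda>k. L (?t k) / a (?t k) * (a (?t k) / (real k + c))) \<longlonglongrightarrow> l * 1"
    by (rule tendsto_mult)
  moreover have "eventually (\<lambda>k. L (?t k) / a (?t k) * (a (?t k) / (real k + c)) = L (?t k) / (real k + c)) sequentially"
    using eventually_gt_at_top[of 0]
  proof eventually_elim
    case (elim k)
    then have "a (?t k) \<noteq> 0"
      using hitting_time_ge[of k] by auto
    then show ?case by simp
  qed
  ultimately show ?thesis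
    by (simp add: Lim_transform_eventually)
qed

lemma LIMSEQ_of_hitting_times:
  assumes L: "mono L" "\<And>n. 0 \<le> L n"
    and lim: "(\<lambda>k. L (hitting_time k) / a (hitting_time k)) \<longlonglongrightarrow> l"
  shows "(\<lambda>n. L n / a n) \<longlonglongrightarrow> l"
proof -
  let ?t = hitting_time
  define k where "k n = nat \<lfloor>a n\<rfloor>" for n
  have k: "real (k n) \<le> a n" "a n < real (Suc (k n))" for n
    using a_nonneg[of n] unfolding k_def by linarith+
  have k_at_top: "filterlim k at_top sequentially"
    unfolding k_def
    by (intro filterlim_compose[OF filterlim_nat_sequentially] filterlim_compose[OF filterlim_floor_sequentially] a_at_top)
  note transfer = LIMSEQ_div_hitting_index[OF lim]
  show ?thesis
  proof (rule tendsto_sandwich)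
    show "(\<lambda>n. L (?t (k n)) / (real (k n) + 1)) \<longlonglongrightarrow> l"
      by (rule filterlim_compose[OF transfer k_at_top])
    have "(\<lambda>k. L (?t (Suc k)) / real k) \<longlonglongrightarrow> l"
      using LIMSEQ_Suc[OF transfer[where c = "- 1"]] by simp
    then show "(\<lambda>n. L (?t (Suc (k n))) / real (k n)) \<longlonglongrightarrow> l"
      by (rule filterlim_compose[OF _ k_at_top])
    have "eventually (\<lambda>n. 1 \<le> k n) sequentially"
      using k_at_top by (simp add: filterlim_at_top)
    then have "eventually (\<lambda>n. L (?t (k n)) / (real (k n) + 1) \<le> L n / a n
        \<and> L n / a n \<le> L (?t (Suc (k n))) / real (k n)) sequentially"
    proof eventually_elim
      case (elim n)
      then have "0 < a n"
        using k(1)[of n] by linarith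
      then show ?case
        using k[of n] L elim hitting_time_leI[OF k(1)] le_hitting_timeI[OF k(2)]
        by (intro conjI frac_le monoD[OF L(1)]) auto
    qed
    then show "eventually (\<lambda>n. L (?t (k n)) / (real (k n) + 1) \<le> L n / a n) sequentially"
      "eventually (\<lambda>n. L n / a n \<le> L (?t (Suc (k n))) / real (k n)) sequentially"
      by (simp_all only: eventually_conj_iff)
  qed
qed

end

section \<open>Counting processes with conditionally Poisson increments\<close>

locale filtered_prob_space = prob_space M + filtration "space M" F
    for M :: "'a measure" and F :: "nat \<Rightarrow> 'a measure" +
  assumes sets_F_subset: "\<And>n. sets (F n) \<subseteq> events"
begin

lemma subalgebra_F: "subalgebra M (F n)"
  by (simp add: subalgebra_def space_F sets_F_subset)

lemma measurable_F_mono: "f \<in> measurable (F n) S \<Longrightarrow> n \<le> k \<Longrightarrow> f \<in> measurable (F k) S"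
  using sets_F_mono[of n k] by (auto simp: measurable_def space_F)

lemma measurable_F_M: "f \<in> measurable (F n) S \<Longrightarrow> f \<in> measurable M S"
  by (rule measurable_from_subalg[OF subalgebra_F])

end

locale cond_poisson_process = filtered_prob_space M F
    for M :: "'a measure" and F +
  fixes N :: "nat \<Rightarrow> 'a \<Rightarrow> nat" and rate :: "nat \<Rightarrow> 'a \<Rightarrow> real"
  assumes N_measurable: "\<And>n. N n \<in> measurable (F n) (count_space UNIV)"
    and rate_measurable: "\<And>n. rate n \<in> borel_measurable (F n)"
    and rate_nonneg: "\<And>n \<omega>. \<omega> \<in> space M \<Longrightarrow> 0 \<le> rate n \<omega>"
    and N_0: "\<And>\<omega>. \<omega> \<in> space M \<Longrightarrow> N 0 \<omega> = 0"
    and N_le_Suc: "\<And>n \<omega>. \<omega> \<in> space M \<Longrightarrow> N n \<omega> \<le> N (Suc n) \<omega>"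
    and increment_law: "\<And>n k. AE \<omega> in M.
      nn_cond_exp M (F n) (indicator {\<omega>\<in>space M. N (Suc n) \<omega> - N n \<omega> = k}) \<omega> = ennreal (poisson_prob (rate n \<omega>) k)"
begin

definition compensator :: "nat \<Rightarrow> 'a \<Rightarrow> real" where
  "compensator n \<omega> = (\<Sum>j<n. rate j \<omega>)"

lemma real_N_measurable: "(\<lambda>\<omega>. real (N n \<omega>)) \<in> borel_measurable (F n)"
  by (intro measurable_compose[OF N_measurable]) simp

lemma compensator_Suc_measurable: "compensator (Suc n) \<in> borel_measurable (F n)"
  unfolding compensator_def by (intro borel_measurable_sum measurable_F_mono[OF rate_measurable]) auto

lemma compensator_measurable: "compensator n \<in> borel_measurable M"
  unfolding compensator_def by (intro borel_measurable_sum measurable_F_M[OF rate_measurable])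

lemma real_N_measurable_M: "(\<lambda>\<omega>. real (N n \<omega>)) \<in> borel_measurable M"
  by (rule measurable_F_M[OF real_N_measurable])

lemma compensator_nonneg: "\<omega> \<in> space M \<Longrightarrow> 0 \<le> compensator n \<omega>"
  unfolding compensator_def by (intro sum_nonneg rate_nonneg)

lemma mono_N: "\<omega> \<in> space M \<Longrightarrow> mono (\<lambda>n. N n \<omega>)"
  by (simp add: mono_iff_le_Suc N_le_Suc)

lemma increment_measurable: "(\<lambda>\<omega>. N (Suc n) \<omega> - N n \<omega>) \<in> measurable M (count_space UNIV)"
  using measurable_F_M[OF N_measurable, of "Suc n"] measurable_F_M[OF N_measurable, of n] by measurable

lemma poisson_prob_rate_measurable: "(\<lambda>\<omega>. poisson_prob (rate n \<omega>) k) \<in> borel_measurable (F n)"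
  unfolding poisson_prob_def using rate_measurable[of n] by measurable

lemma nn_integral_exp_increment:
  assumes G: "G \<in> borel_measurable (F n)"
  shows "(\<integral>\<^sup>+\<omega>. G \<omega> * ennreal (exp (\<theta> * real (N (Suc n) \<omega> - N n \<omega>))) \<partial>M)
    = (\<integral>\<^sup>+\<omega>. G \<omega> * ennreal (exp (rate n \<omega> * (exp \<theta> - 1))) \<partial>M)"
proof -
  let ?p = "\<lambda>k \<omega>. ennreal (poisson_prob (rate n \<omega>) k)" and ?e = "\<lambda>k. ennreal (exp (\<theta> * real k))"
  have "(\<integral>\<^sup>+\<omega>. G \<omega> * ?e (N (Suc n) \<omega> - N n \<omega>) \<partial>M) = (\<integral>\<^sup>+\<omega>. (\<Sum>k. ?p k \<omega> * (G \<omega> * ?e k)) \<partial>M)"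
    by (intro nn_integral_pair_nat[OF subalgebra_F increment_measurable _ increment_law]
        borel_measurable_times_ennreal G borel_measurable_const
        measurable_compose[OF poisson_prob_rate_measurable measurable_ennreal])
  also have "\<dots> = (\<integral>\<^sup>+\<omega>. G \<omega> * ennreal (exp (rate n \<omega> * (exp \<theta> - 1))) \<partial>M)"
  proof (rule nn_integral_cong)
    fix \<omega> assume \<omega>: "\<omega> \<in> space M"
    note nonneg = poisson_prob_nonneg[OF rate_nonneg[OF \<omega>, of n]]
    have "(\<Sum>k. ?p k \<omega> * (G \<omega> * ?e k)) = G \<omega> * (\<Sum>k. ennreal (poisson_prob (rate n \<omega>) k * exp (\<theta> * real k)))"
      by (simp add: ennreal_mult'' nonneg mult.left_commute mult.commute[of "G \<omega>"] flip: ennreal_suminf_multc mult.assoc)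
    also have "(\<Sum>k. ennreal (poisson_prob (rate n \<omega>) k * exp (\<theta> * real k))) = ennreal (exp (rate n \<omega> * (exp \<theta> - 1)))"
      using sums_poisson_prob_exp[of "rate n \<omega>" \<theta>] by (subst suminf_ennreal2) (auto simp: sums_iff nonneg)
    finally show "(\<Sum>k. ?p k \<omega> * (G \<omega> * ?e k)) = G \<omega> * ennreal (exp (rate n \<omega> * (exp \<theta> - 1)))" .
  qed
  finally show ?thesis .
qed

lemma nn_integral_exp_martingale:
  "(\<integral>\<^sup>+\<omega>. ennreal (exp (\<theta> * real (N n \<omega>) - compensator n \<omega> * (exp \<theta> - 1))) \<partial>M) = 1"
proof (induction n)
  case 0
  have "(\<integral>\<^sup>+\<omega>. ennreal (exp (\<theta> * real (N 0 \<omega>) - compensator 0 \<omega> * (exp \<theta> - 1))) \<partial>M) = (\<integral>\<^sup>+\<omega>. 1 \<partial>M)"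
    by (intro nn_integral_cong) (simp add: N_0 compensator_def)
  then show ?case
    by (simp add: emeasure_space_1)
next
  case (Suc n)
  note [measurable] = N_measurable[of n] compensator_Suc_measurable[of n]
  let ?G = "\<lambda>\<omega>. ennreal (exp (\<theta> * real (N n \<omega>) - compensator (Suc n) \<omega> * (exp \<theta> - 1)))"
  have "(\<integral>\<^sup>+\<omega>. ennreal (exp (\<theta> * real (N (Suc n) \<omega>) - compensator (Suc n) \<omega> * (exp \<theta> - 1))) \<partial>M)
      = (\<integral>\<^sup>+\<omega>. ?G \<omega> * ennreal (exp (\<theta> * real (N (Suc n) \<omega> - N n \<omega>))) \<partial>M)"
    by (intro nn_integral_cong)
       (simp add: of_nat_diff N_le_Suc ennreal_mult[symmetric] exp_add[symmetric] algebra_simps)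
  also have "\<dots> = (\<integral>\<^sup>+\<omega>. ?G \<omega> * ennreal (exp (rate n \<omega> * (exp \<theta> - 1))) \<partial>M)"
    by (intro nn_integral_exp_increment) measurable
  also have "\<dots> = (\<integral>\<^sup>+\<omega>. ennreal (exp (\<theta> * real (N n \<omega>) - compensator n \<omega> * (exp \<theta> - 1))) \<partial>M)"
    by (simp add: compensator_def ennreal_mult[symmetric] exp_add[symmetric] algebra_simps)
  finally show ?case
    using Suc by simp
qed

lemma prob_le_exp_of_exponent_ge:
  notes [measurable] = real_N_measurable_M compensator_measurable
  assumes ge: "\<And>\<omega>. \<omega> \<in> E \<Longrightarrow> t \<le> \<theta> * real (N n \<omega>) - compensator n \<omega> * (exp \<theta> - 1)"
    and E: "E \<in> events"
  shows "prob E \<le> exp (- t)"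
proof -
  let ?U = "\<lambda>\<omega>. ennreal (exp (\<theta> * real (N n \<omega>) - compensator n \<omega> * (exp \<theta> - 1)))"
  have "emeasure M E = (\<integral>\<^sup>+\<omega>. indicator E \<omega> \<partial>M)"
    using E by simp
  also have "\<dots> \<le> (\<integral>\<^sup>+\<omega>. ennreal (exp (- t)) * ?U \<omega> \<partial>M)"
  proof (rule nn_integral_mono)
    fix \<omega>
    show "indicator E \<omega> \<le> ennreal (exp (- t)) * ?U \<omega>"
      using ge[of \<omega>] by (cases "\<omega> \<in> E") (simp_all add: ennreal_mult[symmetric] exp_add[symmetric] ennreal_1[symmetric] del: ennreal_1)
  qed
  also have "\<dots> = ennreal (exp (- t))"
    by (subst nn_integral_cmult) (simp_all add: nn_integral_exp_martingale)
  finally show ?thesis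
    by (simp add: emeasure_eq_measure)
qed

end

lemma exp_le_quadratic:
  fixes x :: real
  assumes "\<bar>x\<bar> \<le> 1"
  shows "exp x \<le> 1 + x + x\<^sup>2"
proof (cases "0 \<le> x")
  case True
  then show ?thesis
    using assms exp_bound[of x] by simp
next
  case False
  then have "(1 - x) * (1 + x + x\<^sup>2) \<ge> 1"
    using power_mono_odd[of 3 x 0] by (simp add: algebra_simps power2_eq_square power3_eq_cube)
  then have "1 / (1 - x) \<le> 1 + x + x\<^sup>2"
    using False by (simp add: field_simps)
  moreover have "exp x \<le> 1 / (1 - x)"
    using exp_ge_add_one_self[of "- x"] False by (simp add: exp_minus field_simps)
  ultimately show ?thesis
    by simp
qed

locale normalized_cond_poisson_process = cond_poisson_process M F N rate + slow_sequence a
  for M :: "'a measure" and F N rate and a :: "nat \<Rightarrow> real" +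
  fixes C :: real
  assumes C: "0 < C" and compensator_le: "\<And>n \<omega>. \<omega> \<in> space M \<Longrightarrow> compensator n \<omega> \<le> C * (a n + 1)"
begin

lemma exponent_ge_of_deviation:
  assumes n: "1 \<le> a n" and s: "\<bar>s\<bar> = 1" and \<theta>: "0 < \<theta>" "\<theta> \<le> 1" "4 * C * \<theta> \<le> e"
    and \<omega>: "\<omega> \<in> space M" and ge: "e * a n \<le> s * (real (N n \<omega>) - compensator n \<omega>)"
  shows "\<theta> * e / 2 * a n \<le> s * \<theta> * real (N n \<omega>) - compensator n \<omega> * (exp (s * \<theta>) - 1)"
proof -
  have "s\<^sup>2 = 1"
    using s by (metis power2_abs one_power2)
  then have "exp (s * \<theta>) \<le> 1 + s * \<theta> + \<theta>\<^sup>2"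
    using exp_le_quadratic[of "s * \<theta>"] \<theta> s by (simp add: abs_mult power_mult_distrib)
  then have "compensator n \<omega> * exp (s * \<theta>) \<le> compensator n \<omega> * (1 + s * \<theta> + \<theta>\<^sup>2)"
    using compensator_nonneg[OF \<omega>] by (rule mult_left_mono)
  moreover have "compensator n \<omega> * \<theta>\<^sup>2 \<le> \<theta> * e / 2 * a n"
  proof -
    have "compensator n \<omega> \<le> C * (2 * a n)"
      using compensator_le[OF \<omega>, of n] mult_left_mono[of "a n + 1" "2 * a n" C] C n by linarith
    then have "compensator n \<omega> * \<theta>\<^sup>2 \<le> C * (2 * a n) * \<theta>\<^sup>2"
      by (rule mult_right_mono) simp
    also have "\<dots> = (4 * C * \<theta>) * (\<theta> * a n / 2)"
      by (simp add: power2_eq_square)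
    also have "\<dots> \<le> e * (\<theta> * a n / 2)"
      using \<theta> n by (intro mult_right_mono) auto
    finally show ?thesis
      by (simp add: mult_ac)
  qed
  moreover have "\<theta> * (e * a n) \<le> \<theta> * (s * (real (N n \<omega>) - compensator n \<omega>))"
    using ge \<theta> by (intro mult_left_mono) auto
  ultimately show ?thesis
    by (simp add: algebra_simps)
qed

lemma prob_deviation_le:
  notes [measurable] = real_N_measurable_M compensator_measurable
  assumes e: "0 < e"
  obtains \<kappa> where "0 < \<kappa>" "\<And>n. 1 \<le> a n \<Longrightarrow>
    prob {\<omega>\<in>space M. e * a n \<le> \<bar>real (N n \<omega>) - compensator n \<omega>\<bar>} \<le> 2 * exp (- \<kappa> * a n)"
proof -
  define \<theta> where "\<theta> = min 1 (e / (4 * C))"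
  have \<theta>: "0 < \<theta>" "\<theta> \<le> 1" "4 * C * \<theta> \<le> e"
    using e C by (auto simp: \<theta>_def min_def field_simps)
  show thesis
  proof (rule that)
    show "0 < \<theta> * e / 2"
      using \<theta> e by simp
    fix n assume n: "1 \<le> a n"
    let ?D = "\<lambda>s. {\<omega>\<in>space M. e * a n \<le> s * (real (N n \<omega>) - compensator n \<omega>)}"
    have tail: "prob (?D s) \<le> exp (- (\<theta> * e / 2 * a n))" if "\<bar>s\<bar> = 1" for s
      using exponent_ge_of_deviation[OF n that \<theta>] by (intro prob_le_exp_of_exponent_ge[where \<theta>="s * \<theta>" and n=n]) auto
    have "prob {\<omega>\<in>space M. e * a n \<le> \<bar>real (N n \<omega>) - compensator n \<omega>\<bar>} \<le> prob (?D 1 \<union> ?D (- 1))"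
      by (intro finite_measure_mono) auto
    also have "\<dots> \<le> prob (?D 1) + prob (?D (- 1))"
      by (intro measure_Un_le) measurable
    also have "\<dots> \<le> 2 * exp (- (\<theta> * e / 2) * a n)"
      using tail[of 1] tail[of "- 1"] by simp
    finally show "prob {\<omega>\<in>space M. e * a n \<le> \<bar>real (N n \<omega>) - compensator n \<omega>\<bar>} \<le> 2 * exp (- (\<theta> * e / 2) * a n)" .
  qed
qed

lemma AE_eventually_deviation_less:
  notes [measurable] = real_N_measurable_M compensator_measurable
  assumes e: "0 < e"
  shows "AE \<omega> in M. eventually (\<lambda>k. \<bar>real (N (hitting_time k) \<omega>) - compensator (hitting_time k) \<omega>\<bar>
    < e * a (hitting_time k)) sequentially"
proof -
  obtain \<kappa> where \<kappa>: "0 < \<kappa>" "\<And>n. 1 \<le> a n \<Longrightarrow>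
    prob {\<omega>\<in>space M. e * a n \<le> \<bar>real (N n \<omega>) - compensator n \<omega>\<bar>} \<le> 2 * exp (- \<kappa> * a n)"
    using prob_deviation_le[OF e] by blast
  let ?t = hitting_time
  let ?D = "\<lambda>k. {\<omega>\<in>space M. e * a (?t k) \<le> \<bar>real (N (?t k) \<omega>) - compensator (?t k) \<omega>\<bar>}"
  have "summable (\<lambda>k. prob (?D k))"
  proof (rule summable_comparison_test_ev)
    show "summable (\<lambda>k. 2 * exp (- \<kappa>) ^ k)"
      using \<kappa>(1) by (intro summable_mult summable_geometric) simp
    show "eventually (\<lambda>k. norm (prob (?D k)) \<le> 2 * exp (- \<kappa>) ^ k) sequentially"
      using eventually_ge_at_top[of 1]
    proof eventually_elim
      case (elim k)
      have "prob (?D k) \<le> 2 * exp (- \<kappa> * a (?t k))"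
        using hitting_time_ge[of k] elim by (intro \<kappa>(2)) auto
      also have "\<dots> \<le> 2 * exp (real k * - \<kappa>)"
        using hitting_time_ge[of k] \<kappa>(1) by (simp add: mult.commute)
      finally show ?case
        by (simp only: exp_of_nat_mult real_norm_def abs_of_nonneg measure_nonneg)
    qed
  qed
  then have "AE \<omega> in M. eventually (\<lambda>k. \<omega> \<in> space M - ?D k) sequentially"
    by (intro borel_cantelli_AE1) (auto simp: less_top[symmetric])
  then show ?thesis
    by eventually_elim (auto elim!: eventually_mono)
qed

theorem AE_LIMSEQ_N_div_a:
  assumes comp: "AE \<omega> in M. (\<lambda>n. compensator n \<omega> / a n) \<longlonglongrightarrow> l"
  shows "AE \<omega> in M. (\<lambda>n. real (N n \<omega>) / a n) \<longlonglongrightarrow> l"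
proof -
  let ?t = hitting_time
  have "AE \<omega> in M. \<forall>i::nat. eventually (\<lambda>k. \<bar>real (N (?t k) \<omega>) - compensator (?t k) \<omega>\<bar> < 1 / real (Suc i) * a (?t k)) sequentially"
    unfolding AE_all_countable by (intro allI AE_eventually_deviation_less) simp
  then show ?thesis
    using comp AE_space
  proof eventually_elim
    case (elim \<omega>)
    have "(\<lambda>k. (real (N (?t k) \<omega>) - compensator (?t k) \<omega>) / a (?t k)) \<longlonglongrightarrow> 0"
      unfolding tendsto_iff
    proof (intro allI impI)
      fix e :: real assume "0 < e"
      then obtain i where i: "1 / real (Suc i) < e"
        using reals_Archimedean by (metis inverse_eq_divide)
      show "eventually (\<lambda>k. dist ((real (N (?t k) \<omega>) - compensator (?t k) \<omega>) / a (?t k)) 0 < e) sequentially"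
        using spec[OF elim(1), of i] eventually_ge_at_top[of 1]
      proof eventually_elim
        case (elim k)
        then have pos: "0 < a (?t k)"
          using hitting_time_ge[of k] by linarith
        then have "\<bar>real (N (?t k) \<omega>) - compensator (?t k) \<omega>\<bar> / a (?t k) < 1 / real (Suc i)"
          using elim(1) by (simp add: pos_divide_less_eq)
        then show ?case
          using i pos by simp
      qed
    qed
    from tendsto_add[OF this filterlim_compose[OF elim(2) hitting_time_at_top]]
    have "(\<lambda>k. real (N (?t k) \<omega>) / a (?t k)) \<longlonglongrightarrow> l"
      by (simp add: diff_divide_distrib)
    then show ?case
      using mono_N[OF elim(3)] by (intro LIMSEQ_of_hitting_times) (auto simp: mono_def)
  qed
qed

end

section \<open>Mixing limits and stable convergence\<close>

locale bounded_adapted_process = filtered_prob_space M F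
    for M :: "'a measure" and F +
  fixes Y :: "nat \<Rightarrow> 'a \<Rightarrow> 'b::euclidean_space"
  assumes adapted: "\<And>n. Y n \<in> borel_measurable (F n)"
    and norm_le_1: "\<And>n \<omega>. \<omega> \<in> space M \<Longrightarrow> norm (Y n \<omega>) \<le> 1"
begin

definition mixing_lim :: "'b \<Rightarrow> ('a \<Rightarrow> real) \<Rightarrow> bool" where
  "mixing_lim y g \<longleftrightarrow> integrable M g \<and>
    (\<lambda>n. \<integral>\<omega>. g \<omega> *\<^sub>R Y n \<omega> \<partial>M) \<longlonglongrightarrow> (\<integral>\<omega>. g \<omega> \<partial>M) *\<^sub>R y"

lemma integrable_scaleR_Y:
  assumes "integrable M g"
  shows "integrable M (\<lambda>\<omega>. g \<omega> *\<^sub>R Y n \<omega>)"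
proof (rule Bochner_Integration.integrable_bound[OF assms])
  show "(\<lambda>\<omega>. g \<omega> *\<^sub>R Y n \<omega>) \<in> borel_measurable M"
    using assms measurable_F_M[OF adapted] by (intro borel_measurable_scaleR) auto
  show "AE \<omega> in M. norm (g \<omega> *\<^sub>R Y n \<omega>) \<le> norm (g \<omega>)"
    using mult_left_mono[OF norm_le_1] by (intro AE_I2) fastforce
qed

lemma mixing_lim_add: "mixing_lim y f \<Longrightarrow> mixing_lim y g \<Longrightarrow> mixing_lim y (\<lambda>\<omega>. f \<omega> + g \<omega>)"
  unfolding mixing_lim_def
  by (auto simp: scaleR_add_left integrable_scaleR_Y intro: tendsto_add)

lemma mixing_lim_cmult: "mixing_lim y f \<Longrightarrow> mixing_lim y (\<lambda>\<omega>. c * f \<omega>)"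
  unfolding mixing_lim_def
  by (auto simp: scaleR_scaleR[symmetric] simp del: scaleR_scaleR intro: tendsto_scaleR)

lemma norm_mixing_gap_le:
  assumes g: "integrable M g"
  shows "norm ((\<integral>\<omega>. g \<omega> *\<^sub>R Y n \<omega> \<partial>M) - (\<integral>\<omega>. g \<omega> \<partial>M) *\<^sub>R y) \<le> (1 + norm y) * (\<integral>\<omega>. \<bar>g \<omega>\<bar> \<partial>M)"
proof -
  have "norm (\<integral>\<omega>. g \<omega> *\<^sub>R Y n \<omega> \<partial>M) \<le> (\<integral>\<omega>. \<bar>g \<omega>\<bar> \<partial>M)"
  proof (rule order_trans[OF integral_norm_bound], intro integral_mono integrable_norm integrable_scaleR_Y integrable_abs g)
    fix \<omega> assume "\<omega> \<in> space M"
    from mult_left_mono[OF norm_le_1[OF this], of "\<bar>g \<omega>\<bar>"]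
    show "norm (g \<omega> *\<^sub>R Y n \<omega>) \<le> \<bar>g \<omega>\<bar>"
      by simp
  qed
  moreover have "norm ((\<integral>\<omega>. g \<omega> \<partial>M) *\<^sub>R y) \<le> (\<integral>\<omega>. \<bar>g \<omega>\<bar> \<partial>M) * norm y"
    using integral_abs_bound[of M g] by (simp add: mult_right_mono)
  ultimately show ?thesis
    using norm_triangle_ineq4[of "\<integral>\<omega>. g \<omega> *\<^sub>R Y n \<omega> \<partial>M" "(\<integral>\<omega>. g \<omega> \<partial>M) *\<^sub>R y"]
    by (simp add: algebra_simps)
qed

lemma mixing_lim_L1:
  assumes s: "\<And>i::nat. mixing_lim y (s i)" and f: "integrable M f"
    and lim: "(\<lambda>i. \<integral>\<omega>. \<bar>s i \<omega> - f \<omega>\<bar> \<partial>M) \<longlonglongrightarrow> 0"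
  shows "mixing_lim y f"
proof -
  define D where "D g n = (\<integral>\<omega>. g \<omega> *\<^sub>R Y n \<omega> \<partial>M) - (\<integral>\<omega>. g \<omega> \<partial>M) *\<^sub>R y" for g n
  have s_int: "integrable M (s i)" and s_lim: "D (s i) \<longlonglongrightarrow> 0" for i
    using s[of i] unfolding mixing_lim_def D_def by (auto intro: LIM_zero)
  have "(\<lambda>i. (1 + norm y) * (\<integral>\<omega>. \<bar>s i \<omega> - f \<omega>\<bar> \<partial>M)) \<longlonglongrightarrow> (1 + norm y) * 0"
    by (intro tendsto_mult_left lim)
  then have gap_lim: "(\<lambda>i. (1 + norm y) * (\<integral>\<omega>. \<bar>s i \<omega> - f \<omega>\<bar> \<partial>M)) \<longlonglongrightarrow> 0"
    by simp
  have "D f \<longlonglongrightarrow> 0"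
  proof (rule LIMSEQ_I)
    fix e :: real assume "0 < e"
    then obtain i where i: "(1 + norm y) * (\<integral>\<omega>. \<bar>s i \<omega> - f \<omega>\<bar> \<partial>M) < e / 2"
      using order_tendstoD(2)[OF gap_lim, of "e / 2"] by (auto simp: eventually_sequentially)
    obtain N where N: "\<And>n. N \<le> n \<Longrightarrow> norm (D (s i) n) < e / 2"
      using LIMSEQ_D[OF s_lim[of i], of "e / 2"] \<open>0 < e\<close> by auto
    have "norm (D f n - 0) < e" if "N \<le> n" for n
    proof -
      have "D (s i) n - D f n = D (\<lambda>\<omega>. s i \<omega> - f \<omega>) n"
        using s_int f by (simp add: D_def integrable_scaleR_Y scaleR_diff_left)
      then have "norm (D (s i) n - D f n) < e / 2"
        using norm_mixing_gap_le[of "\<lambda>\<omega>. s i \<omega> - f \<omega>" n y] s_int f i by (simp add: D_def)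
      then show ?thesis
        using norm_triangle_ineq2[of "D f n" "D (s i) n"] N[OF that] by (simp add: norm_minus_commute)
    qed
    then show "\<exists>N. \<forall>n\<ge>N. norm (D f n - 0) < e"
      by blast
  qed
  then show ?thesis
    using f unfolding mixing_lim_def D_def by (auto intro: LIM_zero_cancel)
qed

lemma mixing_lim_dominated:
  assumes s: "\<And>i::nat. mixing_lim y (s i)" and g: "integrable M g"
    and lim: "\<And>\<omega>. \<omega> \<in> space M \<Longrightarrow> (\<lambda>i. s i \<omega>) \<longlonglongrightarrow> f \<omega>"
    and dom: "\<And>i \<omega>. \<omega> \<in> space M \<Longrightarrow> \<bar>s i \<omega>\<bar> \<le> g \<omega>"
  shows "mixing_lim y f"
proof (rule mixing_lim_L1[OF s])
  have s_meas[measurable]: "s i \<in> borel_measurable M" for i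
    using s[of i] by (auto simp: mixing_lim_def)
  have f_meas[measurable]: "f \<in> borel_measurable M"
    using lim by (rule borel_measurable_LIMSEQ_real) measurable
  show "integrable M f"
    using lim dom by (intro integrable_dominated_convergence[OF f_meas s_meas g, of "\<lambda>i. i"]) auto
  have f_le: "\<bar>f \<omega>\<bar> \<le> g \<omega>" if "\<omega> \<in> space M" for \<omega>
    using dom[OF that] by (intro LIMSEQ_le_const2[OF tendsto_rabs[OF lim[OF that]]]) auto
  have "(\<lambda>i. \<integral>\<omega>. \<bar>s i \<omega> - f \<omega>\<bar> \<partial>M) \<longlonglongrightarrow> (\<integral>\<omega>. 0 \<partial>M)"
  proof (rule integral_dominated_convergence[where w="\<lambda>\<omega>. 2 * g \<omega>"])
    show "AE \<omega> in M. (\<lambda>i. \<bar>s i \<omega> - f \<omega>\<bar>) \<longlonglongrightarrow> 0"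
      using lim by (intro AE_I2) (simp add: tendsto_rabs_zero_iff LIM_zero)
    show "AE \<omega> in M. norm \<bar>s i \<omega> - f \<omega>\<bar> \<le> 2 * g \<omega>" for i
    proof (rule AE_I2)
      fix \<omega> assume "\<omega> \<in> space M"
      from dom[OF this, of i] f_le[OF this] show "norm \<bar>s i \<omega> - f \<omega>\<bar> \<le> 2 * g \<omega>"
        by simp
    qed
  qed (use g in simp_all)
  then show "(\<lambda>i. \<integral>\<omega>. \<bar>s i \<omega> - f \<omega>\<bar> \<partial>M) \<longlonglongrightarrow> 0"
    by simp
qed

definition F_inf :: "'a measure" where
  "F_inf = sigma (space M) (\<Union>k. sets (F k))"

lemma
  shows space_F_inf: "space F_inf = space M"
    and sets_F_inf: "sets F_inf = sigma_sets (space M) (\<Union>k. sets (F k))"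
    and sets_F_subset_F_inf: "sets (F k) \<subseteq> sets F_inf"
    and subalgebra_F_inf: "subalgebra M F_inf"
proof -
  have E: "(\<Union>k. sets (F k)) \<subseteq> events"
    using sets_F_subset by auto
  then have Pow: "(\<Union>k. sets (F k)) \<subseteq> Pow (space M)"
    using sets.space_closed by blast
  show space: "space F_inf = space M" and sets: "sets F_inf = sigma_sets (space M) (\<Union>k. sets (F k))"
    using Pow by (simp_all add: F_inf_def)
  show "sets (F k) \<subseteq> sets F_inf"
    unfolding sets by (auto intro: sigma_sets.Basic)
  show "subalgebra M F_inf"
    unfolding subalgebra_def sets space using sets.sigma_sets_subset[OF E] by simp
qed

lemma Int_stable_UN_F: "Int_stable (\<Union>k. sets (F k))"
proof (rule Int_stableI)
  fix A B assume "A \<in> (\<Union>k. sets (F k))" "B \<in> (\<Union>k. sets (F k))"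
  then obtain i k where "A \<in> sets (F i)" "B \<in> sets (F k)"
    by auto
  then have "A \<in> sets (F (max i k))" "B \<in> sets (F (max i k))"
    using sets_F_mono[of i "max i k"] sets_F_mono[of k "max i k"] by auto
  then show "A \<inter> B \<in> (\<Union>k. sets (F k))"
    by blast
qed

lemma mixing_lim_indicator_Diff:
  assumes "mixing_lim y (indicator A)" "mixing_lim y (indicator B)" "B \<subseteq> A"
  shows "mixing_lim y (indicator (A - B))"
proof -
  have "mixing_lim y (\<lambda>\<omega>. indicator A \<omega> + - 1 * indicator B \<omega>)"
    by (intro mixing_lim_add mixing_lim_cmult assms)
  also have "(\<lambda>\<omega>. indicator A \<omega> + - 1 * indicator B \<omega> :: real) = indicator (A - B)"
    using assms(3) by (auto simp: fun_eq_iff split: split_indicator)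
  finally show ?thesis .
qed

lemma mixing_lim_indicator_UN:
  assumes A: "\<And>i::nat. mixing_lim y (indicator (A i))" and disj: "disjoint_family A"
  shows "mixing_lim y (indicator (\<Union>i. A i))"
proof -
  have partial: "mixing_lim y (\<lambda>\<omega>. \<Sum>i<n. indicator (A i) \<omega>)" for n
  proof (induction n)
    case 0
    show ?case
      by (simp add: mixing_lim_def)
  next
    case (Suc n)
    show ?case
      using mixing_lim_add[OF Suc A[of n]] by simp
  qed
  have partial_eq: "(\<Sum>i<n. indicator (A i) \<omega>) = (indicator (\<Union>i<n. A i) \<omega> :: real)" for n \<omega>
    using disj by (subst indicator_UN_disjoint) (auto simp: disjoint_family_on_def)
  show ?thesis
  proof (rule mixing_lim_dominated[OF partial])
    show "integrable M (\<lambda>_. 1 :: real)"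
      by simp
    show "(\<lambda>n. \<Sum>i<n. indicator (A i) \<omega>) \<longlonglongrightarrow> (indicator (\<Union>i. A i) \<omega> :: real)" for \<omega>
      unfolding partial_eq by (rule LIMSEQ_indicator_UN)
    show "\<bar>\<Sum>i<n. indicator (A i) \<omega>\<bar> \<le> (1 :: real)" for n \<omega>
      unfolding partial_eq by (simp add: indicator_def)
  qed
qed

lemma mixing_lim_indicator_F_inf:
  assumes F: "\<And>k H. H \<in> sets (F k) \<Longrightarrow> mixing_lim y (indicator H)"
    and A: "A \<in> sets F_inf"
  shows "mixing_lim y (indicator A)"
proof -
  have Pow: "(\<Union>k. sets (F k)) \<subseteq> Pow (space M)"
    using sets_F_subset sets.space_closed[of M] by blast
  show ?thesis
    using A unfolding sets_F_inf
  proof (induction rule: sigma_sets_induct_disjoint[OF Int_stable_UN_F Pow, consumes 1, case_names basic empty compl union])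
    case (basic A)
    then show ?case
      using F by auto
  next
    case empty
    show ?case
      by (rule F[of "{}" 0]) simp
  next
    case (compl A)
    have "mixing_lim y (indicator (space M))"
      using F[of "space M" 0] sets.top[of "F 0"] by (simp add: space_F)
    then show ?case
      using compl sigma_sets_into_sp[OF Pow compl(1)] by (intro mixing_lim_indicator_Diff)
  next
    case (union A)
    then show ?case
      by (intro mixing_lim_indicator_UN)
  qed
qed

lemma mixing_lim_F_inf:
  assumes F: "\<And>k H. H \<in> sets (F k) \<Longrightarrow> mixing_lim y (indicator H)"
    and g: "integrable (restr_to_subalg M F_inf) g"
  shows "mixing_lim y g"
  using g
proof (induction rule: integrable_induct)
  case (base A c)
  then have "mixing_lim y (indicator A)"
    by (intro mixing_lim_indicator_F_inf[OF F]) (simp_all add: sets_restr_to_subalg[OF subalgebra_F_inf])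
  from mixing_lim_cmult[OF this, of c] show ?case
    by (simp add: mult.commute)
next
  case (add f g)
  show ?case
    by (rule mixing_lim_add[OF add.IH])
next
  case (lim f s)
  show ?case
  proof (rule mixing_lim_dominated[OF lim.IH])
    show "integrable M (\<lambda>\<omega>. 2 * \<bar>f \<omega>\<bar>)"
      using integrable_from_subalg[OF subalgebra_F_inf lim.hyps(4)] by simp
    fix \<omega> assume "\<omega> \<in> space M"
    then have \<omega>: "\<omega> \<in> space (restr_to_subalg M F_inf)"
      by (simp add: space_restr_to_subalg)
    show "(\<lambda>i. s i \<omega>) \<longlonglongrightarrow> f \<omega>"
      by (rule lim.hyps(2)[OF \<omega>])
    show "\<bar>s i \<omega>\<bar> \<le> 2 * \<bar>f \<omega>\<bar>" for i
      using lim.hyps(3)[OF \<omega>, of i] by simp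
  qed
qed

text \<open>An event enters the integrals only through its conditional probability given \<open>F_inf\<close>.\<close>

theorem mixing_lim_indicator:
  assumes F: "\<And>k H. H \<in> sets (F k) \<Longrightarrow> mixing_lim y (indicator H)"
    and H: "H \<in> events"
  shows "mixing_lim y (indicator H)"
proof -
  interpret F_inf: finite_measure_subalgebra M F_inf
    by unfold_locales (rule subalgebra_F_inf)
  have H_int: "integrable M (indicator H :: 'a \<Rightarrow> real)"
    using H by (intro integrable_real_indicator) (simp_all add: less_top[symmetric])
  define g where "g = real_cond_exp M F_inf (indicator H)"
  have g_meas: "g \<in> borel_measurable F_inf"
    by (simp add: g_def)
  have g_int: "integrable M g" "(\<integral>\<omega>. g \<omega> \<partial>M) = prob H"
    unfolding g_def using F_inf.real_cond_exp_int[OF H_int] H by simp_all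
  have Y_meas: "Y n \<in> borel_measurable F_inf" for n
    using adapted[of n] sets_F_subset_F_inf[of n] by (auto simp: measurable_def space_F space_F_inf)
  have "(\<integral>\<omega>. g \<omega> *\<^sub>R Y n \<omega> \<partial>M) = (\<integral>\<omega>. indicator H \<omega> *\<^sub>R Y n \<omega> \<partial>M)" for n
  proof (rule euclidean_eqI)
    fix b :: 'b assume "b \<in> Basis"
    have Hb_int: "integrable M (\<lambda>\<omega>. (Y n \<omega> \<bullet> b) * indicator H \<omega>)"
      using integrable_inner_left[OF integrable_scaleR_Y[OF H_int, of n], of b] by (simp add: mult.commute)
    have "(\<integral>\<omega>. (Y n \<omega> \<bullet> b) * g \<omega> \<partial>M) = (\<integral>\<omega>. (Y n \<omega> \<bullet> b) * indicator H \<omega> \<partial>M)"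
      unfolding g_def using H Y_meas by (intro F_inf.real_cond_exp_intg(2) Hb_int) simp_all
    then show "(\<integral>\<omega>. g \<omega> *\<^sub>R Y n \<omega> \<partial>M) \<bullet> b = (\<integral>\<omega>. indicator H \<omega> *\<^sub>R Y n \<omega> \<partial>M) \<bullet> b"
      using integrable_scaleR_Y[OF g_int(1)] integrable_scaleR_Y[OF H_int]
      by (simp add: integral_inner_left[symmetric] mult.commute del: integral_inner_left)
  qed
  moreover have "mixing_lim y g"
    by (intro mixing_lim_F_inf[OF F] integrable_in_subalg[OF subalgebra_F_inf g_meas g_int(1)])
  ultimately show ?thesis
    using H_int g_int H by (simp add: mixing_lim_def)
qed

end

lemma
  assumes a: "0 \<le> a"
  shows real_distribution_gauss0: "real_distribution (gauss0 a)"
    and char_gauss0: "char (gauss0 a) t = exp (- (t\<^sup>2 * a) / 2)"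
proof -
  consider (degenerate) "a = 0" | (normal) "0 < sqrt a" "a \<noteq> 0"
    using a by fastforce
  then have "real_distribution (gauss0 a) \<and> char (gauss0 a) t = exp (- (t\<^sup>2 * a) / 2)"
  proof cases
    case degenerate
    then show ?thesis
      by (auto simp: gauss0_def real_distribution_def real_distribution_axioms_def char_def integral_return
          intro!: prob_space_return)
  next
    case normal
    let ?s = "sqrt a"
    have std: "normal_density 0 ?s (?s * x) * ?s = std_normal_density x" for x
      using normal a by (simp add: normal_density_def real_sqrt_mult power_mult_distrib)
    have "char (gauss0 a) t = (\<integral>x. normal_density 0 ?s x *\<^sub>R iexp (t * x) \<partial>lborel)"
      unfolding char_def gauss0_def using normal by (simp add: integral_density)
    also have "\<dots> = \<bar>?s\<bar> *\<^sub>R (\<integral>x. normal_density 0 ?s (0 + ?s * x) *\<^sub>R iexp (t * (0 + ?s * x)) \<partial>lborel)"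
      using normal by (intro lborel_integral_real_affine) simp
    also have "\<dots> = (\<integral>x. std_normal_density x *\<^sub>R iexp ((t * ?s) * x) \<partial>lborel)"
      unfolding std[symmetric] using normal by (simp add: mult_ac scaleR_conv_of_real)
    also have "\<dots> = char std_normal_distribution (t * ?s)"
      unfolding char_def by (simp add: integral_density)
    also have "\<dots> = exp (- (t\<^sup>2 * a) / 2)"
      using a by (simp add: char_std_normal_distribution power_mult_distrib)
    finally have "char (gauss0 a) t = exp (- (t\<^sup>2 * a) / 2)" .
    moreover have "real_distribution (gauss0 a)"
      using normal prob_space_normal_density[of ?s 0]
      by (auto simp: gauss0_def real_distribution_def real_distribution_axioms_def)
    ultimately show ?thesis by simp
  qed
  then show "real_distribution (gauss0 a)" "char (gauss0 a) t = exp (- (t\<^sup>2 * a) / 2)"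
    by auto
qed

lemma (in prob_space)
  assumes H: "H \<in> events" "0 < prob H"
  defines "P_H \<equiv> density M (\<lambda>\<omega>. ennreal (indicator H \<omega> / prob H))"
  shows prob_space_density_indicator: "prob_space P_H"
    and integral_distr_density_indicator: "\<And>(Z :: 'a \<Rightarrow> 'c::topological_space) (g :: 'c \<Rightarrow> 'b::{banach, second_countable_topology}).
      Z \<in> borel_measurable M \<Longrightarrow> g \<in> borel_measurable borel \<Longrightarrow>
      (\<integral>x. g x \<partial>distr P_H borel Z) = (\<integral>\<omega>. indicator H \<omega> *\<^sub>R g (Z \<omega>) \<partial>M) /\<^sub>R prob H"
proof -
  note [measurable] = H(1)
  show "prob_space P_H"
  proof
    have "emeasure P_H (space P_H) = (\<integral>\<^sup>+\<omega>. ennreal (indicator H \<omega> / prob H) \<partial>M)"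
      unfolding P_H_def by (subst emeasure_density) (auto intro!: nn_integral_cong)
    also have "\<dots> = (\<integral>\<^sup>+\<omega>. ennreal (1 / prob H) * indicator H \<omega> \<partial>M)"
      by (intro nn_integral_cong) (auto split: split_indicator)
    also have "\<dots> = 1"
      using H(2) by (subst nn_integral_cmult_indicator) (auto simp: emeasure_eq_measure ennreal_mult[symmetric])
    finally show "emeasure P_H (space P_H) = 1" .
  qed
  fix Z :: "'a \<Rightarrow> 'c" and g :: "'c \<Rightarrow> 'b"
  assume Z[measurable]: "Z \<in> borel_measurable M" and g[measurable]: "g \<in> borel_measurable borel"
  have "(\<integral>x. g x \<partial>distr P_H borel Z) = (\<integral>\<omega>. g (Z \<omega>) \<partial>P_H)"
    by (intro integral_distr g) (simp add: P_H_def)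
  also have "\<dots> = (\<integral>\<omega>. (indicator H \<omega> / prob H) *\<^sub>R g (Z \<omega>) \<partial>M)"
    unfolding P_H_def using H(2) by (intro integral_density) auto
  also have "\<dots> = (\<integral>\<omega>. inverse (prob H) *\<^sub>R (indicator H \<omega> *\<^sub>R g (Z \<omega>)) \<partial>M)"
    by (simp add: divide_inverse mult.commute)
  finally show "(\<integral>x. g x \<partial>distr P_H borel Z) = (\<integral>\<omega>. indicator H \<omega> *\<^sub>R g (Z \<omega>) \<partial>M) /\<^sub>R prob H"
    by (simp only: integral_scaleR_right)
qed

lemma (in prob_space) stably_to_constI:
  assumes Z: "\<And>n. Z n \<in> borel_measurable M" and K: "real_distribution K"
    and char_lim: "\<And>t H. H \<in> events \<Longrightarrow>
      (\<lambda>n. \<integral>\<omega>. indicator H \<omega> *\<^sub>R iexp (t * Z n \<omega>) \<partial>M) \<longlonglongrightarrow> prob H *\<^sub>R char K t"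
  shows "stably_to M Z (\<lambda>_. K)"
  unfolding stably_to_def
proof (intro ballI impI allI)
  fix H and f :: "real \<Rightarrow> real"
  assume H: "H \<in> events" "0 < prob H" and f: "continuous_on UNIV f" "bounded (range f)"
  let ?P_H = "density M (\<lambda>\<omega>. ennreal (indicator H \<omega> / prob H))"
  let ?D = "\<lambda>n. distr ?P_H borel (Z n)"
  have D: "real_distribution (?D n)" for n
    using prob_space_density_indicator[OF H] Z by (intro prob_space.real_distribution_distr) auto
  have "weak_conv_m ?D K"
  proof (rule levy_continuity[OF D K])
    fix t
    have "char (?D n) t = (\<integral>\<omega>. indicator H \<omega> *\<^sub>R iexp (t * Z n \<omega>) \<partial>M) /\<^sub>R prob H" for n
      unfolding char_def by (intro integral_distr_density_indicator[OF H] Z) simp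
    moreover have "(\<lambda>n. (\<integral>\<omega>. indicator H \<omega> *\<^sub>R iexp (t * Z n \<omega>) \<partial>M) /\<^sub>R prob H)
        \<longlonglongrightarrow> (prob H *\<^sub>R char K t) /\<^sub>R prob H"
      by (intro tendsto_scaleR tendsto_const char_lim[OF H(1)])
    ultimately show "(\<lambda>n. char (?D n) t) \<longlonglongrightarrow> char K t"
      using H(2) by simp
  qed
  moreover obtain b where "\<And>x. \<bar>f x\<bar> \<le> b"
    using f(2) by (auto simp: bounded_iff)
  moreover have "isCont f x" for x
    using f(1) by (simp add: continuous_on_eq_continuous_at)
  ultimately have "(\<lambda>n. \<integral>x. f x \<partial>?D n) \<longlonglongrightarrow> (\<integral>x. f x \<partial>K)"
    using D K by (intro weak_conv_imp_integral_bdd_continuous_conv[where B=b]) auto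
  moreover have "(\<integral>x. f x \<partial>?D n) = (\<integral>\<omega>. f (Z n \<omega>) * indicator H \<omega> \<partial>M) / prob H" for n
    using integral_distr_density_indicator[OF H Z borel_measurable_continuous_onI[OF f(1)], of n]
    by (simp add: divide_inverse mult.commute)
  ultimately show "(\<lambda>n. (\<integral>\<omega>. f (Z n \<omega>) * indicator H \<omega> \<partial>M) / prob H)
      \<longlonglongrightarrow> (\<integral>\<omega>. (\<integral>x. f x \<partial>K) * indicator H \<omega> \<partial>M) / prob H"
    using H by simp
qed

section \<open>The central limit theorem\<close>

lemma norm_iexp_minus_1_le: "norm (iexp x - 1) \<le> \<bar>x\<bar>"
  using iexp_approx1[of x 0] by simp

lemma one_minus_cos_le: "1 - cos x \<le> x\<^sup>2 / 2" for x :: real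
proof -
  have "norm (iexp x - 1 - \<i> * x) \<le> x\<^sup>2 / 2"
    using iexp_approx1[of x 1] by (simp add: numeral_2_eq_2 diff_diff_eq)
  then show ?thesis
    using abs_Re_le_cmod[of "iexp x - 1 - \<i> * x"] by (simp add: Re_exp)
qed

lemma norm_iexp_third_order: "norm (iexp x - 1 - \<i> * x + x\<^sup>2 / 2) \<le> \<bar>x\<bar> ^ 3 / 6"
proof -
  have "(\<Sum>k\<le>2. (\<i> * complex_of_real x) ^ k / fact k) = 1 + \<i> * x - x\<^sup>2 / 2"
    by (simp add: numeral_2_eq_2 power2_eq_square algebra_simps)
  then show ?thesis
    using iexp_approx1[of x 2] by (simp add: fact_numeral eval_nat_numeral algebra_simps)
qed

context cond_poisson_process
begin

lemma integral_iexp_increment: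
  fixes G :: "'a \<Rightarrow> complex"
  assumes G: "G \<in> borel_measurable (F n)" "\<And>\<omega>. \<omega> \<in> space M \<Longrightarrow> norm (G \<omega>) \<le> K"
  shows "(\<integral>\<omega>. G \<omega> * iexp (s * real (N (Suc n) \<omega> - N n \<omega>)) \<partial>M)
    = (\<integral>\<omega>. G \<omega> * exp (rate n \<omega> * (iexp s - 1)) \<partial>M)"
proof -
  let ?p = "\<lambda>k \<omega>. poisson_prob (rate n \<omega>) k" and ?G = "\<lambda>k \<omega>. G \<omega> * iexp (s * real k)"
  have "(\<integral>\<omega>. ?G (N (Suc n) \<omega> - N n \<omega>) \<omega> \<partial>M) = (\<integral>\<omega>. (\<Sum>k. ?p k \<omega> *\<^sub>R ?G k \<omega>) \<partial>M)"
  proof (rule integral_pair_nat[OF subalgebra_F increment_measurable poisson_prob_rate_measurable])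
    fix k \<omega>
    show "?G k \<in> borel_measurable (F n)"
      by (intro borel_measurable_times G borel_measurable_const)
    show "AE \<omega> in M. nn_cond_exp M (F n) (indicator {\<omega>\<in>space M. N (Suc n) \<omega> - N n \<omega> = k}) \<omega> = ennreal (?p k \<omega>)"
      by (rule increment_law)
    assume \<omega>: "\<omega> \<in> space M"
    show "0 \<le> ?p k \<omega>"
      by (rule poisson_prob_nonneg[OF rate_nonneg[OF \<omega>]])
    show "summable (\<lambda>k. ?p k \<omega>)"
      by (rule sums_summable[OF poisson_prob_sums])
    show "norm (?G k \<omega>) \<le> K"
      using G(2)[OF \<omega>] by (simp add: norm_mult)
  qed
  also have "\<dots> = (\<integral>\<omega>. G \<omega> * exp (rate n \<omega> * (iexp s - 1)) \<partial>M)"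
  proof (rule Bochner_Integration.integral_cong)
    fix \<omega>
    have "(\<lambda>k. G \<omega> * (of_real (?p k \<omega>) * iexp s ^ k)) sums (G \<omega> * exp (rate n \<omega> * (iexp s - 1)))"
      by (intro sums_mult sums_poisson_prob_power)
    then show "(\<Sum>k. ?p k \<omega> *\<^sub>R ?G k \<omega>) = G \<omega> * exp (rate n \<omega> * (iexp s - 1))"
      by (simp add: sums_iff scaleR_conv_of_real exp_of_nat_mult[symmetric] mult_ac)
  qed simp
  finally show ?thesis .
qed

definition iexp_martingale :: "real \<Rightarrow> nat \<Rightarrow> 'a \<Rightarrow> complex" where
  "iexp_martingale s n \<omega> = iexp (s * real (N n \<omega>)) * exp (- compensator n \<omega> * (iexp s - 1))"

lemma iexp_martingale_measurable: "iexp_martingale s n \<in> borel_measurable M"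
  unfolding iexp_martingale_def
  using real_N_measurable_M[of n, measurable] compensator_measurable[of n, measurable] by measurable

end

context normalized_cond_poisson_process
begin

lemma norm_exp_compensator_le:
  assumes "\<omega> \<in> space M"
  shows "norm (exp (- compensator n \<omega> * (iexp s - 1))) \<le> exp (C * (a n + 1) * (s\<^sup>2 / 2))"
proof -
  have "compensator n \<omega> * (1 - cos s) \<le> C * (a n + 1) * (s\<^sup>2 / 2)"
    using compensator_nonneg[OF assms] by (intro mult_mono compensator_le[OF assms] one_minus_cos_le) (auto intro: order_trans[OF _ compensator_le[OF assms]])
  then show ?thesis
    by (simp add: Re_exp algebra_simps)
qed

lemma norm_iexp_martingale_le:
  "\<omega> \<in> space M \<Longrightarrow> norm (iexp_martingale s n \<omega>) \<le> exp (C * (a n + 1) * (s\<^sup>2 / 2))"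
  unfolding iexp_martingale_def norm_mult norm_exp_i_times mult_1 by (rule norm_exp_compensator_le)

lemma integral_iexp_martingale:
  assumes H: "H \<in> sets (F k)" and "k \<le> n"
  shows "(\<integral>\<omega>. indicator H \<omega> *\<^sub>R iexp_martingale s n \<omega> \<partial>M) = (\<integral>\<omega>. indicator H \<omega> *\<^sub>R iexp_martingale s k \<omega> \<partial>M)"
  using \<open>k \<le> n\<close>
proof (induction rule: dec_induct)
  case (step n)
  then have [measurable]: "H \<in> sets (F n)"
    using H sets_F_mono[of k n] by auto
  note [measurable] = N_measurable[of n] compensator_Suc_measurable[of n]
  let ?G = "\<lambda>\<omega>. indicator H \<omega> *\<^sub>R (iexp (s * real (N n \<omega>)) * exp (- compensator (Suc n) \<omega> * (iexp s - 1)))"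
  have "(\<integral>\<omega>. indicator H \<omega> *\<^sub>R iexp_martingale s (Suc n) \<omega> \<partial>M)
      = (\<integral>\<omega>. ?G \<omega> * iexp (s * real (N (Suc n) \<omega> - N n \<omega>)) \<partial>M)"
    unfolding iexp_martingale_def
    by (intro Bochner_Integration.integral_cong)
       (simp_all add: of_nat_diff N_le_Suc exp_add[symmetric] algebra_simps)
  also have "\<dots> = (\<integral>\<omega>. ?G \<omega> * exp (rate n \<omega> * (iexp s - 1)) \<partial>M)"
  proof (rule integral_iexp_increment)
    show "?G \<in> borel_measurable (F n)"
      by measurable
    fix \<omega> assume "\<omega> \<in> space M"
    from norm_exp_compensator_le[OF this, of "Suc n" s]
    show "norm (?G \<omega>) \<le> exp (C * (a (Suc n) + 1) * (s\<^sup>2 / 2))"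
      unfolding norm_scaleR norm_mult norm_exp_i_times by (simp add: indicator_def del: norm_exp_eq_Re)
  qed
  also have "\<dots> = (\<integral>\<omega>. indicator H \<omega> *\<^sub>R iexp_martingale s n \<omega> \<partial>M)"
    unfolding iexp_martingale_def
    by (intro Bochner_Integration.integral_cong)
       (simp_all add: compensator_def exp_add[symmetric] algebra_simps)
  finally show ?case
    using step by simp
qed simp

lemma integral_iexp_martingale_LIMSEQ:
  assumes H: "H \<in> sets (F k)" and s: "s \<longlonglongrightarrow> 0"
  shows "(\<lambda>n. \<integral>\<omega>. indicator H \<omega> *\<^sub>R iexp_martingale (s n) n \<omega> \<partial>M) \<longlonglongrightarrow> prob H"
proof -
  have [measurable]: "H \<in> events"
    using H sets_F_subset by auto
  note [measurable] = iexp_martingale_measurable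
  obtain S where S: "\<And>n. \<bar>s n\<bar> \<le> S"
    using convergent_imp_Bseq[OF convergentI[OF s]] by (auto simp: Bseq_def)
  have iexp_lim: "(\<lambda>n. iexp (s n * x)) \<longlonglongrightarrow> 1" for x
    using tendsto_exp[OF tendsto_mult_left[OF tendsto_of_real[OF tendsto_mult_left_zero[OF s, of x]], of \<i>]] by simp
  have martingale_lim: "(\<lambda>n. iexp_martingale (s n) k \<omega>) \<longlonglongrightarrow> 1" for \<omega>
    using tendsto_mult[OF iexp_lim[of "real (N k \<omega>)"]
        tendsto_exp[OF tendsto_mult_left[OF LIM_zero[OF iexp_lim[of 1]], of "- of_real (compensator k \<omega>)"]]]
    unfolding iexp_martingale_def by simp
  have "(\<lambda>n. \<integral>\<omega>. indicator H \<omega> *\<^sub>R iexp_martingale (s n) k \<omega> \<partial>M) \<longlonglongrightarrow> (\<integral>\<omega>. indicator H \<omega> *\<^sub>R 1 \<partial>M)"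
  proof (rule integral_dominated_convergence)
    show "AE \<omega> in M. (\<lambda>n. indicator H \<omega> *\<^sub>R iexp_martingale (s n) k \<omega>) \<longlonglongrightarrow> indicator H \<omega> *\<^sub>R 1"
      by (intro AE_I2 tendsto_scaleR tendsto_const martingale_lim)
    show "AE \<omega> in M. norm (indicator H \<omega> *\<^sub>R iexp_martingale (s n) k \<omega>) \<le> exp (C * (a k + 1) * (S\<^sup>2 / 2))" for n
    proof (rule AE_I2)
      fix \<omega> assume \<omega>: "\<omega> \<in> space M"
      have "(s n)\<^sup>2 \<le> S\<^sup>2"
        using power_mono[OF S abs_ge_zero, of n 2] by simp
      then have "C * (a k + 1) * ((s n)\<^sup>2 / 2) \<le> C * (a k + 1) * (S\<^sup>2 / 2)"
        using C a_nonneg[of k] by (intro mult_left_mono) auto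
      then have "exp (C * (a k + 1) * ((s n)\<^sup>2 / 2)) \<le> exp (C * (a k + 1) * (S\<^sup>2 / 2))"
        by simp
      from order_trans[OF norm_iexp_martingale_le[OF \<omega>] this]
      show "norm (indicator H \<omega> *\<^sub>R iexp_martingale (s n) k \<omega>) \<le> exp (C * (a k + 1) * (S\<^sup>2 / 2))"
        by (simp add: indicator_def)
    qed
  qed simp_all
  then have "(\<lambda>n. \<integral>\<omega>. indicator H \<omega> *\<^sub>R iexp_martingale (s n) k \<omega> \<partial>M) \<longlonglongrightarrow> prob H"
    by (subst (asm) integral_scaleR_left) (simp_all add: scaleR_conv_of_real less_top[symmetric])
  then show ?thesis
  proof (rule Lim_transform_eventually)
    show "eventually (\<lambda>n. (\<integral>\<omega>. indicator H \<omega> *\<^sub>R iexp_martingale (s n) k \<omega> \<partial>M)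
        = (\<integral>\<omega>. indicator H \<omega> *\<^sub>R iexp_martingale (s n) n \<omega> \<partial>M)) sequentially"
      using eventually_ge_at_top[of k] by eventually_elim (rule integral_iexp_martingale[OF H, symmetric])
  qed
qed

end

locale poisson_process_clt = normalized_cond_poisson_process M F N rate a C
    for M :: "'a measure" and F N rate a C +
  fixes l :: real
  assumes compensator_lim: "AE \<omega> in M. (\<lambda>n. compensator n \<omega> / a n) \<longlonglongrightarrow> l"
    and compensator_L1: "(\<lambda>n. (\<integral>\<omega>. \<bar>compensator n \<omega> - l * a n\<bar> \<partial>M) / sqrt (a n)) \<longlonglongrightarrow> 0"
begin

definition fluctuation :: "nat \<Rightarrow> 'a \<Rightarrow> real" where
  "fluctuation n \<omega> = sqrt (a n) * (real (N n \<omega>) / a n - l)"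

definition compensator_factor :: "real \<Rightarrow> nat \<Rightarrow> 'a \<Rightarrow> complex" where
  "compensator_factor s n \<omega> = exp (compensator n \<omega> * (iexp s - 1 - \<i> * s))"

definition correction :: "real \<Rightarrow> nat \<Rightarrow> 'a \<Rightarrow> complex" where
  "correction s n \<omega> = compensator_factor s n \<omega> * iexp (s * (compensator n \<omega> - l * a n))"

definition gauss_char :: "real \<Rightarrow> complex" where
  "gauss_char t = exp (- (t\<^sup>2 * l) / 2)"

lemma compensator_factor_measurable: "compensator_factor s n \<in> borel_measurable M"
  unfolding compensator_factor_def using compensator_measurable[of n, measurable] by measurable

lemma norm_compensator_factor_le_1: "\<omega> \<in> space M \<Longrightarrow> norm (compensator_factor s n \<omega>) \<le> 1"
  by (simp add: compensator_factor_def Re_exp mult_nonneg_nonpos compensator_nonneg)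

lemma correction_measurable: "correction s n \<in> borel_measurable M"
  unfolding correction_def compensator_factor_def using compensator_measurable[of n, measurable] by measurable

lemma limit_nonneg: "0 \<le> l"
proof -
  have "AE \<omega> in M. 0 \<le> l"
    using compensator_lim AE_space
  proof eventually_elim
    case (elim \<omega>)
    then show ?case
      by (intro LIMSEQ_le_const[OF elim(1)]) (auto simp: compensator_nonneg a_nonneg)
  qed
  then show ?thesis by simp
qed

lemma norm_gauss_char_le_1: "norm (gauss_char t) \<le> 1"
  using limit_nonneg by (simp add: gauss_char_def)

lemma iexp_fluctuation_eq:
  "iexp (t * fluctuation n \<omega>) = iexp_martingale (t / sqrt (a n)) n \<omega> * correction (t / sqrt (a n)) n \<omega>"
proof -
  have "t * fluctuation n \<omega> = t / sqrt (a n) * (real (N n \<omega>) - l * a n)"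
    using a_nonneg[of n] by (cases "a n = 0") (simp_all add: fluctuation_def field_simps)
  moreover have "iexp_martingale s n \<omega> * correction s n \<omega> = iexp (s * (real (N n \<omega>) - l * a n))" for s
    by (simp add: iexp_martingale_def correction_def compensator_factor_def exp_add[symmetric] algebra_simps)
  ultimately show ?thesis
    by (simp only:)
qed

lemma iexp_scaled_lim: "(\<lambda>n. a n * (iexp (t / sqrt (a n)) - 1 - \<i> * (t / sqrt (a n)))) \<longlonglongrightarrow> complex_of_real (- (t\<^sup>2 / 2))"
proof -
  let ?s = "\<lambda>n. t / sqrt (a n)"
  have "(\<lambda>n. a n * (iexp (?s n) - 1 - \<i> * ?s n) + t\<^sup>2 / 2) \<longlonglongrightarrow> 0"
  proof (rule Lim_null_comparison)
    show "(\<lambda>n. (\<bar>t\<bar> ^ 3 / 6) / sqrt (a n)) \<longlonglongrightarrow> 0"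
      by (rule tendsto_const_div_sqrt_a)
    show "eventually (\<lambda>n. norm (a n * (iexp (?s n) - 1 - \<i> * ?s n) + t\<^sup>2 / 2) \<le> (\<bar>t\<bar> ^ 3 / 6) / sqrt (a n)) sequentially"
      using eventually_a_ge_1
    proof eventually_elim
      case (elim n)
      then have a_s: "a n * (?s n)\<^sup>2 = t\<^sup>2" "a n * \<bar>?s n\<bar> ^ 3 = \<bar>t\<bar> ^ 3 / sqrt (a n)"
        by (simp_all add: power_divide power3_eq_cube field_simps)
      have "a n * (iexp (?s n) - 1 - \<i> * ?s n) + t\<^sup>2 / 2 = a n * (iexp (?s n) - 1 - \<i> * ?s n + (?s n)\<^sup>2 / 2)"
        unfolding a_s(1)[symmetric] by (simp add: algebra_simps)
      also have "norm \<dots> \<le> a n * (\<bar>?s n\<bar> ^ 3 / 6)"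
        using elim by (subst norm_mult) (intro mult_mono norm_iexp_third_order, auto)
      finally show ?case
        using a_s(2) by simp
    qed
  qed
  from tendsto_diff[OF this tendsto_const[of "complex_of_real (t\<^sup>2 / 2)"]] show ?thesis
    by simp
qed

lemma LIMSEQ_compensator_factor:
  assumes "(\<lambda>n. compensator n \<omega> / a n) \<longlonglongrightarrow> l"
  shows "(\<lambda>n. compensator_factor (t / sqrt (a n)) n \<omega>) \<longlonglongrightarrow> gauss_char t"
proof -
  let ?z = "\<lambda>n. iexp (t / sqrt (a n)) - 1 - \<i> * (t / sqrt (a n))"
  have "(\<lambda>n. of_real (compensator n \<omega> / a n) * (a n * ?z n)) \<longlonglongrightarrow> complex_of_real l * complex_of_real (- (t\<^sup>2 / 2))"
    by (intro tendsto_mult tendsto_of_real assms iexp_scaled_lim)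
  moreover have "eventually (\<lambda>n. of_real (compensator n \<omega> / a n) * (a n * ?z n) = compensator n \<omega> * ?z n) sequentially"
    using eventually_a_ge_1 by eventually_elim simp
  ultimately have "(\<lambda>n. compensator n \<omega> * ?z n) \<longlonglongrightarrow> complex_of_real l * complex_of_real (- (t\<^sup>2 / 2))"
    by (rule Lim_transform_eventually)
  from tendsto_exp[OF this] show ?thesis
    unfolding compensator_factor_def gauss_char_def
    by (simp only: of_real_mult[symmetric] exp_of_real) (simp only: mult.commute[of l] mult_minus_left minus_divide_left times_divide_eq_left)
qed

lemma compensator_factor_L1_lim:
  "(\<lambda>n. \<integral>\<omega>. norm (compensator_factor (t / sqrt (a n)) n \<omega> - gauss_char t) \<partial>M) \<longlonglongrightarrow> 0"
proof -
  note [measurable] = compensator_factor_measurable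
  have "(\<lambda>n. \<integral>\<omega>. norm (compensator_factor (t / sqrt (a n)) n \<omega> - gauss_char t) \<partial>M) \<longlonglongrightarrow> (\<integral>\<omega>. 0 \<partial>M)"
  proof (rule integral_dominated_convergence)
    show "AE \<omega> in M. (\<lambda>n. norm (compensator_factor (t / sqrt (a n)) n \<omega> - gauss_char t)) \<longlonglongrightarrow> 0"
      using compensator_lim by eventually_elim (intro tendsto_norm_zero LIM_zero LIMSEQ_compensator_factor)
    show "AE \<omega> in M. norm (norm (compensator_factor (t / sqrt (a n)) n \<omega> - gauss_char t)) \<le> 1 + 1" for n
      unfolding real_norm_def abs_norm_cancel
      by (intro AE_I2 order_trans[OF norm_triangle_ineq4] add_mono norm_compensator_factor_le_1 norm_gauss_char_le_1)
  qed simp_all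
  then show ?thesis by simp
qed

lemma norm_correction_diff_le:
  assumes "\<omega> \<in> space M"
  shows "norm (correction s n \<omega> - z) \<le> \<bar>s\<bar> * \<bar>compensator n \<omega> - l * a n\<bar> + norm (compensator_factor s n \<omega> - z)"
proof -
  let ?e = "iexp (s * (compensator n \<omega> - l * a n))"
  have "correction s n \<omega> - z = compensator_factor s n \<omega> * (?e - 1) + (compensator_factor s n \<omega> - z)"
    by (simp add: correction_def right_diff_distrib)
  also have "norm \<dots> \<le> norm (compensator_factor s n \<omega>) * norm (?e - 1) + norm (compensator_factor s n \<omega> - z)"
    by (metis norm_mult norm_triangle_ineq)
  also have "norm (compensator_factor s n \<omega>) * norm (?e - 1) \<le> 1 * \<bar>s * (compensator n \<omega> - l * a n)\<bar>"
    by (intro mult_mono norm_compensator_factor_le_1 assms norm_iexp_minus_1_le) auto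
  finally show ?thesis
    by (simp add: abs_mult)
qed

lemma correction_L1_lim:
  "(\<lambda>n. \<integral>\<omega>. norm (correction (t / sqrt (a n)) n \<omega> - gauss_char t) \<partial>M) \<longlonglongrightarrow> 0"
proof (rule Lim_null_comparison)
  let ?s = "\<lambda>n. t / sqrt (a n)" and ?d = "\<lambda>n \<omega>. compensator n \<omega> - l * a n"
  let ?A = "\<lambda>n. \<integral>\<omega>. norm (compensator_factor (?s n) n \<omega> - gauss_char t) \<partial>M"
  have d_int: "integrable M (\<lambda>\<omega>. \<bar>?d n \<omega>\<bar>)" for n
    using compensator_nonneg compensator_le compensator_measurable
    by (intro integrable_abs Bochner_Integration.integrable_diff integrable_const
        integrable_const_bound[of _ "C * (a n + 1)"] AE_I2) auto
  have A_int: "integrable M (\<lambda>\<omega>. norm (compensator_factor (?s n) n \<omega> - gauss_char t))" for n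
    by (intro integrable_norm Bochner_Integration.integrable_diff integrable_const
        integrable_const_bound[of _ 1] AE_I2 norm_compensator_factor_le_1 compensator_factor_measurable)
  show "eventually (\<lambda>n. norm (\<integral>\<omega>. norm (correction (?s n) n \<omega> - gauss_char t) \<partial>M)
      \<le> \<bar>t\<bar> * ((\<integral>\<omega>. \<bar>?d n \<omega>\<bar> \<partial>M) / sqrt (a n)) + ?A n) sequentially"
  proof (intro always_eventually allI)
    fix n
    have "(\<integral>\<omega>. norm (correction (?s n) n \<omega> - gauss_char t) \<partial>M)
        \<le> (\<integral>\<omega>. \<bar>?s n\<bar> * \<bar>?d n \<omega>\<bar> + norm (compensator_factor (?s n) n \<omega> - gauss_char t) \<partial>M)"
      by (intro integral_mono_AE' AE_I2 norm_correction_diff_le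
          Bochner_Integration.integrable_add integrable_mult_right d_int A_int) auto
    also have "\<dots> = \<bar>?s n\<bar> * (\<integral>\<omega>. \<bar>?d n \<omega>\<bar> \<partial>M) + ?A n"
      using d_int[of n] A_int[of n] by (subst Bochner_Integration.integral_add) auto
    finally show "norm (\<integral>\<omega>. norm (correction (?s n) n \<omega> - gauss_char t) \<partial>M)
        \<le> \<bar>t\<bar> * ((\<integral>\<omega>. \<bar>?d n \<omega>\<bar> \<partial>M) / sqrt (a n)) + ?A n"
      using a_nonneg[of n] by (simp add: abs_divide)
  qed
  from tendsto_add[OF tendsto_mult_left[OF compensator_L1, of "\<bar>t\<bar>"] compensator_factor_L1_lim[of t]]
  show "(\<lambda>n. \<bar>t\<bar> * ((\<integral>\<omega>. \<bar>?d n \<omega>\<bar> \<partial>M) / sqrt (a n)) + ?A n) \<longlonglongrightarrow> 0"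
    by simp
qed

lemma norm_integral_iexp_fluctuation_diff_le:
  fixes t n
  assumes H: "H \<in> events" and n: "1 \<le> a n"
  defines "s \<equiv> t / sqrt (a n)"
  shows "norm ((\<integral>\<omega>. indicator H \<omega> *\<^sub>R iexp (t * fluctuation n \<omega>) \<partial>M) - (\<integral>\<omega>. indicator H \<omega> *\<^sub>R iexp_martingale s n \<omega> \<partial>M) * z)
    \<le> exp (C * t\<^sup>2) * (\<integral>\<omega>. norm (correction s n \<omega> - z) \<partial>M)"
proof -
  let ?U = "\<lambda>\<omega>. indicator H \<omega> *\<^sub>R iexp_martingale s n \<omega>"
  have U_meas: "?U \<in> borel_measurable M"
    using H by (intro borel_measurable_scaleR iexp_martingale_measurable) auto
  have U_le: "norm (?U \<omega>) \<le> exp (C * t\<^sup>2)" if \<omega>: "\<omega> \<in> space M" for \<omega>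
  proof -
    have "C * (a n + 1) * (s\<^sup>2 / 2) \<le> C * (2 * a n) * (s\<^sup>2 / 2)"
      using n C by (intro mult_right_mono mult_left_mono) auto
    also have "\<dots> = C * t\<^sup>2"
      using n by (simp add: s_def power_divide)
    finally have "exp (C * (a n + 1) * (s\<^sup>2 / 2)) \<le> exp (C * t\<^sup>2)"
      by simp
    from order_trans[OF norm_iexp_martingale_le[OF \<omega>] this] show ?thesis
      by (simp add: indicator_def)
  qed
  have corr_le: "norm (correction s n \<omega>) \<le> 1" if "\<omega> \<in> space M" for \<omega>
    unfolding correction_def norm_mult norm_exp_i_times using norm_compensator_factor_le_1[OF that] by simp
  have U_int: "integrable M ?U"
    using U_le by (intro integrable_const_bound[of _ "exp (C * t\<^sup>2)"] AE_I2 U_meas)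
  have Uc_int: "integrable M (\<lambda>\<omega>. ?U \<omega> * correction s n \<omega>)"
  proof (intro integrable_const_bound[of _ "exp (C * t\<^sup>2) * 1"] AE_I2 borel_measurable_times U_meas correction_measurable)
    fix \<omega> assume "\<omega> \<in> space M"
    then show "norm (?U \<omega> * correction s n \<omega>) \<le> exp (C * t\<^sup>2) * 1"
      unfolding norm_mult by (intro mult_mono U_le corr_le) auto
  qed
  have corr_int: "integrable M (\<lambda>\<omega>. norm (correction s n \<omega> - z))"
    by (intro integrable_norm Bochner_Integration.integrable_diff integrable_const
        integrable_const_bound[of _ 1] AE_I2 corr_le correction_measurable)
  have "(\<integral>\<omega>. indicator H \<omega> *\<^sub>R iexp (t * fluctuation n \<omega>) \<partial>M) - (\<integral>\<omega>. ?U \<omega> \<partial>M) * z = (\<integral>\<omega>. ?U \<omega> * (correction s n \<omega> - z) \<partial>M)"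
    unfolding iexp_fluctuation_eq s_def[symmetric] right_diff_distrib mult_scaleR_left[symmetric]
      Bochner_Integration.integral_diff[OF Uc_int integrable_mult_left[OF U_int]] integral_mult_left_zero ..
  also have "norm \<dots> \<le> (\<integral>\<omega>. exp (C * t\<^sup>2) * norm (correction s n \<omega> - z) \<partial>M)"
  proof (rule order_trans[OF integral_norm_bound], rule integral_mono_AE')
    show "AE \<omega> in M. norm (?U \<omega> * (correction s n \<omega> - z)) \<le> exp (C * t\<^sup>2) * norm (correction s n \<omega> - z)"
      unfolding norm_mult by (intro AE_I2 mult_right_mono U_le norm_ge_zero)
  qed (use corr_int in auto)
  finally show ?thesis by simp
qed

lemma integral_iexp_fluctuation_LIMSEQ:
  assumes H: "H \<in> sets (F k)"
  shows "(\<lambda>n. \<integral>\<omega>. indicator H \<omega> *\<^sub>R iexp (t * fluctuation n \<omega>) \<partial>M) \<longlonglongrightarrow> prob H *\<^sub>R gauss_char t"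
proof -
  let ?I = "\<lambda>n. \<integral>\<omega>. indicator H \<omega> *\<^sub>R iexp (t * fluctuation n \<omega>) \<partial>M"
  let ?U = "\<lambda>n. \<integral>\<omega>. indicator H \<omega> *\<^sub>R iexp_martingale (t / sqrt (a n)) n \<omega> \<partial>M"
  have "(\<lambda>n. ?I n - ?U n * gauss_char t) \<longlonglongrightarrow> 0"
  proof (rule Lim_null_comparison)
    show "(\<lambda>n. exp (C * t\<^sup>2) * (\<integral>\<omega>. norm (correction (t / sqrt (a n)) n \<omega> - gauss_char t) \<partial>M)) \<longlonglongrightarrow> 0"
      by (rule tendsto_mult_right_zero[OF correction_L1_lim])
    show "eventually (\<lambda>n. norm (?I n - ?U n * gauss_char t)
        \<le> exp (C * t\<^sup>2) * (\<integral>\<omega>. norm (correction (t / sqrt (a n)) n \<omega> - gauss_char t) \<partial>M)) sequentially"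
      using eventually_a_ge_1
      by eventually_elim (use H sets_F_subset in \<open>blast intro: norm_integral_iexp_fluctuation_diff_le\<close>)
  qed
  moreover have "(\<lambda>n. ?U n * gauss_char t) \<longlonglongrightarrow> prob H * gauss_char t"
    by (intro tendsto_mult tendsto_const integral_iexp_martingale_LIMSEQ[OF H] tendsto_const_div_sqrt_a)
  ultimately have "(\<lambda>n. ?I n - ?U n * gauss_char t + ?U n * gauss_char t) \<longlonglongrightarrow> 0 + prob H * gauss_char t"
    by (rule tendsto_add)
  then show ?thesis
    by (simp add: scaleR_conv_of_real)
qed

theorem fluctuation_stably_to_gauss0: "stably_to M fluctuation (\<lambda>_. gauss0 l)"
proof (rule stably_to_constI)
  have fluctuation_measurable: "fluctuation n \<in> borel_measurable (F n)" for n
    unfolding fluctuation_def using real_N_measurable[of n, measurable] by measurable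
  then show "fluctuation n \<in> borel_measurable M" for n
    by (rule measurable_F_M)
  show "real_distribution (gauss0 l)"
    by (rule real_distribution_gauss0[OF limit_nonneg])
  fix t H assume H: "H \<in> events"
  let ?Y = "\<lambda>n \<omega>. iexp (t * fluctuation n \<omega>)"
  interpret Y: bounded_adapted_process M F ?Y
  proof
    show "?Y n \<in> borel_measurable (F n)" for n
      using fluctuation_measurable[of n, measurable] by measurable
  qed simp
  have "Y.mixing_lim (gauss_char t) (indicator H)"
  proof (rule Y.mixing_lim_indicator[OF _ H])
    fix k H assume H: "H \<in> sets (F k)"
    then have "H \<in> events"
      using sets_F_subset by auto
    then show "Y.mixing_lim (gauss_char t) (indicator H)"
      using integral_iexp_fluctuation_LIMSEQ[OF H, of t]
      unfolding Y.mixing_lim_def by (simp add: less_top[symmetric] scaleR_conv_of_real)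
  qed
  then show "(\<lambda>n. \<integral>\<omega>. indicator H \<omega> *\<^sub>R ?Y n \<omega> \<partial>M) \<longlonglongrightarrow> prob H *\<^sub>R char (gauss0 l) t"
    using H unfolding Y.mixing_lim_def char_gauss0[OF limit_nonneg] gauss_char_def by simp
qed

end

section \<open>Asymptotics of the new-feature rates\<close>

lemma ln_Gamma_plus1:
  fixes x :: real
  assumes "0 < x"
  shows "ln (Gamma (x + 1)) = ln x + ln (Gamma x)"
proof -
  have "x \<notin> \<int>\<^sub>\<le>\<^sub>0"
    using assms nonpos_Ints_nonpos[of x] by auto
  then have "Gamma (x + 1) = x * Gamma x"
    by (rule Gamma_plus1)
  then show ?thesis
    using assms Gamma_real_pos[OF assms] by (simp only: ln_mult_pos)
qed

text \<open>Gautschi's inequality, from the logarithmic convexity of the Gamma function.\<close>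

lemma
  fixes x b :: real
  assumes x: "0 < x" and b: "0 \<le> b" "b \<le> 1"
  shows Gamma_quotient_ge: "(x + b) powr (b - 1) \<le> Gamma (x + b) / Gamma (x + 1)"
    and Gamma_quotient_le: "Gamma (x + b) / Gamma (x + 1) \<le> x powr (b - 1)"
proof -
  have convex: "ln (Gamma ((1 - t) * y + t * z)) \<le> (1 - t) * ln (Gamma y) + t * ln (Gamma z)"
    if "0 \<le> t" "t \<le> 1" "0 < y" "0 < z" for t y z :: real
    using convex_onD[OF log_convex_Gamma_real, of t y z] that by simp
  have quotient_eq: "Gamma (x + b) / Gamma (x + 1) = exp (ln (Gamma (x + b)) - ln (Gamma (x + 1)))"
    using x b by (simp add: exp_diff Gamma_real_pos)
  have "(1 - b) * x + b * (x + 1) = x + b" "(1 - (1 - b)) * (x + b) + (1 - b) * (x + b + 1) = x + 1"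
    by (simp_all add: algebra_simps)
  then have "ln (Gamma (x + b)) \<le> (1 - b) * ln (Gamma x) + b * ln (Gamma (x + 1))"
    "ln (Gamma (x + 1)) \<le> b * ln (Gamma (x + b)) + (1 - b) * ln (Gamma (x + b + 1))"
    using convex[of b x "x + 1"] convex[of "1 - b" "x + b" "x + b + 1"] x b by simp_all
  then have "ln (Gamma (x + b)) - ln (Gamma (x + 1)) \<le> (b - 1) * ln x"
    "(b - 1) * ln (x + b) \<le> ln (Gamma (x + b)) - ln (Gamma (x + 1))"
    using x b by (simp_all only: ln_Gamma_plus1[OF x] ln_Gamma_plus1[of "x + b"] add_pos_nonneg) (simp_all add: algebra_simps)
  then show "(x + b) powr (b - 1) \<le> Gamma (x + b) / Gamma (x + 1)"
    "Gamma (x + b) / Gamma (x + 1) \<le> x powr (b - 1)"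
    unfolding quotient_eq powr_def using x b by simp_all
qed

lemma powr_lipschitz:
  fixes e a x y :: real
  assumes e: "e \<le> 0" and a: "0 < a" "a \<le> x" "a \<le> y"
  shows "\<bar>x powr e - y powr e\<bar> \<le> \<bar>e\<bar> * a powr (e - 1) * \<bar>x - y\<bar>"
proof -
  have "norm (x powr e - y powr e) \<le> \<bar>e\<bar> * a powr (e - 1) * norm (x - y)"
  proof (rule field_differentiable_bound[where S="{a..}" and f'="\<lambda>x. e * x powr (e - 1)"])
    fix z assume z: "z \<in> {a..}"
    show "((\<lambda>x. x powr e) has_field_derivative e * z powr (e - 1)) (at z within {a..})"
      using z a by (intro DERIV_subset[OF has_real_derivative_powr]) auto
    have "z powr (e - 1) \<le> a powr (e - 1)"
      using z a e by (intro powr_mono2') auto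
    then show "norm (e * z powr (e - 1)) \<le> \<bar>e\<bar> * a powr (e - 1)"
      by (simp add: abs_mult mult_left_mono)
  qed (use a in auto)
  then show ?thesis by simp
qed

lemma weighted_cesaro_null:
  fixes w x b :: "nat \<Rightarrow> real"
  assumes w: "\<And>j. 0 \<le> w j" "\<And>n. (\<Sum>j<n. w j) \<le> K * (b n + 1)" and b: "filterlim b at_top sequentially"
    and x: "x \<longlonglongrightarrow> 0"
  shows "(\<lambda>n. (\<Sum>j<n. w j * x j) / b n) \<longlonglongrightarrow> 0"
proof (rule tendstoI)
  fix e :: real assume e: "0 < e"
  define d where "d = e / (4 * (\<bar>K\<bar> + 1))"
  have d: "0 < d" "d * \<bar>K\<bar> \<le> e / 4"
    using e by (auto simp: d_def field_simps)
  obtain J where J: "\<And>j. J \<le> j \<Longrightarrow> \<bar>x j\<bar> < d"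
    using LIMSEQ_D[OF x d(1)] by auto
  define S where "S = (\<Sum>j<J. w j * \<bar>x j\<bar>)"
  have split: "\<bar>\<Sum>j<n. w j * x j\<bar> \<le> S + d * (\<Sum>j<n. w j)" if "J \<le> n" for n
  proof -
    have "\<bar>\<Sum>j<n. w j * x j\<bar> \<le> (\<Sum>j<n. \<bar>w j * x j\<bar>)"
      by (rule sum_abs)
    also have "\<dots> \<le> (\<Sum>j<n. (if j < J then w j * \<bar>x j\<bar> else 0) + d * w j)"
    proof (rule sum_mono)
      show "\<bar>w j * x j\<bar> \<le> (if j < J then w j * \<bar>x j\<bar> else 0) + d * w j" for j
        using J[of j] d(1) w(1)[of j] mult_left_mono[of "\<bar>x j\<bar>" d "w j"] by (auto simp: abs_mult mult.commute)
    qed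
    also have "\<dots> = S + d * (\<Sum>j<n. w j)"
      using that by (simp add: S_def sum.distrib sum_distrib_left sum.If_cases lessThan_def[symmetric] Int_absorb1 subset_eq)
    finally show ?thesis .
  qed
  have "eventually (\<lambda>n. max 1 (4 * S / e) < b n) sequentially"
    using b unfolding filterlim_at_top_dense by blast
  then show "eventually (\<lambda>n. dist ((\<Sum>j<n. w j * x j) / b n) 0 < e) sequentially"
    using eventually_ge_at_top[of J]
  proof eventually_elim
    case (elim n)
    then have b_n: "1 < b n" "S < e * b n / 4"
      using e by (auto simp: field_simps)
    have "d * (\<Sum>j<n. w j) \<le> d * (\<bar>K\<bar> * (b n + 1))"
      using order_trans[OF w(2) mult_right_mono[OF abs_ge_self]] b_n(1) d(1) by (intro mult_left_mono) auto
    also have "\<dots> \<le> e / 4 * (b n + 1)"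
      using mult_right_mono[OF d(2), of "b n + 1"] b_n(1) by (simp add: mult.assoc)
    also have "\<dots> \<le> e / 4 * (2 * b n)"
      using e b_n(1) by (intro mult_left_mono) auto
    finally have "\<bar>\<Sum>j<n. w j * x j\<bar> < e * b n"
      using split[OF elim(2)] b_n(2) e b_n(1) by (simp add: field_simps)
    then show ?case
      using b_n(1) by (simp add: field_simps)
  qed
qed

definition a_slope :: "real \<Rightarrow> real" where
  "a_slope \<beta> = (if \<beta> = 0 then 1 else \<beta>)"

context
  fixes \<beta> :: real
  assumes \<beta>: "0 \<le> \<beta>" "\<beta> \<le> 1"
begin

lemma a_slope_bounds: "0 < a_slope \<beta>" "a_slope \<beta> \<le> 1"
  using \<beta> by (auto simp: a_slope_def)

lemma a_seq_0: "a_seq \<beta> 0 = 0"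
  by (simp add: a_seq_def)

lemma
  assumes n: "1 \<le> n"
  shows a_seq_increment_ge: "a_slope \<beta> * real (Suc n) powr (\<beta> - 1) \<le> a_seq \<beta> (Suc n) - a_seq \<beta> n"
    and a_seq_increment_le: "a_seq \<beta> (Suc n) - a_seq \<beta> n \<le> a_slope \<beta> * real n powr (\<beta> - 1)"
proof -
  define f where "f x = (if \<beta> = 0 then ln x else x powr \<beta>)" for x :: real
  have deriv: "(f has_real_derivative a_slope \<beta> * x powr (\<beta> - 1)) (at x)" if "0 < x" for x
  proof (cases "\<beta> = 0")
    case True
    then have "f = ln" "a_slope \<beta> * x powr (\<beta> - 1) = 1 / x"
      using that by (auto simp: f_def a_slope_def powr_minus_divide)
    then show ?thesis
      using DERIV_ln_divide[OF that] by simp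
  next
    case False
    then have "f = (\<lambda>x. x powr \<beta>)" "a_slope \<beta> = \<beta>"
      by (auto simp: f_def a_slope_def)
    then show ?thesis
      using has_real_derivative_powr[OF that, of \<beta>] by simp
  qed
  obtain z where z: "real n < z" "z < real (Suc n)"
    "f (real (Suc n)) - f (real n) = (real (Suc n) - real n) * (a_slope \<beta> * z powr (\<beta> - 1))"
    using MVT2[of "real n" "real (Suc n)" f "\<lambda>x. a_slope \<beta> * x powr (\<beta> - 1)"] deriv n by fastforce
  have "a_seq \<beta> k = f (real k)" for k
    by (simp add: f_def a_seq_def)
  then have increment: "a_seq \<beta> (Suc n) - a_seq \<beta> n = a_slope \<beta> * z powr (\<beta> - 1)"
    using z(3) by (simp only:) simp
  have "real (Suc n) powr (\<beta> - 1) \<le> z powr (\<beta> - 1)" "z powr (\<beta> - 1) \<le> real n powr (\<beta> - 1)"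
    using z n \<beta> by (auto intro!: powr_mono2')
  then show "a_slope \<beta> * real (Suc n) powr (\<beta> - 1) \<le> a_seq \<beta> (Suc n) - a_seq \<beta> n"
    "a_seq \<beta> (Suc n) - a_seq \<beta> n \<le> a_slope \<beta> * real n powr (\<beta> - 1)"
    unfolding increment using a_slope_bounds by (auto intro!: mult_left_mono)
qed

lemma a_slope_powr_le_1: "1 \<le> n \<Longrightarrow> a_slope \<beta> * real n powr (\<beta> - 1) \<le> 1"
  using mult_mono[OF a_slope_bounds(2) powr_mono2'[of "\<beta> - 1" 1 "real n"]] \<beta> by simp

lemma slow_sequence_a_seq: "slow_sequence (a_seq \<beta>)"
proof
  show "a_seq \<beta> 0 = 0"
    by (rule a_seq_0)
  have a_seq_1: "0 \<le> a_seq \<beta> (Suc 0)" "a_seq \<beta> (Suc 0) \<le> 1"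
    by (simp_all add: a_seq_def)
  show "mono (a_seq \<beta>)"
    unfolding mono_iff_le_Suc
  proof
    fix n
    show "a_seq \<beta> n \<le> a_seq \<beta> (Suc n)"
    proof (cases n)
      case (Suc k)
      have "0 \<le> a_slope \<beta> * real (Suc n) powr (\<beta> - 1)"
        using a_slope_bounds by simp
      then show ?thesis
        using a_seq_increment_ge[of n] Suc by simp
    qed (simp add: a_seq_0 a_seq_1)
  qed
  show "a_seq \<beta> (Suc n) \<le> a_seq \<beta> n + 1" for n
    using a_seq_increment_le[of n] a_slope_powr_le_1[of n] a_seq_0 a_seq_1 by (cases n) auto
  show "filterlim (a_seq \<beta>) at_top sequentially"
  proof (cases "\<beta> = 0")
    case True
    then show ?thesis
      unfolding a_seq_def by (simp add: filterlim_compose[OF ln_at_top filterlim_real_sequentially])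
  next
    case False
    then show ?thesis
      unfolding a_seq_def using \<beta> by (simp add: filterlim_compose[OF real_powr_at_top filterlim_real_sequentially])
  qed
qed

text \<open>The term \<open>j = 0\<close> vanishes, because \<open>0 powr e = 0\<close>.\<close>

lemma sum_powr_a_seq: "\<bar>a_slope \<beta> * (\<Sum>j<n. real j powr (\<beta> - 1)) - a_seq \<beta> n\<bar> \<le> 1"
proof (cases "n = 0")
  case False
  then have "1 \<le> n" by simp
  then have "a_seq \<beta> n - a_seq \<beta> 1 \<le> a_slope \<beta> * (\<Sum>j<n. real j powr (\<beta> - 1)) \<and>
    a_slope \<beta> * (\<Sum>j<n. real j powr (\<beta> - 1)) \<le> a_seq \<beta> n - a_seq \<beta> 1 + (a_slope \<beta> - a_slope \<beta> * real n powr (\<beta> - 1))"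
  proof (induction n rule: dec_induct)
    case (step k)
    then show ?case
      using a_seq_increment_ge[OF step(1)] a_seq_increment_le[OF step(1)] by (simp add: distrib_left)
  qed simp
  moreover have "0 \<le> a_slope \<beta> * real n powr (\<beta> - 1)" "0 \<le> a_seq \<beta> 1" "a_seq \<beta> 1 \<le> 1"
    using a_slope_bounds by (auto simp: a_seq_def)
  ultimately show ?thesis
    using a_slope_bounds by linarith
qed (simp add: a_seq_0)

end

locale ibp_parameters =
  fixes \<alpha> \<beta> c u :: real
  assumes \<alpha>: "0 < \<alpha>" and \<beta>: "0 \<le> \<beta>" "\<beta> < 1" and c: "- \<beta> < c" and u: "\<beta> < u"
begin

lemma u_pos: "0 < u"
  using u \<beta> by simp

lemma Lambda_n_0: "Lambda_n \<alpha> \<beta> c 0 = \<alpha>"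
  using c \<beta> by (simp add: Lambda_n_def Gamma_real_pos[THEN less_imp_neq, symmetric])

definition Lambda_slope :: real where
  "Lambda_slope = \<alpha> * Gamma (c + 1) / Gamma (c + \<beta>)"

lemma Lambda_slope_pos: "0 < Lambda_slope"
  unfolding Lambda_slope_def using \<alpha> c \<beta> by (auto intro!: divide_pos_pos mult_pos_pos Gamma_real_pos)

lemma Lambda_n_pos: "0 \<le> s \<Longrightarrow> 0 < Lambda_n \<alpha> \<beta> c s"
  unfolding Lambda_n_def using \<alpha> c \<beta> by (intro divide_pos_pos mult_pos_pos Gamma_real_pos) auto

lemma continuous_on_Lambda_n: "continuous_on {0..} (Lambda_n \<alpha> \<beta> c)"
proof (intro continuous_at_imp_continuous_on ballI)
  fix s :: real assume "s \<in> {0..}"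
  then have "0 < c + \<beta>" "0 < c + \<beta> + s" "0 < c + 1 + s"
    using c \<beta> by auto
  then have "Gamma (c + \<beta>) * Gamma (c + 1 + s) \<noteq> 0" "c + \<beta> + s \<notin> \<int>\<^sub>\<le>\<^sub>0" "c + 1 + s \<notin> \<int>\<^sub>\<le>\<^sub>0"
    using nonpos_Ints_nonpos[of "c + \<beta> + s"] nonpos_Ints_nonpos[of "c + 1 + s"]
    by (auto simp: Gamma_real_pos[THEN less_imp_neq, symmetric])
  then show "isCont (Lambda_n \<alpha> \<beta> c) s"
    unfolding Lambda_n_def[abs_def] isCont_def by (intro tendsto_intros tendsto_Gamma)
qed

lemma Lambda_n_eq: "Lambda_n \<alpha> \<beta> c s = Lambda_slope * (Gamma (s + c + \<beta>) / Gamma (s + c + 1))"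
  by (simp add: Lambda_n_def Lambda_slope_def add_ac)

lemma lam_const_eq:
  assumes r: "0 < r"
  shows "lam_const \<alpha> \<beta> c r * a_slope \<beta> = Lambda_slope * r powr (\<beta> - 1)"
proof (cases "\<beta> = 0")
  case True
  have "c \<notin> \<int>\<^sub>\<le>\<^sub>0" "0 < Gamma c"
    using c True nonpos_Ints_nonpos[of c] by (auto intro!: Gamma_real_pos)
  then show ?thesis
    unfolding lam_const_def a_slope_def Lambda_slope_def
    using True r by (simp add: Gamma_plus1 powr_minus_divide)
next
  case False
  have "r powr (\<beta> - 1) = 1 / r powr (1 - \<beta>)"
    using powr_minus_divide[of r "1 - \<beta>"] by simp
  then show ?thesis
    using False by (simp add: lam_const_def a_slope_def Lambda_slope_def)
qed

lemma Gamma_quotient_minus_powr_le: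
  obtains D where "0 \<le> D"
    "\<And>s. u \<le> s \<Longrightarrow> \<bar>Gamma (s + c + \<beta>) / Gamma (s + c + 1) - s powr (\<beta> - 1)\<bar> \<le> D * s powr (\<beta> - 2)"
proof -
  define \<delta> where "\<delta> = 1 - \<beta> / u"
  have \<delta>: "0 < \<delta>" "\<delta> \<le> 1"
    using u u_pos \<beta> by (auto simp: \<delta>_def)
  show thesis
  proof (rule that[of "(\<bar>c\<bar> + 1) * \<delta> powr (\<beta> - 2)"])
    fix s assume s: "u \<le> s"
    then have "0 < s"
      using u_pos by simp
    have "\<beta> * u \<le> \<beta> * s"
      using s \<beta> by (intro mult_left_mono) auto
    then have "\<beta> \<le> \<beta> / u * s"
      using u_pos by (simp add: field_simps)
    then have "\<delta> * s \<le> s + c" "\<delta> * s \<le> s"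
      using c \<beta> by (auto simp: \<delta>_def algebra_simps)
    moreover have "0 < \<delta> * s"
      using \<delta> \<open>0 < s\<close> by simp
    ultimately have shift: "\<bar>(s + d) powr (\<beta> - 1) - s powr (\<beta> - 1)\<bar> \<le> (\<bar>c\<bar> + 1) * \<delta> powr (\<beta> - 2) * s powr (\<beta> - 2)"
      if "c \<le> d" "\<bar>d\<bar> \<le> \<bar>c\<bar> + 1" for d
    proof -
      have "\<bar>(s + d) powr (\<beta> - 1) - s powr (\<beta> - 1)\<bar> \<le> \<bar>\<beta> - 1\<bar> * (\<delta> * s) powr (\<beta> - 1 - 1) * \<bar>s + d - s\<bar>"
        using \<open>\<delta> * s \<le> s + c\<close> \<open>\<delta> * s \<le> s\<close> \<open>0 < \<delta> * s\<close> that \<beta> by (intro powr_lipschitz) auto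
      also have "\<dots> \<le> 1 * (\<delta> * s) powr (\<beta> - 1 - 1) * (\<bar>c\<bar> + 1)"
        using \<beta> that by (intro mult_mono) auto
      finally show ?thesis
        using \<delta> \<open>0 < s\<close> by (simp add: powr_mult mult_ac)
    qed
    have "\<bar>c + \<beta>\<bar> \<le> \<bar>c\<bar> + 1"
      using \<beta> by linarith
    moreover have "0 < s + c"
      using \<open>\<delta> * s \<le> s + c\<close> \<open>0 < \<delta> * s\<close> by simp
    ultimately show "\<bar>Gamma (s + c + \<beta>) / Gamma (s + c + 1) - s powr (\<beta> - 1)\<bar>
        \<le> (\<bar>c\<bar> + 1) * \<delta> powr (\<beta> - 2) * s powr (\<beta> - 2)"
      using Gamma_quotient_ge[of "s + c" \<beta>] Gamma_quotient_le[of "s + c" \<beta>] shift[of c] shift[of "c + \<beta>"] \<beta>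
      by (simp add: add.assoc)
  qed simp
qed

lemma Lambda_n_minus_powr_le:
  obtains D where "0 \<le> D" "\<And>s. u \<le> s \<Longrightarrow> \<bar>Lambda_n \<alpha> \<beta> c s - Lambda_slope * s powr (\<beta> - 1)\<bar> \<le> D * s powr (\<beta> - 2)"
proof -
  obtain D where D: "0 \<le> D"
    "\<And>s. u \<le> s \<Longrightarrow> \<bar>Gamma (s + c + \<beta>) / Gamma (s + c + 1) - s powr (\<beta> - 1)\<bar> \<le> D * s powr (\<beta> - 2)"
    using Gamma_quotient_minus_powr_le by blast
  show thesis
  proof (rule that[of "Lambda_slope * D"])
    fix s assume "u \<le> s"
    from mult_left_mono[OF D(2)[OF this] less_imp_le[OF Lambda_slope_pos]]
    show "\<bar>Lambda_n \<alpha> \<beta> c s - Lambda_slope * s powr (\<beta> - 1)\<bar> \<le> Lambda_slope * D * s powr (\<beta> - 2)"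
      unfolding Lambda_n_eq right_diff_distrib[symmetric] abs_mult using Lambda_slope_pos by (simp only: abs_of_pos mult.assoc)
  qed (use D(1) Lambda_slope_pos in simp)
qed

lemma u_le_of_mult_le: "1 \<le> j \<Longrightarrow> real j * u \<le> s \<Longrightarrow> u \<le> s"
  using u_pos by (intro order_trans[OF mult_right_mono[of 1 "real j" u, simplified mult_1]]) auto

lemma Lambda_n_le:
  obtains K where "0 \<le> K" "\<And>j s. 1 \<le> j \<Longrightarrow> real j * u \<le> s \<Longrightarrow> Lambda_n \<alpha> \<beta> c s \<le> K * real j powr (\<beta> - 1)"
proof -
  obtain D where D: "0 \<le> D" "\<And>s. u \<le> s \<Longrightarrow> \<bar>Lambda_n \<alpha> \<beta> c s - Lambda_slope * s powr (\<beta> - 1)\<bar> \<le> D * s powr (\<beta> - 2)"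
    using Lambda_n_minus_powr_le by blast
  define K where "K = Lambda_slope + D / u"
  have K: "0 \<le> K"
    using D Lambda_slope_pos u_pos by (simp add: K_def)
  show thesis
  proof (rule that[of "K * u powr (\<beta> - 1)"])
    fix j :: nat and s assume j: "1 \<le> j" and s: "real j * u \<le> s"
    have s_ge: "u \<le> s"
      by (rule u_le_of_mult_le[OF j s])
    have "s powr (\<beta> - 2) * u \<le> s powr (\<beta> - 2) * s"
      using s_ge by (intro mult_left_mono) auto
    also have "\<dots> = s powr (\<beta> - 1)"
      using s_ge u_pos powr_add[of s "\<beta> - 2" 1] by simp
    finally have "D * s powr (\<beta> - 2) \<le> D * (s powr (\<beta> - 1) / u)"
      using D(1) u_pos by (intro mult_left_mono) (auto simp: field_simps)
    then have "Lambda_n \<alpha> \<beta> c s \<le> K * s powr (\<beta> - 1)"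
      using D(2)[OF s_ge] by (simp add: K_def distrib_right)
    also have "\<dots> \<le> K * (real j * u) powr (\<beta> - 1)"
      using K \<beta> s j u_pos by (intro mult_left_mono powr_mono2') auto
    finally show "Lambda_n \<alpha> \<beta> c s \<le> K * u powr (\<beta> - 1) * real j powr (\<beta> - 1)"
      using u_pos by (simp add: powr_mult mult_ac)
  qed (use K in simp)
qed

lemma powr_minus_scaled_powr_le:
  assumes r: "u \<le> r" and j: "1 \<le> j" and s: "real j * u \<le> s"
  shows "\<bar>s powr (\<beta> - 1) - r powr (\<beta> - 1) * real j powr (\<beta> - 1)\<bar> \<le> u powr (\<beta> - 2) * (real j powr (\<beta> - 1) * \<bar>s / real j - r\<bar>)"
proof -
  have mean_ge: "u \<le> s / real j"
    using s j by (simp add: field_simps)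
  have "s powr (\<beta> - 1) = real j powr (\<beta> - 1) * (s / real j) powr (\<beta> - 1)"
    using j mean_ge u_pos by (simp flip: powr_mult)
  then have "\<bar>s powr (\<beta> - 1) - r powr (\<beta> - 1) * real j powr (\<beta> - 1)\<bar>
      = real j powr (\<beta> - 1) * \<bar>(s / real j) powr (\<beta> - 1) - r powr (\<beta> - 1)\<bar>"
    by (simp only: mult.commute[of "r powr (\<beta> - 1)"] right_diff_distrib[symmetric] abs_mult) simp
  also have "\<dots> \<le> real j powr (\<beta> - 1) * (1 * u powr (\<beta> - 1 - 1) * \<bar>s / real j - r\<bar>)"
    using \<beta> u_pos mean_ge r
    by (intro mult_left_mono order_trans[OF powr_lipschitz[of "\<beta> - 1" u]] mult_right_mono) auto
  finally show ?thesis
    by (simp add: mult_ac)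
qed

lemma Lambda_n_minus_scaled_powr_le:
  assumes r: "u \<le> r"
  obtains C\<^sub>1 C\<^sub>2 where "0 \<le> C\<^sub>1" "0 \<le> C\<^sub>2"
    "\<And>j s. 1 \<le> j \<Longrightarrow> real j * u \<le> s \<Longrightarrow>
      \<bar>Lambda_n \<alpha> \<beta> c s - lam_const \<alpha> \<beta> c r * a_slope \<beta> * real j powr (\<beta> - 1)\<bar>
        \<le> C\<^sub>1 * real j powr (\<beta> - 2) + C\<^sub>2 * (real j powr (\<beta> - 1) * \<bar>s / real j - r\<bar>)"
proof -
  obtain D where D: "0 \<le> D" "\<And>s. u \<le> s \<Longrightarrow> \<bar>Lambda_n \<alpha> \<beta> c s - Lambda_slope * s powr (\<beta> - 1)\<bar> \<le> D * s powr (\<beta> - 2)"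
    using Lambda_n_minus_powr_le by blast
  have r_pos: "0 < r"
    using r u_pos by simp
  show thesis
  proof (rule that[of "D * u powr (\<beta> - 2)" "Lambda_slope * u powr (\<beta> - 2)"])
    fix j :: nat and s assume j: "1 \<le> j" and s: "real j * u \<le> s"
    let ?d = "real j powr (\<beta> - 1) * \<bar>s / real j - r\<bar>"
    have "D * s powr (\<beta> - 2) \<le> D * (real j * u) powr (\<beta> - 2)"
      using D(1) \<beta> s j u_pos by (intro mult_left_mono powr_mono2') auto
    then have "\<bar>Lambda_n \<alpha> \<beta> c s - Lambda_slope * s powr (\<beta> - 1)\<bar> \<le> D * u powr (\<beta> - 2) * real j powr (\<beta> - 2)"
      using D(2)[OF u_le_of_mult_le[OF j s]] u_pos by (simp add: powr_mult mult_ac)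
    moreover have "\<bar>Lambda_slope * s powr (\<beta> - 1) - Lambda_slope * (r powr (\<beta> - 1) * real j powr (\<beta> - 1))\<bar>
        \<le> Lambda_slope * (u powr (\<beta> - 2) * ?d)"
      using mult_left_mono[OF powr_minus_scaled_powr_le[OF r j s], of Lambda_slope] Lambda_slope_pos
      by (simp only: right_diff_distrib[symmetric] abs_mult abs_of_pos)
    ultimately show "\<bar>Lambda_n \<alpha> \<beta> c s - lam_const \<alpha> \<beta> c r * a_slope \<beta> * real j powr (\<beta> - 1)\<bar>
        \<le> D * u powr (\<beta> - 2) * real j powr (\<beta> - 2) + Lambda_slope * u powr (\<beta> - 2) * ?d"
      unfolding lam_const_eq[OF r_pos] mult.assoc by linarith
  qed (use D(1) Lambda_slope_pos in simp_all)
qed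

lemma sum_Lambda_n_split:
  fixes s :: "nat \<Rightarrow> real"
  assumes "s 0 = 0" "0 < n"
  shows "(\<Sum>j<n. Lambda_n \<alpha> \<beta> c (s j)) = \<alpha> + (\<Sum>j=1..<n. Lambda_n \<alpha> \<beta> c (s j))"
proof -
  have "{..<n} = insert 0 {1..<n}"
    using assms by auto
  then show ?thesis
    by (simp add: assms Lambda_n_0)
qed

lemma sum_powr_split: "(\<Sum>j<n. real j powr e * x j) = (\<Sum>j=1..<n. real j powr e * x j)"
  by (cases "n = 0") (simp_all add: lessThan_atLeast0 sum.atLeast_Suc_lessThan)

lemma sum_Lambda_n_le:
  obtains K where "0 < K" "\<And>(s :: nat \<Rightarrow> real) n. s 0 = 0 \<Longrightarrow> (\<And>j. real j * u \<le> s j) \<Longrightarrow>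
    (\<Sum>j<n. Lambda_n \<alpha> \<beta> c (s j)) \<le> K * (a_seq \<beta> n + 1)"
proof -
  interpret slow_sequence "a_seq \<beta>"
    using \<beta> by (intro slow_sequence_a_seq) auto
  obtain K where K: "0 \<le> K" "\<And>j s. 1 \<le> j \<Longrightarrow> real j * u \<le> s \<Longrightarrow> Lambda_n \<alpha> \<beta> c s \<le> K * real j powr (\<beta> - 1)"
    using Lambda_n_le by blast
  have slope: "0 < a_slope \<beta>"
    using \<beta> by (intro a_slope_bounds) auto
  show thesis
  proof (rule that[of "\<alpha> + K / a_slope \<beta>"])
    show "0 < \<alpha> + K / a_slope \<beta>"
      using \<alpha> K(1) slope by (simp add: add_pos_nonneg)
    fix s :: "nat \<Rightarrow> real" and n assume s: "s 0 = 0" "\<And>j. real j * u \<le> s j"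
    have "(\<Sum>j=1..<n. Lambda_n \<alpha> \<beta> c (s j)) \<le> (\<Sum>j=1..<n. K * real j powr (\<beta> - 1))"
      by (intro sum_mono K(2) s) simp
    also have "\<dots> = K * (\<Sum>j<n. real j powr (\<beta> - 1))"
      using sum_powr_split[of _ "\<lambda>_. 1"] by (simp add: sum_distrib_left)
    also have "\<dots> \<le> K * ((a_seq \<beta> n + 1) / a_slope \<beta>)"
    proof (intro mult_left_mono K(1))
      show "(\<Sum>j<n. real j powr (\<beta> - 1)) \<le> (a_seq \<beta> n + 1) / a_slope \<beta>"
        using sum_powr_a_seq[of \<beta> n] \<beta> slope by (simp add: field_simps)
    qed
    finally have "(\<Sum>j=1..<n. Lambda_n \<alpha> \<beta> c (s j)) \<le> K / a_slope \<beta> * (a_seq \<beta> n + 1)"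
      by simp
    moreover have "(\<Sum>j<n. Lambda_n \<alpha> \<beta> c (s j)) \<le> \<alpha> + (\<Sum>j=1..<n. Lambda_n \<alpha> \<beta> c (s j))"
      using sum_Lambda_n_split[of s n] s(1) \<alpha> by (cases "n = 0") auto
    moreover have "\<alpha> \<le> \<alpha> * (a_seq \<beta> n + 1)"
      using a_nonneg[of n] \<alpha> by simp
    ultimately show "(\<Sum>j<n. Lambda_n \<alpha> \<beta> c (s j)) \<le> (\<alpha> + K / a_slope \<beta>) * (a_seq \<beta> n + 1)"
      unfolding distrib_right by linarith
  qed
qed

lemma lam_const_nonneg: "0 < r \<Longrightarrow> 0 \<le> lam_const \<alpha> \<beta> c r"
  using lam_const_eq[of r] Lambda_slope_pos a_slope_bounds(1)[of \<beta>] \<beta> by (simp add: zero_le_mult_iff) (metis zero_le_mult_iff less_imp_le not_less powr_ge_zero)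

lemma sum_Lambda_n_minus_a_seq_le:
  assumes r: "u \<le> r"
  obtains C\<^sub>1 C\<^sub>2 where "0 \<le> C\<^sub>1" "0 \<le> C\<^sub>2"
    "\<And>(s :: nat \<Rightarrow> real) n. s 0 = 0 \<Longrightarrow> (\<And>j. real j * u \<le> s j) \<Longrightarrow>
      \<bar>(\<Sum>j<n. Lambda_n \<alpha> \<beta> c (s j)) - lam_const \<alpha> \<beta> c r * a_seq \<beta> n\<bar>
        \<le> C\<^sub>1 + C\<^sub>2 * (\<Sum>j<n. real j powr (\<beta> - 1) * \<bar>s j / real j - r\<bar>)"
proof -
  let ?l = "lam_const \<alpha> \<beta> c r"
  obtain C\<^sub>1 C\<^sub>2 where C: "0 \<le> C\<^sub>1" "0 \<le> C\<^sub>2"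
    "\<And>j s. 1 \<le> j \<Longrightarrow> real j * u \<le> s \<Longrightarrow>
      \<bar>Lambda_n \<alpha> \<beta> c s - ?l * a_slope \<beta> * real j powr (\<beta> - 1)\<bar>
        \<le> C\<^sub>1 * real j powr (\<beta> - 2) + C\<^sub>2 * (real j powr (\<beta> - 1) * \<bar>s / real j - r\<bar>)"
    using Lambda_n_minus_scaled_powr_le[OF r] by blast
  have l: "0 \<le> ?l"
    using r u_pos by (intro lam_const_nonneg) simp
  have summable: "summable (\<lambda>j. real j powr (\<beta> - 2))"
    using \<beta> by (subst summable_real_powr_iff) auto
  define Z where "Z = (\<Sum>j. real j powr (\<beta> - 2))"
  have Z: "0 \<le> Z"
    unfolding Z_def by (intro suminf_nonneg summable) auto
  show thesis
  proof (rule that[of "\<alpha> + C\<^sub>1 * Z + ?l" C\<^sub>2])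
    fix s :: "nat \<Rightarrow> real" and n assume s: "s 0 = 0" "\<And>j. real j * u \<le> s j"
    let ?w = "\<lambda>j. real j powr (\<beta> - 1)" and ?d = "\<lambda>j. \<bar>s j / real j - r\<bar>"
    have "\<bar>(\<Sum>j=1..<n. Lambda_n \<alpha> \<beta> c (s j)) - ?l * (a_slope \<beta> * (\<Sum>j<n. ?w j))\<bar>
        = \<bar>\<Sum>j=1..<n. (Lambda_n \<alpha> \<beta> c (s j) - ?l * a_slope \<beta> * ?w j)\<bar>"
      using sum_powr_split[of "\<beta> - 1" "\<lambda>_. 1" n] by (simp add: sum_subtractf sum_distrib_left mult.assoc)
    also have "\<dots> \<le> (\<Sum>j=1..<n. C\<^sub>1 * real j powr (\<beta> - 2) + C\<^sub>2 * (?w j * ?d j))"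
      using s by (intro sum_abs[THEN order_trans] sum_mono C(3)) auto
    also have "\<dots> = C\<^sub>1 * (\<Sum>j=1..<n. real j powr (\<beta> - 2)) + C\<^sub>2 * (\<Sum>j<n. ?w j * ?d j)"
      by (simp add: sum.distrib sum_distrib_left sum_powr_split)
    also have "\<dots> \<le> C\<^sub>1 * Z + C\<^sub>2 * (\<Sum>j<n. ?w j * ?d j)"
      unfolding Z_def by (intro add_right_mono mult_left_mono sum_le_suminf summable C(1)) auto
    finally have tail: "\<bar>(\<Sum>j=1..<n. Lambda_n \<alpha> \<beta> c (s j)) - ?l * (a_slope \<beta> * (\<Sum>j<n. ?w j))\<bar>
        \<le> C\<^sub>1 * Z + C\<^sub>2 * (\<Sum>j<n. ?w j * ?d j)" .
    have "\<bar>?l * (a_slope \<beta> * (\<Sum>j<n. ?w j)) - ?l * a_seq \<beta> n\<bar> \<le> ?l"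
      using mult_left_mono[OF sum_powr_a_seq[of \<beta> n] l] \<beta> l
      by (simp add: right_diff_distrib[symmetric] abs_mult)
    moreover have "\<bar>(\<Sum>j<n. Lambda_n \<alpha> \<beta> c (s j)) - (\<Sum>j=1..<n. Lambda_n \<alpha> \<beta> c (s j))\<bar> \<le> \<alpha>"
      using sum_Lambda_n_split[of s n] s(1) \<alpha> by (cases "n = 0") auto
    ultimately show "\<bar>(\<Sum>j<n. Lambda_n \<alpha> \<beta> c (s j)) - ?l * a_seq \<beta> n\<bar>
        \<le> \<alpha> + C\<^sub>1 * Z + ?l + C\<^sub>2 * (\<Sum>j<n. ?w j * ?d j)"
      using tail by linarith
  qed (use \<alpha> C Z l in auto)
qed

end

section \<open>Measures with a finite atomic part and a diffuse part\<close>

definition atomic_plus_diffuse :: "'x::topological_space set \<Rightarrow> ('x \<Rightarrow> real) \<Rightarrow> real \<Rightarrow> 'x measure \<Rightarrow> 'x measure" where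
  "atomic_plus_diffuse S p \<theta> m =
    measure_of UNIV (sets borel) (\<lambda>A. ennreal ((\<Sum>x\<in>S \<inter> A. p x) + \<theta> * measure m A))"

lemma measure_atomic_plus_diffuse:
  fixes m :: "'x::topological_space measure"
  assumes m: "finite_measure m" "sets m = sets borel" and S: "finite S"
    and p: "\<And>x. x \<in> S \<Longrightarrow> 0 \<le> p x" and \<theta>: "0 \<le> \<theta>" and A: "A \<in> sets borel"
  shows "measure (atomic_plus_diffuse S p \<theta> m) A = (\<Sum>x\<in>S \<inter> A. p x) + \<theta> * measure m A"
proof -
  interpret m: finite_measure m by (rule m(1))
  let ?f = "\<lambda>A. ennreal ((\<Sum>x\<in>S \<inter> A. p x) + \<theta> * measure m A)"
  let ?\<delta> = "distr (point_measure S (\<lambda>x. ennreal (p x))) borel (\<lambda>x. x)"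
  let ?\<nu> = "add_measure ?\<delta> (scale_measure (ennreal \<theta>) m)"
  have emeasure_\<delta>: "emeasure ?\<delta> A = ennreal (\<Sum>x\<in>S \<inter> A. p x)" if "A \<in> sets borel" for A
  proof -
    have "emeasure ?\<delta> A = emeasure (point_measure S (\<lambda>x. ennreal (p x))) (S \<inter> A)"
      using that by (subst emeasure_distr) (auto simp: point_measure_def measurable_count_space_eq1 Int_commute cong: measurable_cong_sets)
    also have "\<dots> = ennreal (\<Sum>x\<in>S \<inter> A. p x)"
      using S p by (subst emeasure_point_measure_finite2) (auto intro!: sum_ennreal)
    finally show ?thesis .
  qed
  have emeasure_\<nu>: "emeasure ?\<nu> A = ?f A" if "A \<in> sets borel" for A
    using that m(2) \<theta> p
    by (subst ennreal_plus)
       (auto simp: emeasure_add_measure emeasure_\<delta> m.emeasure_eq_measure ennreal_mult intro!: sum_nonneg)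
  have "atomic_plus_diffuse S p \<theta> m = measure_of UNIV (sets borel) (emeasure ?\<nu>)"
    unfolding atomic_plus_diffuse_def using emeasure_\<nu> sets.sigma_sets_eq[of "borel :: 'x measure"]
    by (intro measure_of_eq) auto
  also have "\<dots> = ?\<nu>"
    using measure_of_of_measure[of ?\<nu>] by simp
  finally show ?thesis
    using \<theta> p
    by (auto simp: measure_def[of ?\<nu>] emeasure_\<nu>[OF A] intro!: enn2real_ennreal add_nonneg_nonneg sum_nonneg)
qed

lemma
  fixes m :: "'x::{metric_space, second_countable_topology} measure"
  assumes m: "prob_space m" "sets m = sets borel" and diffuse: "\<And>x. measure m {x} = 0"
    and S: "finite S" and p: "\<And>x. x \<in> S \<Longrightarrow> 0 < p x \<and> p x \<le> 1" and \<theta>: "0 < \<theta>"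
  shows atoms_of_atomic_plus_diffuse: "atoms_of (atomic_plus_diffuse S p \<theta> m) = S"
    and hazard_measure_atomic_plus_diffuse: "hazard_measure m \<theta> (atomic_plus_diffuse S p \<theta> m)"
proof -
  let ?\<nu> = "atomic_plus_diffuse S p \<theta> m"
  have measure_\<nu>: "measure ?\<nu> A = (\<Sum>x\<in>S \<inter> A. p x) + \<theta> * measure m A" if "A \<in> sets borel" for A
    using p by (intro measure_atomic_plus_diffuse prob_space.finite_measure m S less_imp_le[OF \<theta>] that) (auto intro: less_imp_le)
  have point: "measure ?\<nu> {x} = (if x \<in> S then p x else 0)" for x
    using measure_\<nu>[of "{x}"] by (simp add: diffuse)
  show atoms: "atoms_of ?\<nu> = S"
    unfolding atoms_of_def point using p by force
  show "hazard_measure m \<theta> ?\<nu>"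
  proof (intro hazard_measure.intro hazard_measure_axioms.intro m diffuse \<theta>)
    show "finite (atoms_of ?\<nu>)"
      by (simp add: atoms S)
    show "measure ?\<nu> {x} \<le> 1" for x
      using p by (simp add: point)
    have "(\<Sum>\<^sub>\<infinity>x\<in>S \<inter> A. measure ?\<nu> {x}) = (\<Sum>x\<in>S \<inter> A. p x)" for A
      using S by (subst infsum_finite) (auto simp: point intro: sum.cong)
    then show "diffuse_part ?\<nu> A = \<theta> * measure m A" if "A \<in> sets borel" for A
      unfolding diffuse_part_def atoms by (simp add: measure_\<nu>[OF that])
  qed
qed

section \<open>The weighted Indian buffet process\<close>

locale ibp = prob_space P + ibp_parameters \<alpha> \<beta> c u + m: prob_space m
  for P :: "'o measure" and \<alpha> \<beta> c u and m :: "'x::{metric_space, second_countable_topology} measure" +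
  fixes M :: "nat \<Rightarrow> 'o \<Rightarrow> 'x measure" and R :: "nat \<Rightarrow> 'o \<Rightarrow> real" and B :: "'x set"
  assumes m_sets: "sets m = sets borel" and m_diffuse: "\<And>x. measure m {x} = 0"
    and M_measurable: "\<And>n. 1 \<le> n \<Longrightarrow> M n \<in> measurable P (finite_measures borel)"
    and R_measurable: "\<And>n. 1 \<le> n \<Longrightarrow> R n \<in> borel_measurable P"
    and R_ge: "\<And>n \<omega>. 1 \<le> n \<Longrightarrow> \<omega> \<in> space P \<Longrightarrow> u \<le> R n \<omega>"
    and M_cond: "\<And>n A. A \<in> sets (finite_measures borel) \<Longrightarrow>
      AE \<omega> in P. real_cond_exp P (filt P M R n) (indicator {\<omega>\<in>space P. M (Suc n) \<omega> \<in> A}) \<omega>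
        = measure (BeP_law (ibp_nu m \<alpha> \<beta> c M R n \<omega>)) A"
    and B: "B \<in> sets borel"
begin

definition history_events :: "nat \<Rightarrow> 'o set set" where
  "history_events n =
    {{\<omega>\<in>space P. measure (M i \<omega>) A \<in> C} | i A C. i \<in> {1..n} \<and> A \<in> sets borel \<and> C \<in> sets borel} \<union>
    {{\<omega>\<in>space P. R i \<omega> \<in> C} | i C. i \<in> {1..n} \<and> C \<in> sets borel}"

lemma history_events_subset: "history_events n \<subseteq> events"
proof -
  have "{\<omega>\<in>space P. measure (M i \<omega>) A \<in> C} \<in> events"
    if "i \<in> {1..n}" "A \<in> sets borel" "C \<in> sets borel" for i A and C :: "real set"
  proof -
    have [measurable]: "(\<lambda>\<omega>. measure (M i \<omega>) A) \<in> borel_measurable P"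
      using that by (intro measurable_compose[OF M_measurable measurable_measure_finite_measures]) auto
    show ?thesis
      using that(3) by measurable
  qed
  moreover have "{\<omega>\<in>space P. R i \<omega> \<in> C} \<in> events" if "i \<in> {1..n}" "C \<in> sets borel" for i C
  proof -
    have [measurable]: "R i \<in> borel_measurable P"
      using that by (intro R_measurable) simp
    show ?thesis
      using that(2) by measurable
  qed
  ultimately show ?thesis
    unfolding history_events_def by blast
qed

lemma space_filt: "space (filt P M R n) = space P"
  by (simp add: filt_def gen_sigma_def space_measure_of_conv)

lemma sets_filt: "sets (filt P M R n) = sigma_sets (space P) (history_events n)"
  unfolding filt_def gen_sigma_def history_events_def[symmetric]
  using history_events_subset[of n] sets.space_closed[of P] by (intro sets_measure_of) (rule subset_trans)

sublocale filtered_prob_space P "filt P M R"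
proof
  show "sets (filt P M R n) \<subseteq> events" for n
    unfolding sets_filt by (rule sets.sigma_sets_subset[OF history_events_subset])
  fix n k :: nat assume "n \<le> k"
  then have "{1..n} \<subseteq> {1..k}" by auto
  then have "history_events n \<subseteq> history_events k"
    unfolding history_events_def by (intro Un_mono) blast+
  then show "sets (filt P M R n) \<subseteq> sets (filt P M R k)"
    unfolding sets_filt by (rule sigma_sets_mono')
qed (rule space_filt)

lemma M_in_space: "1 \<le> i \<Longrightarrow> \<omega> \<in> space P \<Longrightarrow> M i \<omega> \<in> space (finite_measures borel)"
  using measurable_space[OF M_measurable] .

lemma M_measurable_filt:
  assumes i: "i \<in> {1..n}"
  shows "M i \<in> measurable (filt P M R n) (finite_measures borel)"
proof (rule measurable_finite_measures)
  show "M i \<omega> \<in> space (finite_measures borel)" if "\<omega> \<in> space (filt P M R n)" for \<omega>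
    using i that by (intro M_in_space) (auto simp: space_filt)
  fix A :: "'x set" assume A: "A \<in> sets borel"
  show "(\<lambda>\<omega>. measure (M i \<omega>) A) \<in> borel_measurable (filt P M R n)"
  proof (rule measurableI)
    fix C :: "real set" assume "C \<in> sets borel"
    then have "{\<omega>\<in>space P. measure (M i \<omega>) A \<in> C} \<in> sets (filt P M R n)"
      unfolding sets_filt history_events_def using i A by (intro sigma_sets.Basic) blast
    then show "(\<lambda>\<omega>. measure (M i \<omega>) A) -` C \<inter> space (filt P M R n) \<in> sets (filt P M R n)"
      by (simp add: space_filt vimage_def Int_def conj_commute)
  qed simp
qed

lemma R_measurable_filt:
  assumes i: "i \<in> {1..n}"
  shows "R i \<in> borel_measurable (filt P M R n)"
proof (rule measurableI)
  fix C :: "real set" assume "C \<in> sets borel"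
  then have "{\<omega>\<in>space P. R i \<omega> \<in> C} \<in> sets (filt P M R n)"
    unfolding sets_filt history_events_def using i by (intro sigma_sets.Basic) blast
  then show "R i -` C \<inter> space (filt P M R n) \<in> sets (filt P M R n)"
    by (simp add: space_filt vimage_def Int_def conj_commute)
qed simp

definition R_sum :: "nat \<Rightarrow> 'o \<Rightarrow> real" where
  "R_sum n \<omega> = (\<Sum>i=1..n. R i \<omega>)"

lemma R_sum_ge: "\<omega> \<in> space P \<Longrightarrow> real n * u \<le> R_sum n \<omega>"
  unfolding R_sum_def using sum_bounded_below[of "{1..n}" u "\<lambda>i. R i \<omega>"] R_ge by simp

lemma R_sum_nonneg: "\<omega> \<in> space P \<Longrightarrow> 0 \<le> R_sum n \<omega>"
  by (rule order_trans[OF _ R_sum_ge]) (use u_pos in simp)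

lemma feat_Suc: "feat M (Suc n) \<omega> = feat M n \<omega> \<union> unit_atoms (M (Suc n) \<omega>)"
  by (auto simp: feat_def unit_atoms_def atLeastAtMostSuc_conv)

lemma finite_feat: "\<omega> \<in> space P \<Longrightarrow> finite (feat M n \<omega>)"
proof (induction n)
  case (Suc n)
  then show ?case
    using finite_unit_atoms[OF M_in_space[of "Suc n" \<omega>]] by (simp add: feat_Suc)
qed (simp add: feat_def)

lemma feat_sets: "\<omega> \<in> space P \<Longrightarrow> feat M n \<omega> \<in> sets borel"
  using finite_feat by (simp add: borel_closed finite_imp_closed)

definition atom_weight :: "nat \<Rightarrow> 'o \<Rightarrow> 'x \<Rightarrow> real" where
  "atom_weight n \<omega> x = ((\<Sum>i=1..n. R i \<omega> * measure (M i \<omega>) {x}) - \<beta>) / (R_sum n \<omega> + c)"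

lemma ibp_nu_eq:
  "ibp_nu m \<alpha> \<beta> c M R n \<omega> = atomic_plus_diffuse (feat M n \<omega>) (atom_weight n \<omega>) (Lambda_n \<alpha> \<beta> c (R_sum n \<omega>)) m"
  unfolding ibp_nu_def atomic_plus_diffuse_def atom_weight_def R_sum_def ..

lemma atom_weight_bounds:
  assumes \<omega>: "\<omega> \<in> space P" and simple: "\<forall>i\<in>{1..n}. simple_point_measure (M i \<omega>)" and x: "x \<in> feat M n \<omega>"
  shows "0 < atom_weight n \<omega> x \<and> atom_weight n \<omega> x \<le> 1"
proof -
  have R_nonneg: "0 \<le> R i \<omega>" if "i \<in> {1..n}" for i
    using R_ge[of i \<omega>] u_pos \<omega> that by auto
  obtain i where i: "i \<in> {1..n}" "measure (M i \<omega>) {x} = 1"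
    using x by (auto simp: feat_def)
  have "R i \<omega> * measure (M i \<omega>) {x} \<le> (\<Sum>i=1..n. R i \<omega> * measure (M i \<omega>) {x})"
    using i R_nonneg by (intro member_le_sum) auto
  then have "\<beta> < (\<Sum>i=1..n. R i \<omega> * measure (M i \<omega>) {x})"
    using i u R_ge[of i \<omega>] \<omega> by simp
  moreover have "(\<Sum>i=1..n. R i \<omega> * measure (M i \<omega>) {x}) \<le> R_sum n \<omega>"
    unfolding R_sum_def
  proof (intro sum_mono mult_left_le R_nonneg)
    show "measure (M i \<omega>) {x} \<le> 1" if "i \<in> {1..n}" for i
      using simple_point_measure_singleton[OF M_in_space[of i \<omega>], of x] \<omega> simple that by auto
  qed
  ultimately show ?thesis
    unfolding atom_weight_def using c by (auto simp: divide_simps)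
qed

lemma
  assumes \<omega>: "\<omega> \<in> space P" and simple: "\<forall>i\<in>{1..n}. simple_point_measure (M i \<omega>)"
  shows hazard_measure_ibp_nu: "hazard_measure m (Lambda_n \<alpha> \<beta> c (R_sum n \<omega>)) (ibp_nu m \<alpha> \<beta> c M R n \<omega>)"
    and atoms_of_ibp_nu: "atoms_of (ibp_nu m \<alpha> \<beta> c M R n \<omega>) = feat M n \<omega>"
proof -
  note assms = m.prob_space_axioms m_sets m_diffuse finite_feat[OF \<omega>] atom_weight_bounds[OF assms] Lambda_n_pos[OF R_sum_nonneg[OF \<omega>]]
  show "hazard_measure m (Lambda_n \<alpha> \<beta> c (R_sum n \<omega>)) (ibp_nu m \<alpha> \<beta> c M R n \<omega>)"
    unfolding ibp_nu_eq by (rule hazard_measure_atomic_plus_diffuse[OF assms])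
  show "atoms_of (ibp_nu m \<alpha> \<beta> c M R n \<omega>) = feat M n \<omega>"
    unfolding ibp_nu_eq by (rule atoms_of_atomic_plus_diffuse[OF assms])
qed

lemma AE_simple_point_measure_M: "AE \<omega> in P. \<forall>i\<in>{1..n}. simple_point_measure (M i \<omega>)"
proof (induction n)
  case (Suc n)
  interpret finite_measure_subalgebra P "filt P M R n"
    by unfold_locales (rule subalgebra_F)
  define A where "A = {\<mu> \<in> space (finite_measures borel). simple_point_measure (\<mu> :: 'x measure)}"
  have A: "A \<in> sets (finite_measures borel)"
    using pred_simple_point_measure by (simp add: A_def pred_def)
  let ?E = "{\<omega>\<in>space P. M (Suc n) \<omega> \<in> A}"
  have E: "?E \<in> events"
    using measurable_sets[OF M_measurable A, of "Suc n"] by (simp add: vimage_def Int_def conj_commute)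
  have "AE \<omega> in P. real_cond_exp P (filt P M R n) (indicator ?E) \<omega> = 1"
    using M_cond[OF A, of n] Suc AE_space
  proof eventually_elim
    case (elim \<omega>)
    interpret H: hazard_measure m "Lambda_n \<alpha> \<beta> c (R_sum n \<omega>)" "ibp_nu m \<alpha> \<beta> c M R n \<omega>"
      by (rule hazard_measure_ibp_nu[OF elim(3,2)])
    interpret K: prob_space "BeP_law (ibp_nu m \<alpha> \<beta> c M R n \<omega>)"
      by (rule H.prob_space_BeP_law)
    have "AE \<mu> in BeP_law (ibp_nu m \<alpha> \<beta> c M R n \<omega>). \<mu> \<in> A"
      using H.AE_simple_BeP_law AE_space
      by eventually_elim (simp add: A_def sets_eq_imp_space_eq[OF H.sets_BeP_law])
    then show ?case
      using elim(1) A by (simp add: K.prob_eq_1 H.sets_BeP_law)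
  qed
  then have "(\<integral>\<omega>. real_cond_exp P (filt P M R n) (indicator ?E) \<omega> \<partial>P) = (\<integral>\<omega>. 1 \<partial>P)"
    by (intro integral_cong_AE) auto
  moreover have "(\<integral>\<omega>. real_cond_exp P (filt P M R n) (indicator ?E) \<omega> \<partial>P) = prob ?E"
    using real_cond_exp_int(2)[of "indicator ?E"] E by (simp add: less_top[symmetric])
  ultimately have "AE \<omega> in P. M (Suc n) \<omega> \<in> A"
    using E by (simp add: prob_space prob_Collect_eq_1)
  with Suc show ?case
    by eventually_elim (auto simp: A_def le_Suc_eq)
qed simp

lemma conditional_law_M:
  "conditional_law P (filt P M R n) (finite_measures borel) (M (Suc n)) (\<lambda>\<omega>. BeP_law (ibp_nu m \<alpha> \<beta> c M R n \<omega>))"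
proof
  interpret finite_measure_subalgebra P "filt P M R n"
    by unfold_locales (rule subalgebra_F)
  let ?\<kappa> = "\<lambda>\<omega>. BeP_law (ibp_nu m \<alpha> \<beta> c M R n \<omega>)"
  show \<kappa>: "AE \<omega> in P. prob_space (?\<kappa> \<omega>) \<and> sets (?\<kappa> \<omega>) = sets (finite_measures borel)"
    using AE_simple_point_measure_M[of n] AE_space
  proof eventually_elim
    case (elim \<omega>)
    interpret H: hazard_measure m "Lambda_n \<alpha> \<beta> c (R_sum n \<omega>)" "ibp_nu m \<alpha> \<beta> c M R n \<omega>"
      by (rule hazard_measure_ibp_nu[OF elim(2,1)])
    show ?case
      by (simp add: H.prob_space_BeP_law H.sets_BeP_law)
  qed
  fix A assume A: "A \<in> sets (finite_measures (borel :: 'x measure))"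
  have "{\<omega>\<in>space P. M (Suc n) \<omega> \<in> A} \<in> events"
    using measurable_sets[OF M_measurable A, of "Suc n"] by (simp add: vimage_def Int_def conj_commute)
  from nn_cond_exp_indicator_eq_real_cond_exp[OF this] M_cond[OF A, of n] \<kappa>
  show "AE \<omega> in P. nn_cond_exp P (filt P M R n) (indicator {\<omega>\<in>space P. M (Suc n) \<omega> \<in> A}) \<omega> = emeasure (?\<kappa> \<omega>) A"
    by eventually_elim (simp add: finite_measure.emeasure_eq_measure prob_space.finite_measure)
qed (simp_all add: subalgebra_F M_measurable)

definition new_features :: "nat \<Rightarrow> 'o \<Rightarrow> 'x set" where
  "new_features n \<omega> = (B - feat M n \<omega>) \<inter> unit_atoms (M (Suc n) \<omega>)"

definition feature_count :: "nat \<Rightarrow> 'o \<Rightarrow> nat" where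
  "feature_count n \<omega> = card (B \<inter> feat M n \<omega>)"

definition feature_rate :: "nat \<Rightarrow> 'o \<Rightarrow> real" where
  "feature_rate n \<omega> = Lambda_n \<alpha> \<beta> c (R_sum n \<omega>) * measure m B"

lemma feature_count_Suc:
  assumes \<omega>: "\<omega> \<in> space P"
  shows "feature_count (Suc n) \<omega> = feature_count n \<omega> + card (new_features n \<omega>)"
proof -
  have "B \<inter> feat M (Suc n) \<omega> = (B \<inter> feat M n \<omega>) \<union> new_features n \<omega>"
    by (auto simp: feat_Suc new_features_def)
  moreover have "finite (new_features n \<omega>)"
    unfolding new_features_def using finite_unit_atoms[OF M_in_space[OF _ \<omega>]] by simp
  ultimately show ?thesis
    using finite_feat[OF \<omega>, of n] unfolding feature_count_def
    by (simp add: card_Un_disjoint new_features_def Int_Un_distrib2 disjoint_iff)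
qed

lemma pred_notin_feat: "Measurable.pred (filt P M R n \<Otimes>\<^sub>M borel) (\<lambda>p. snd p \<notin> feat M n (fst p))"
proof -
  have "{p \<in> space (filt P M R n \<Otimes>\<^sub>M borel). \<forall>i\<in>{1..n}. measure (M i (fst p)) {snd p} \<noteq> 1}
      \<in> sets (filt P M R n \<Otimes>\<^sub>M borel)"
  proof (rule sets.sets_Collect_finite_All)
    fix i assume "i \<in> {1..n}"
    note [measurable] = measurable_point_mass[OF M_measurable_filt[OF this]]
    show "{p \<in> space (filt P M R n \<Otimes>\<^sub>M borel). measure (M i (fst p)) {snd p} \<noteq> 1} \<in> sets (filt P M R n \<Otimes>\<^sub>M borel)"
      by measurable
  qed simp
  then show ?thesis
    by (simp add: feat_def pred_def)
qed

lemma card_new_features_measurable: "(\<lambda>\<omega>. card (new_features n \<omega>)) \<in> measurable (filt P M R (Suc n)) (count_space UNIV)"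
proof -
  let ?F = "filt P M R (Suc n)"
  have M_Suc: "M (Suc n) \<in> measurable ?F (finite_measures borel)"
    by (rule M_measurable_filt) simp
  have id: "(\<lambda>\<omega>. \<omega>) \<in> measurable ?F (filt P M R n)"
    by (rule measurable_F_mono[of _ n]) auto
  have [measurable]: "Measurable.pred (?F \<Otimes>\<^sub>M borel) (\<lambda>p. snd p \<notin> feat M n (fst p))"
    using measurable_compose[OF measurable_Pair[OF measurable_compose[OF measurable_fst id] measurable_snd] pred_notin_feat]
    by simp
  note [measurable] = measurable_point_mass[OF M_Suc] B
  have "(SIGMA \<omega>:space ?F. new_features n \<omega>)
      = {p \<in> space (?F \<Otimes>\<^sub>M borel). snd p \<in> B \<and> snd p \<notin> feat M n (fst p) \<and> measure (M (Suc n) (fst p)) {snd p} = 1}"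
    by (auto simp: new_features_def unit_atoms_def space_pair_measure)
  also have "\<dots> \<in> sets (?F \<Otimes>\<^sub>M borel)"
    by measurable
  finally have "(\<lambda>\<omega>. measure (M (Suc n) \<omega>) (new_features n \<omega>)) \<in> borel_measurable ?F"
    by (rule measurable_measure_finite_kernel[OF _ M_Suc])
  then have "(\<lambda>\<omega>. nat \<lfloor>measure (M (Suc n) \<omega>) (new_features n \<omega>)\<rfloor>) \<in> measurable ?F (count_space UNIV)"
    by measurable
  then show ?thesis
  proof (rule measurable_cong[THEN iffD1, rotated])
    fix \<omega> assume "\<omega> \<in> space ?F"
    then have "M (Suc n) \<omega> \<in> space (finite_measures borel)"
      by (intro M_in_space) (simp_all add: space_filt)
    then show "nat \<lfloor>measure (M (Suc n) \<omega>) (new_features n \<omega>)\<rfloor> = card (new_features n \<omega>)"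
      by (subst measure_finite_subset_unit_atoms) (auto simp: new_features_def finite_unit_atoms)
  qed
qed

lemma feature_count_measurable: "feature_count n \<in> measurable (filt P M R n) (count_space UNIV)"
proof (induction n)
  case 0
  show ?case
    by (simp add: feature_count_def feat_def)
next
  case (Suc n)
  have [measurable]: "feature_count n \<in> measurable (filt P M R (Suc n)) (count_space UNIV)"
    using Suc by (rule measurable_F_mono) simp
  note card_new_features_measurable[measurable]
  have "(\<lambda>\<omega>. feature_count n \<omega> + card (new_features n \<omega>)) \<in> measurable (filt P M R (Suc n)) (count_space UNIV)"
    by measurable
  then show ?case
    by (rule measurable_cong[THEN iffD1, rotated]) (simp add: feature_count_Suc space_filt)
qed

lemma feature_rate_measurable: "feature_rate n \<in> borel_measurable (filt P M R n)"
proof -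
  have [measurable]: "Lambda_n \<alpha> \<beta> c \<in> borel_measurable (restrict_space borel {0..})"
    by (rule borel_measurable_continuous_on_restrict[OF continuous_on_Lambda_n])
  have "R_sum n \<in> borel_measurable (filt P M R n)"
    unfolding R_sum_def by (intro borel_measurable_sum R_measurable_filt)
  then have "R_sum n \<in> measurable (filt P M R n) (restrict_space borel {0..})"
    using R_sum_nonneg by (intro measurable_restrict_space2) (auto simp: space_filt)
  then show ?thesis
    unfolding feature_rate_def by measurable
qed

lemma measure_m_Diff_feat:
  assumes "\<omega> \<in> space P"
  shows "measure m (B - feat M n \<omega>) = measure m B"
proof -
  have "AE x in m. x \<notin> feat M n \<omega>"
    by (intro AE_notin_finite_of_diffuse m.finite_measure_axioms m_sets m_diffuse finite_feat assms)
  then show ?thesis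
    using B feat_sets[OF assms] m_sets by (intro m.finite_measure_eq_AE) auto
qed

lemma sets_off_feat_count:
  "{p \<in> space (filt P M R n \<Otimes>\<^sub>M finite_measures borel). measure (snd p) (B - feat M n (fst p)) = real k}
    \<in> sets (filt P M R n \<Otimes>\<^sub>M finite_measures borel)"
proof -
  let ?FG = "filt P M R n \<Otimes>\<^sub>M finite_measures (borel :: 'x measure)"
  have [measurable]: "Measurable.pred (?FG \<Otimes>\<^sub>M borel) (\<lambda>q. snd q \<notin> feat M n (fst (fst q)))"
    using measurable_compose[OF measurable_Pair[OF measurable_compose[OF measurable_fst measurable_fst] measurable_snd] pred_notin_feat]
    by simp
  note [measurable] = B
  have "(SIGMA p:space ?FG. B - feat M n (fst p)) = {q \<in> space (?FG \<Otimes>\<^sub>M borel). snd q \<in> B \<and> snd q \<notin> feat M n (fst (fst q))}"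
    by (auto simp: space_pair_measure)
  also have "\<dots> \<in> sets (?FG \<Otimes>\<^sub>M borel)"
    by measurable
  finally have [measurable]: "(\<lambda>p. measure (snd p) (B - feat M n (fst p))) \<in> borel_measurable ?FG"
    by (rule measurable_measure_finite_kernel[OF _ measurable_snd])
  show ?thesis
    by measurable
qed

lemma AE_feature_increment_iff:
  "AE \<omega> in P. feature_count (Suc n) \<omega> - feature_count n \<omega> = k \<longleftrightarrow> measure (M (Suc n) \<omega>) (B - feat M n \<omega>) = real k"
  using AE_simple_point_measure_M[of "Suc n"] AE_space
proof eventually_elim
  case (elim \<omega>)
  have "measure (M (Suc n) \<omega>) (B - feat M n \<omega>) = real (card (new_features n \<omega>))"
    unfolding new_features_def using elim B feat_sets[OF elim(2)]
    by (intro measure_simple_point_measure M_in_space) auto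
  then show ?case
    using elim(2) by (simp add: feature_count_Suc)
qed

lemma feature_increment_law:
  "AE \<omega> in P. nn_cond_exp P (filt P M R n) (indicator {\<omega>\<in>space P. feature_count (Suc n) \<omega> - feature_count n \<omega> = k}) \<omega>
    = ennreal (poisson_prob (feature_rate n \<omega>) k)"
proof -
  interpret C: conditional_law P "filt P M R n" "finite_measures borel" "M (Suc n)" "\<lambda>\<omega>. BeP_law (ibp_nu m \<alpha> \<beta> c M R n \<omega>)"
    by (rule conditional_law_M)
  let ?W = "{p \<in> space (filt P M R n \<Otimes>\<^sub>M finite_measures borel). measure (snd p) (B - feat M n (fst p)) = real k}"
  let ?I = "indicator {\<omega>\<in>space P. feature_count (Suc n) \<omega> - feature_count n \<omega> = k} :: 'o \<Rightarrow> ennreal"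
  have "AE \<omega> in P. ?I \<omega> = indicator (C.graph_event ?W) \<omega>"
    using AE_feature_increment_iff[of n k] AE_space
    by eventually_elim (auto simp: C.graph_event_def space_pair_measure space_filt indicator_def intro: M_in_space)
  moreover have "?I \<in> borel_measurable P"
    using measurable_F_M[OF feature_count_measurable, of n] measurable_F_M[OF feature_count_measurable, of "Suc n"] by measurable
  ultimately have "AE \<omega> in P. nn_cond_exp P (filt P M R n) ?I \<omega> = nn_cond_exp P (filt P M R n) (indicator (C.graph_event ?W)) \<omega>"
    using C.sets_graph_event[OF sets_off_feat_count[of n k]] by (intro C.nn_cond_exp_cong) auto
  then show ?thesis
    using C.nn_cond_exp_section[OF sets_off_feat_count[of n k], folded C.graph_event_def] AE_simple_point_measure_M[of n] AE_space
  proof eventually_elim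
    case (elim \<omega>)
    interpret H: hazard_measure m "Lambda_n \<alpha> \<beta> c (R_sum n \<omega>)" "ibp_nu m \<alpha> \<beta> c M R n \<omega>"
      by (rule hazard_measure_ibp_nu[OF elim(4,3)])
    interpret K: prob_space "BeP_law (ibp_nu m \<alpha> \<beta> c M R n \<omega>)"
      by (rule H.prob_space_BeP_law)
    have "Pair \<omega> -` ?W = {\<mu>\<in>space (finite_measures borel). measure \<mu> (B - feat M n \<omega>) = real k}"
      using elim(4) by (auto simp: space_pair_measure space_filt)
    then show ?case
      using elim B feat_sets[OF elim(4), of n] H.measure_BeP_law_off_atoms[of "B - feat M n \<omega>" k]
      by (simp add: atoms_of_ibp_nu measure_m_Diff_feat feature_rate_def K.emeasure_eq_measure disjoint_iff)
  qed
qed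

sublocale cond_poisson_process P "filt P M R" feature_count feature_rate
proof
  show "0 \<le> feature_rate n \<omega>" if "\<omega> \<in> space P" for n \<omega>
    unfolding feature_rate_def using Lambda_n_pos[OF R_sum_nonneg[OF that]] by (intro mult_nonneg_nonneg) (auto intro: less_imp_le)
  show "feature_count 0 \<omega> = 0" for \<omega>
    by (simp add: feature_count_def feat_def)
  show "feature_count n \<omega> \<le> feature_count (Suc n) \<omega>" if "\<omega> \<in> space P" for n \<omega>
    using that by (simp add: feature_count_Suc)
qed (fact feature_count_measurable feature_rate_measurable feature_increment_law)+

lemma ex_normalized_cond_poisson_process:
  "\<exists>C. normalized_cond_poisson_process P (filt P M R) feature_count feature_rate (a_seq \<beta>) C"
proof -
  obtain K where K: "0 < K" "\<And>(s :: nat \<Rightarrow> real) n. s 0 = 0 \<Longrightarrow> (\<And>j. real j * u \<le> s j) \<Longrightarrow>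
      (\<Sum>j<n. Lambda_n \<alpha> \<beta> c (s j)) \<le> K * (a_seq \<beta> n + 1)"
    using sum_Lambda_n_le by blast
  have "compensator n \<omega> \<le> K * (a_seq \<beta> n + 1)" if \<omega>: "\<omega> \<in> space P" for n \<omega>
  proof -
    have "compensator n \<omega> = (\<Sum>j<n. Lambda_n \<alpha> \<beta> c (R_sum j \<omega>)) * measure m B"
      by (simp add: compensator_def feature_rate_def sum_distrib_right)
    also have "\<dots> \<le> (\<Sum>j<n. Lambda_n \<alpha> \<beta> c (R_sum j \<omega>)) * 1"
      using Lambda_n_pos[OF R_sum_nonneg[OF \<omega>]] by (intro mult_left_mono sum_nonneg m.prob_le_1) (auto intro: less_imp_le)
    also have "\<dots> \<le> K * (a_seq \<beta> n + 1)"
      using K(2)[of "\<lambda>j. R_sum j \<omega>" n] R_sum_ge[OF \<omega>] by (simp add: R_sum_def)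
    finally show ?thesis .
  qed
  then have "normalized_cond_poisson_process P (filt P M R) feature_count feature_rate (a_seq \<beta>) K"
    using \<beta> K(1)
    by (intro normalized_cond_poisson_process.intro normalized_cond_poisson_process_axioms.intro
        cond_poisson_process_axioms slow_sequence_a_seq) auto
  then show ?thesis ..
qed

end

locale ibp_lln = ibp P \<alpha> \<beta> c u m M R B
    for P :: "'o measure" and \<alpha> \<beta> c u and m :: "'x::{metric_space, second_countable_topology} measure" and M R B +
  fixes r :: real
  assumes R_mean_lim: "AE \<omega> in P. (\<lambda>n. R_sum n \<omega> / real n) \<longlonglongrightarrow> r"
begin

lemma u_le_r: "u \<le> r"
proof -
  have "AE \<omega> in P. u \<le> r"
    using R_mean_lim AE_space
  proof eventually_elim
    case (elim \<omega>)
    have "eventually (\<lambda>n. u \<le> R_sum n \<omega> / real n) sequentially"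
      using eventually_gt_at_top[of 0] by eventually_elim (use R_sum_ge[OF elim(2)] in \<open>simp add: field_simps\<close>)
    then show ?case
      by (intro tendsto_lowerbound[OF elim(1)]) auto
  qed
  then show ?thesis by simp
qed

definition limit_const :: real where
  "limit_const = measure m B * lam_const \<alpha> \<beta> c r"

definition weighted_deviation :: "nat \<Rightarrow> 'o \<Rightarrow> real" where
  "weighted_deviation n \<omega> = (\<Sum>j<n. real j powr (\<beta> - 1) * \<bar>R_sum j \<omega> / real j - r\<bar>)"

lemma compensator_minus_a_seq_le:
  obtains C\<^sub>1 C\<^sub>2 where "0 \<le> C\<^sub>1" "0 \<le> C\<^sub>2"
    "\<And>n \<omega>. \<omega> \<in> space P \<Longrightarrow> \<bar>compensator n \<omega> - limit_const * a_seq \<beta> n\<bar> \<le> C\<^sub>1 + C\<^sub>2 * weighted_deviation n \<omega>"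
proof -
  obtain C\<^sub>1 C\<^sub>2 where C: "0 \<le> C\<^sub>1" "0 \<le> C\<^sub>2" "\<And>(s :: nat \<Rightarrow> real) n. s 0 = 0 \<Longrightarrow> (\<And>j. real j * u \<le> s j) \<Longrightarrow>
      \<bar>(\<Sum>j<n. Lambda_n \<alpha> \<beta> c (s j)) - lam_const \<alpha> \<beta> c r * a_seq \<beta> n\<bar>
        \<le> C\<^sub>1 + C\<^sub>2 * (\<Sum>j<n. real j powr (\<beta> - 1) * \<bar>s j / real j - r\<bar>)"
    using sum_Lambda_n_minus_a_seq_le[OF u_le_r] by blast
  show thesis
  proof (rule that[OF C(1,2)])
    fix n \<omega> assume \<omega>: "\<omega> \<in> space P"
    let ?D = "(\<Sum>j<n. Lambda_n \<alpha> \<beta> c (R_sum j \<omega>)) - lam_const \<alpha> \<beta> c r * a_seq \<beta> n"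
    have "compensator n \<omega> - limit_const * a_seq \<beta> n = measure m B * ?D"
      by (simp add: compensator_def feature_rate_def limit_const_def sum_distrib_left right_diff_distrib mult_ac)
    then have "\<bar>compensator n \<omega> - limit_const * a_seq \<beta> n\<bar> \<le> 1 * \<bar>?D\<bar>"
      unfolding abs_mult by (simp add: abs_mult mult_left_le_one_le)
    also have "1 * \<bar>?D\<bar> \<le> C\<^sub>1 + C\<^sub>2 * weighted_deviation n \<omega>"
      using C(3)[of "\<lambda>j. R_sum j \<omega>" n] R_sum_ge[OF \<omega>] by (simp add: R_sum_def weighted_deviation_def)
    finally show "\<bar>compensator n \<omega> - limit_const * a_seq \<beta> n\<bar> \<le> C\<^sub>1 + C\<^sub>2 * weighted_deviation n \<omega>" .
  qed
qed

lemma AE_weighted_deviation_lim: "AE \<omega> in P. (\<lambda>n. weighted_deviation n \<omega> / a_seq \<beta> n) \<longlonglongrightarrow> 0"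
proof -
  interpret slow_sequence "a_seq \<beta>"
    using \<beta> by (intro slow_sequence_a_seq) auto
  have slope: "0 < a_slope \<beta>"
    using \<beta> by (intro a_slope_bounds) auto
  have weights: "(\<Sum>j<n. real j powr (\<beta> - 1)) \<le> 1 / a_slope \<beta> * (a_seq \<beta> n + 1)" for n
  proof -
    have "a_slope \<beta> * (\<Sum>j<n. real j powr (\<beta> - 1)) \<le> a_seq \<beta> n + 1"
      using sum_powr_a_seq[of \<beta> n] \<beta> by simp
    then show ?thesis
      using slope by (simp add: pos_le_divide_eq mult.commute)
  qed
  show ?thesis
    using R_mean_lim
  proof eventually_elim
    case (elim \<omega>)
    show ?case
      unfolding weighted_deviation_def
      by (rule weighted_cesaro_null[OF _ weights a_at_top tendsto_rabs_zero[OF LIM_zero[OF elim]]]) simp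
  qed
qed

lemma AE_compensator_lim: "AE \<omega> in P. (\<lambda>n. compensator n \<omega> / a_seq \<beta> n) \<longlonglongrightarrow> limit_const"
proof -
  interpret slow_sequence "a_seq \<beta>"
    using \<beta> by (intro slow_sequence_a_seq) auto
  obtain C\<^sub>1 C\<^sub>2 where C: "0 \<le> C\<^sub>1" "0 \<le> C\<^sub>2" "\<And>n \<omega>. \<omega> \<in> space P \<Longrightarrow>
      \<bar>compensator n \<omega> - limit_const * a_seq \<beta> n\<bar> \<le> C\<^sub>1 + C\<^sub>2 * weighted_deviation n \<omega>"
    using compensator_minus_a_seq_le by metis
  show ?thesis
    using AE_weighted_deviation_lim AE_space
  proof eventually_elim
    case (elim \<omega>)
    have "(\<lambda>n. compensator n \<omega> / a_seq \<beta> n - limit_const) \<longlonglongrightarrow> 0"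
    proof (rule Lim_null_comparison)
      show "(\<lambda>n. C\<^sub>1 / a_seq \<beta> n + C\<^sub>2 * (weighted_deviation n \<omega> / a_seq \<beta> n)) \<longlonglongrightarrow> 0"
        by (intro tendsto_add_zero tendsto_const_div_a tendsto_mult_right_zero elim)
      show "eventually (\<lambda>n. norm (compensator n \<omega> / a_seq \<beta> n - limit_const)
          \<le> C\<^sub>1 / a_seq \<beta> n + C\<^sub>2 * (weighted_deviation n \<omega> / a_seq \<beta> n)) sequentially"
        using eventually_a_ge_1
      proof eventually_elim
        case (elim n)
        then have "compensator n \<omega> / a_seq \<beta> n - limit_const = (compensator n \<omega> - limit_const * a_seq \<beta> n) / a_seq \<beta> n"
          by (simp add: diff_divide_distrib)
        then have "norm (compensator n \<omega> / a_seq \<beta> n - limit_const) = \<bar>compensator n \<omega> - limit_const * a_seq \<beta> n\<bar> / a_seq \<beta> n"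
          using elim by (simp add: abs_divide)
        also have "\<dots> \<le> (C\<^sub>1 + C\<^sub>2 * weighted_deviation n \<omega>) / a_seq \<beta> n"
          using elim by (intro divide_right_mono C(3) \<open>\<omega> \<in> space P\<close>) auto
        finally show ?case
          by (simp add: add_divide_distrib)
      qed
    qed
    then show ?case
      by (rule LIM_zero_cancel)
  qed
qed

theorem AE_LIMSEQ_feature_count: "AE \<omega> in P. (\<lambda>n. real (feature_count n \<omega>) / a_seq \<beta> n) \<longlonglongrightarrow> limit_const"
proof -
  obtain C where "normalized_cond_poisson_process P (filt P M R) feature_count feature_rate (a_seq \<beta>) C"
    using ex_normalized_cond_poisson_process ..
  then show ?thesis
    by (rule normalized_cond_poisson_process.AE_LIMSEQ_N_div_a[OF _ AE_compensator_lim])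
qed

lemma compensator_L1:
  assumes int: "\<And>j. 1 \<le> j \<Longrightarrow> integrable P (\<lambda>\<omega>. \<bar>R_sum j \<omega> / real j - r\<bar>)"
    and L1: "(\<lambda>n. (\<Sum>j=1..n. real j powr (\<beta> - 1) * (\<integral>\<omega>. \<bar>R_sum j \<omega> / real j - r\<bar> \<partial>P)) / sqrt (a_seq \<beta> n)) \<longlonglongrightarrow> 0"
  shows "(\<lambda>n. (\<integral>\<omega>. \<bar>compensator n \<omega> - limit_const * a_seq \<beta> n\<bar> \<partial>P) / sqrt (a_seq \<beta> n)) \<longlonglongrightarrow> 0"
proof -
  interpret slow_sequence "a_seq \<beta>"
    using \<beta> by (intro slow_sequence_a_seq) auto
  obtain C\<^sub>1 C\<^sub>2 where C: "0 \<le> C\<^sub>1" "0 \<le> C\<^sub>2" "\<And>n \<omega>. \<omega> \<in> space P \<Longrightarrow>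
      \<bar>compensator n \<omega> - limit_const * a_seq \<beta> n\<bar> \<le> C\<^sub>1 + C\<^sub>2 * weighted_deviation n \<omega>"
    using compensator_minus_a_seq_le by metis
  let ?S = "\<lambda>n. \<Sum>j=1..n. real j powr (\<beta> - 1) * (\<integral>\<omega>. \<bar>R_sum j \<omega> / real j - r\<bar> \<partial>P)"
  have dev_eq: "weighted_deviation n \<omega> = (\<Sum>j=1..<n. real j powr (\<beta> - 1) * \<bar>R_sum j \<omega> / real j - r\<bar>)" for n \<omega>
    unfolding weighted_deviation_def by (rule sum_powr_split)
  have dev_int: "integrable P (weighted_deviation n)" for n
    unfolding dev_eq[abs_def] by (intro Bochner_Integration.integrable_sum integrable_mult_right int) simp
  have dev_le: "(\<integral>\<omega>. weighted_deviation n \<omega> \<partial>P) \<le> ?S n" for n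
  proof -
    have "(\<integral>\<omega>. weighted_deviation n \<omega> \<partial>P) = (\<Sum>j=1..<n. real j powr (\<beta> - 1) * (\<integral>\<omega>. \<bar>R_sum j \<omega> / real j - r\<bar> \<partial>P))"
      unfolding dev_eq using int by (subst Bochner_Integration.integral_sum) auto
    also have "\<dots> \<le> ?S n"
      by (intro sum_mono2) auto
    finally show ?thesis .
  qed
  show ?thesis
  proof (rule Lim_null_comparison)
    show "(\<lambda>n. C\<^sub>1 / sqrt (a_seq \<beta> n) + C\<^sub>2 * (?S n / sqrt (a_seq \<beta> n))) \<longlonglongrightarrow> 0"
      by (intro tendsto_add_zero tendsto_const_div_sqrt_a tendsto_mult_right_zero L1)
    show "eventually (\<lambda>n. norm ((\<integral>\<omega>. \<bar>compensator n \<omega> - limit_const * a_seq \<beta> n\<bar> \<partial>P) / sqrt (a_seq \<beta> n))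
        \<le> C\<^sub>1 / sqrt (a_seq \<beta> n) + C\<^sub>2 * (?S n / sqrt (a_seq \<beta> n))) sequentially"
    proof (intro always_eventually allI)
      fix n
      have "(\<integral>\<omega>. \<bar>compensator n \<omega> - limit_const * a_seq \<beta> n\<bar> \<partial>P) \<le> (\<integral>\<omega>. C\<^sub>1 + C\<^sub>2 * weighted_deviation n \<omega> \<partial>P)"
        using dev_int order_trans[OF abs_ge_zero C(3)]
        by (intro integral_mono_AE' AE_I2 C(3) Bochner_Integration.integrable_add integrable_mult_right) auto
      also have "\<dots> = C\<^sub>1 + C\<^sub>2 * (\<integral>\<omega>. weighted_deviation n \<omega> \<partial>P)"
        using dev_int[of n] by (simp add: prob_space)
      also have "\<dots> \<le> C\<^sub>1 + C\<^sub>2 * ?S n"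
        by (intro add_left_mono mult_left_mono dev_le C(2))
      finally have "(\<integral>\<omega>. \<bar>compensator n \<omega> - limit_const * a_seq \<beta> n\<bar> \<partial>P) / sqrt (a_seq \<beta> n) \<le> (C\<^sub>1 + C\<^sub>2 * ?S n) / sqrt (a_seq \<beta> n)"
        using a_nonneg[of n] by (intro divide_right_mono) auto
      then show "norm ((\<integral>\<omega>. \<bar>compensator n \<omega> - limit_const * a_seq \<beta> n\<bar> \<partial>P) / sqrt (a_seq \<beta> n))
          \<le> C\<^sub>1 / sqrt (a_seq \<beta> n) + C\<^sub>2 * (?S n / sqrt (a_seq \<beta> n))"
        using a_nonneg[of n] by (simp add: add_divide_distrib)
    qed
  qed
qed

theorem feature_count_stably_to_gauss0:
  assumes "\<And>j. 1 \<le> j \<Longrightarrow> integrable P (\<lambda>\<omega>. \<bar>R_sum j \<omega> / real j - r\<bar>)"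
    and "(\<lambda>n. (\<Sum>j=1..n. real j powr (\<beta> - 1) * (\<integral>\<omega>. \<bar>R_sum j \<omega> / real j - r\<bar> \<partial>P)) / sqrt (a_seq \<beta> n)) \<longlonglongrightarrow> 0"
  shows "stably_to P (\<lambda>n \<omega>. sqrt (a_seq \<beta> n) * (real (feature_count n \<omega>) / a_seq \<beta> n - limit_const)) (\<lambda>_. gauss0 limit_const)"
proof -
  obtain C where "normalized_cond_poisson_process P (filt P M R) feature_count feature_rate (a_seq \<beta>) C"
    using ex_normalized_cond_poisson_process ..
  then interpret poisson_process_clt P "filt P M R" feature_count feature_rate "a_seq \<beta>" C limit_const
    by (intro poisson_process_clt.intro poisson_process_clt_axioms.intro AE_compensator_lim compensator_L1 assms)
  show ?thesis
    using fluctuation_stably_to_gauss0 unfolding fluctuation_def[abs_def] .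
qed

end

theorem theorem7:
  fixes P :: "'o measure"
    and m :: "'x::{metric_space, second_countable_topology} measure"
    and M :: "nat \<Rightarrow> 'o \<Rightarrow> 'x measure"
    and R :: "nat \<Rightarrow> 'o \<Rightarrow> real"
    and \<alpha> \<beta> c r :: real
    and B :: "'x set"
  assumes P: "prob_space P"
    and m_prob: "prob_space m" and m_sets: "sets m = sets borel"
    and m_diffuse: "\<forall>x. measure m {x} = 0"
    and \<alpha>: "\<alpha> > 0" and \<beta>: "0 \<le> \<beta>" "\<beta> < 1" and c: "c > - \<beta>"
    and M_rm: "\<forall>n\<ge>1. random_measure P (M n)"
    and R_rv: "\<forall>n\<ge>1. R n \<in> borel_measurable P"
    and R_indep: "\<forall>n\<ge>1. prob_space.indep_set P
                   (sets (sigma (space P) {{\<omega>\<in>space P. R n \<omega> \<in> C} | C. C \<in> sets (borel :: real measure)}))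
                   (sets (gen_sigma P M R n (n - 1)))"
    and R_lower: "\<exists>u. u > max \<beta> 0 \<and> (\<forall>n\<ge>1. \<forall>\<omega>\<in>space P. R n \<omega> \<ge> u)"
    and M_cond: "\<forall>n. \<forall>A\<in>sets (finite_measures (borel :: 'x measure)).
                   AE \<omega> in P. real_cond_exp P (filt P M R n)
                       (indicator {\<omega>\<in>space P. M (Suc n) \<omega> \<in> A}) \<omega>
                     = measure (BeP_law (ibp_nu m \<alpha> \<beta> c M R n \<omega>)) A"
    and B: "B \<in> sets borel"
    and Rbar: "AE \<omega> in P. (\<lambda>n. (\<Sum>i=1..n. R i \<omega>) / real n) \<longlonglongrightarrow> r"
  shows "(AE \<omega> in P. (\<lambda>n. real (card (B \<inter> feat M n \<omega>)) / a_seq \<beta> n)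
             \<longlonglongrightarrow> measure m B * lam_const \<alpha> \<beta> c r)
       \<and> (((\<forall>j\<ge>1. integrable P (\<lambda>\<omega>. \<bar>(\<Sum>i=1..j. R i \<omega>) / real j - r\<bar>)) \<and>
            (\<lambda>n. (\<Sum>j=1..n. real j powr (\<beta> - 1) *
                     (\<integral>\<omega>. \<bar>(\<Sum>i=1..j. R i \<omega>) / real j - r\<bar> \<partial>P)) / sqrt (a_seq \<beta> n))
              \<longlonglongrightarrow> 0)
          \<longrightarrow> stably_to P
                (\<lambda>n \<omega>. sqrt (a_seq \<beta> n) *
                   (real (card (B \<inter> feat M n \<omega>)) / a_seq \<beta> n - measure m B * lam_const \<alpha> \<beta> c r))
                (\<lambda>_. gauss0 (measure m B * lam_const \<alpha> \<beta> c r)))"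
proof -
  obtain u where u: "u > max \<beta> 0" "\<And>n \<omega>. 1 \<le> n \<Longrightarrow> \<omega> \<in> space P \<Longrightarrow> u \<le> R n \<omega>"
    using R_lower by blast
  interpret ibp P \<alpha> \<beta> c u m M R B
  proof (intro ibp.intro ibp_parameters.intro ibp_axioms.intro P m_prob m_sets \<alpha> \<beta> c B)
    show "\<beta> < u"
      using u(1) by simp
    show "M n \<in> measurable P (finite_measures borel)" if "1 \<le> n" for n
      using M_rm that by (simp add: random_measure_iff_measurable)
  qed (use m_diffuse R_rv u(2) M_cond in blast)+
  interpret ibp_lln P \<alpha> \<beta> c u m M R B r
    by unfold_locales (use Rbar in \<open>simp add: R_sum_def\<close>)
  show ?thesis
    using AE_LIMSEQ_feature_count feature_count_stably_to_gauss0
    unfolding feature_count_def R_sum_def limit_const_def by blast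
qed

end
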